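(* The $(\mathcal I(2),\mathcal I(2))$-bimodule $\mathcal X^{DA}$ with the operations $\delta^1_i$ ($i\ge 1$) listed in the context is a valid $DA$ bimodule over $(\mathcal B(2),\mathcal B(2))$.
   Context: Let $\mathbb F=\mathbb F_2$. **The algebra $\mathcal B(2)$.** $\mathcal B(2)$ is the $\mathbb F$-path algebra of the following quiver modulo relations. Vertices: all subsets $\mathbf x\subset\{0,1,2\}$. For $i\in\{1,2\}$: an arrow $R_i$ from $\mathbf x$ to $(\mathbf x\setminus\{i-1\})\cup\{i\}$ whenever $\mathbf x\cap\{i-1,i\}=\{i-1\}$; an arrow $L_i$ from $\mathbf x$ to $(\mathbf x\setminus\{i\})\cup\{i-1\}$ whenever $\mathbf x\cap\{i-1,i\}=\{i\}$; a loop $U_i$ at every $\mathbf x$. Paths are multiplied left to right: an arrow from $\mathbf x$ to $\mathbf y$ is an element of $\mathbf I_{\mathbf x}\mathcal B(2)\mathbf I_{\mathbf y}$ (left idempotent $\mathbf I_{\mathbf x}$, right idempotent $\mathbf I_{\mathbf y}$), where $\mathbf I_{\mathbf x}$ is the trivial path at $\mathbf x$. Relations, wherever composable: $U_i$ commutes with all labels; $R_iL_i=U_i$; $L_iR_i=U_i$; $R_1R_2=0$; $L_2L_1=0$; and $U_i=0$ at $\mathbf x$ if $\mathbf x\cap\{i-1,i\}=\varnothing$. $\mathcal I(2)$ is the subring spanned by the $\mathbf I_{\mathbf x}$. The differential of $\mathcal B(2)$ is zero. $\mathcal B(2)=\bigoplus_{k=0}^3\mathcal B(2,k)$, where $\mathcal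 B(2,k)$ is the part with $|\mathbf x|=k$. Write $A=\{0\},B=\{1\},C=\{2\},AB=\{0,1\},AC=\{0,2\},BC=\{1,2\},ABC=\{0,1,2\}$. $\mathcal B(2)$ has homological degree $0$ and Alexander degree in $\mathbb Z^4=\mathbb Z\langle\tau_1,\beta_1,\tau_2,\beta_2\rangle$ given by $R_i\mapsto\tau_i$, $L_i\mapsto\beta_i$, $U_i\mapsto\tau_i+\beta_i$. Basis of $\mathcal B(2)$ used to specify operations ($i,j\ge0$): $k=0$: $\mathbf I_\varnothing$. $k=1$: from $A$ to $A$: $U_1^i$; $A$ to $B$: $R_1U_1^i$; $B$ to $A$: $L_1U_1^i$; $B$ to $B$: $\mathbf I_B$, $U_1^{i+1}$, $U_2^{i+1}$; $B$ to $C$: $R_2U_2^i$; $C$ to $B$: $L_2U_2^i$; $C$ to $C$: $U_2^i$; none between $A$ and $C$. $k=2$: $pU_1^iU_2^j$, where $p$ is: the idempotent (each vertex to itself); $R_2$ ($AB$ to $AC$); $R_2R_1$ ($AB$ to $BC$); $L_2$ ($AC$ to $AB$); $R_1$ ($AC$ to $BC$); $L_1L_2$ ($BC$ to $AB$); $L_1$ ($BC$ to $AC$). $k=3$: $U_1^iU_2^j$. **$DA$ bimodules.** A $DA$ bimodule over $(\mathcal B(2),\mathcal B(2))$ (whose differentials vanish) is a $\mathbb Z\oplus\mathbb Z^4$-graded (left, right) $(\mathcal I(2),\mathcal I(2))$-bimodule $X$ with, for $i\ge1$, $(\mathcal I(2),\mathcal I(2))$-bilinear maps $\delta^1_i:X\otimes\mathcal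 B(2)^{\otimes(i-1)}\to\mathcal B(2)\otimes X$ (tensor products over $\mathcal I(2)$) which preserve the Alexander ($\mathbb Z^4$) degree and change the homological ($\mathbb Z$) degree by $2-i$, such that for all $i\ge1$ $$\sum_{j=1}^i(\mu\otimes\mathrm{id})\circ(\mathrm{id}\otimes\delta^1_{i-j+1})\circ(\delta^1_j\otimes\mathrm{id})+\sum_{j=1}^{i-2}\delta^1_{i-1}\circ(\mathrm{id}\otimes\mu_{j,j+1})=0,$$ where $\mu$ is multiplication and $\mu_{j,j+1}$ multiplies the $j$-th and $(j+1)$-st algebra inputs. **The bimodule $\mathcal X^{DA}$.** It has the following $\mathbb F$-basis; "$(\mathbf x|\mathbf y)$" means left idempotent $\mathbf I_{\mathbf x}$ and right idempotent $\mathbf I_{\mathbf y}$, and each basis element has a type among $S^\pm_t,S^\pm_b,W_t,W_b,E_t,E_b$. * Over $\mathcal B(2,0)$: $z_1=S^-_t,\ z_2=S^-_b,\ z_3=S^+_b,\ z_4=S^+_t$, all $(\varnothing|\varnothing)$. * Over $\mathcal B(2,1)$: $x_1=S^-_t\,(A|A)$, $x_2=S^-_t\,(C|C)$, $x_3=W_t\,(B|A)$, $x_4=S^-_b\,(A|A)$, $x_5=S^-_b\,(C|C)$, $x_6=E_b\,(B|C)$, $x_7=W_b\,(B|A)$, $x_8=S^+_b\,(A|A)$, $x_9=S^+_b\,(C|C)$, $x_{10}=E_t\,(B|C)$, $x_{11}=S^+_t\,(A|A)$, $x_{12}=S^+_t\,(C|C)$. * Over $\mathcal B(2,2)$: $y_1=S^-_t\,(AC|AC)$,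 $y_2=W_t\,(BC|AC)$, $y_3=S^-_b\,(AC|AC)$, $y_4=E_b\,(AB|AC)$, $y_5=W_b\,(BC|AC)$, $y_6=S^+_b\,(AC|AC)$, $y_7=E_t\,(AB|AC)$, $y_8=S^+_t\,(AC|AC)$. * Over $\mathcal B(2,3)$: zero. Gradings by type, as (homological; Alexander): $S^-_t:(1;0)$, $W_t:(0;\beta_1)$, $S^-_b:(0;\tau_2+\beta_2)$, $E_b:(0;\tau_2)$, $W_b:(-1;\tau_2+\beta_1+\beta_2)$, $S^+_b:(-1;\tau_2+\beta_2)$, $E_t:(-1;\tau_1+\tau_2+\beta_1)$, $S^+_t:(-2;\tau_1+\tau_2+\beta_1+\beta_2)$. Operations (evaluated on basis inputs; all values not listed are zero; the idempotents of algebra labels are determined by the adjacent basis elements). In all summands $\delta^1_2(x\otimes\mathbf I')=\mathbf I\otimes x$ for $\mathbf I,\mathbf I'$ the left and right idempotents of $x$; $\delta^1_2$ vanishes on all non-idempotent basis inputs, and $\delta^1_i=0$ for $i>2$ if some input is an idempotent. Over $\mathcal B(2,0)$: $\delta^1_1(z_3)=\mathbf I_\varnothing\otimes z_2$. Over $\mathcal B(2,1)$: $\delta^1_1$: $x_3\mapsto L_1\otimes x_1$; $x_5\mapsto U_2\otimes x_2$; $x_6\mapsto R_2\otimes x_2$; $x_7\mapsto U_2\otimes x_3+L_1\otimes x_4$; $x_8\mapsto \mathbf I_A\otimes x_4$; $x_9\mapsto\mathbf I_C\otimes x_5+L_2\otimes x_6$; $x_{10}\mapsto U_1\otimes x_6$;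 $x_{11}\mapsto R_1\otimes x_7+U_1\otimes x_8$; $x_{12}\mapsto L_2\otimes x_{10}$. $\delta^1_3$ with inputs $(R_1,R_2)$: $x_1\mapsto R_1\otimes x_6$; $x_3\mapsto\mathbf I_B\otimes x_{10}$; $x_7\mapsto R_2\otimes x_{12}$. With inputs $(L_2,L_1)$: $x_2\mapsto L_2\otimes x_3$; $x_5\mapsto L_2\otimes x_7$; $x_6\mapsto\mathbf I_B\otimes x_7+L_1\otimes x_8$; $x_{10}\mapsto L_1\otimes x_{11}$. $\delta^1_4$ with inputs $(R_1,U_2,L_1)$: $x_1\mapsto R_1\otimes x_7+U_1\otimes x_8$; $x_3\mapsto L_1\otimes x_{11}$. With inputs $(L_2,U_1,R_2)$: $x_2\mapsto L_2\otimes x_{10}$; $x_5\mapsto U_2\otimes x_{12}$; $x_6\mapsto R_2\otimes x_{12}$. Over $\mathcal B(2,2)$, with $P=\{(U_1,U_2),(L_2U_1,R_2),(R_1,L_1U_2)\}$: $\delta^1_1$: $y_2\mapsto L_1\otimes y_1$; $y_3\mapsto U_2\otimes y_1$; $y_4\mapsto R_2\otimes y_1$; $y_5\mapsto U_2\otimes y_2+L_1\otimes y_3$; $y_6\mapsto\mathbf I_{AC}\otimes y_3+L_2\otimes y_4$; $y_7\mapsto R_2R_1\otimes y_2+U_1\otimes y_4$; $y_8\mapsto R_1\otimes y_5+U_1\otimes y_6+L_2\otimes y_7$. $\delta^1_3$ with inputs any pair in $P$: $y_1\mapsto R_1U_2\otimes y_2+L_2U_1\otimes y_4$; $y_2\mapsto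 L_1L_2\otimes y_7$; $y_3\mapsto R_1U_2\otimes y_5+U_1U_2\otimes y_6$; $y_4\mapsto R_2R_1\otimes y_5+R_2U_1\otimes y_6$; $y_5\mapsto L_1U_2\otimes y_8$; $y_7\mapsto R_2U_1\otimes y_8$. $\delta^1_4$ with inputs $(R_1,U_2,L_1)$: $y_1\mapsto R_1\otimes y_5+U_1\otimes y_6$; $y_2\mapsto L_1\otimes y_8$. With inputs $(L_2,U_1,R_2)$: $y_1\mapsto L_2\otimes y_7$; $y_3\mapsto U_2\otimes y_8$; $y_4\mapsto R_2\otimes y_8$. $\delta^1_5$ with inputs $(p_1,p_2,q_1,q_2)$ for any $(p_1,p_2),(q_1,q_2)\in P$ (nine sequences): $y_1\mapsto U_1U_2\otimes y_8$. *)

theory Defs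
  imports
    "HOL-Library.Poly_Mapping"
    "HOL-Library.Product_Plus"
    "HOL-Library.Z2"
    "HOL-Computational_Algebra.Group_Closure"
begin

section \<open>The quiver and its path algebra\<close>

text \<open>Vertices are the subsets of \<^term>\<open>{0, 1, 2::nat}\<close>; an arrow is determined by its
  source and its label, hence a path by its source and its word of labels.\<close>

datatype label = R nat | L nat | U nat

fun is_arrow :: "nat set \<Rightarrow> label \<Rightarrow> bool" where
  "is_arrow x (R i) \<longleftrightarrow> x \<subseteq> {0, 1, 2} \<and> i \<in> {1, 2} \<and> x \<inter> {i - 1, i} = {i - 1}"
| "is_arrow x (L i) \<longleftrightarrow> x \<subseteq> {0, 1, 2} \<and> i \<in> {1, 2} \<and> x \<inter> {i - 1, i} = {i}"
| "is_arrow x (U i) \<longleftrightarrow> x \<subseteq> {0, 1, 2} \<and> i \<in> {1, 2}"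

fun target :: "nat set \<Rightarrow> label \<Rightarrow> nat set" where
  "target x (R i) = (x - {i - 1}) \<union> {i}"
| "target x (L i) = (x - {i}) \<union> {i - 1}"
| "target x (U i) = x"

fun is_path :: "nat set \<Rightarrow> label list \<Rightarrow> bool" where
  "is_path x [] \<longleftrightarrow> x \<subseteq> {0, 1, 2}"
| "is_path x (l # w) \<longleftrightarrow> is_arrow x l \<and> is_path (target x l) w"

fun endpoint :: "nat set \<Rightarrow> label list \<Rightarrow> nat set" where
  "endpoint x [] = x"
| "endpoint x (l # w) = endpoint (target x l) w"

typedef path = "{(x, w). is_path x w}"
  by (rule exI[of _ "({}, [])"]) simp

definition src :: "path \<Rightarrow> nat set" where "src p = fst (Rep_path p)"
definition word :: "path \<Rightarrow> label list" where "word p = snd (Rep_path p)"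
definition tgt :: "path \<Rightarrow> nat set" where "tgt p = endpoint (src p) (word p)"

text \<open>Concatenation, meaningful if \<^term>\<open>tgt p = src q\<close>.\<close>

definition path_comp :: "path \<Rightarrow> path \<Rightarrow> path" where
  "path_comp p q = Abs_path (src p, word p @ word q)"

type_synonym path_alg = "path \<Rightarrow>\<^sub>0 bit"

definition path_mult :: "path_alg \<Rightarrow> path_alg \<Rightarrow> path_alg" (infixl "\<star>" 70) where
  "u \<star> v = (\<Sum>p\<in>Poly_Mapping.keys u. \<Sum>q\<in>Poly_Mapping.keys v.
     if tgt p = src q
     then Poly_Mapping.single (path_comp p q) (Poly_Mapping.lookup u p * Poly_Mapping.lookup v q)
     else 0)"

definition path_elt :: "nat set \<Rightarrow> label list \<Rightarrow> path_alg" where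
  "path_elt x w = (if is_path x w then Poly_Mapping.single (Abs_path (x, w)) 1 else 0)"

definition path_one :: path_alg where
  "path_one = (\<Sum>x\<in>Pow {0, 1, 2}. path_elt x [])"


lemma group_closure_cong:
  fixes a b c d :: "'a::ab_group_add"
  assumes ab: "a - b \<in> group_closure S"
  shows "c - d \<in> group_closure S \<Longrightarrow> (a + c) - (b + d) \<in> group_closure S"
    and "c - d \<in> group_closure S \<Longrightarrow> (a - c) - (b - d) \<in> group_closure S"
    and "- a - - b \<in> group_closure S"
proof -
  have "(a + c) - (b + d) = (a - b) + (c - d)" "(a - c) - (b - d) = (a - b) - (c - d)"
    "- a - - b = - (a - b)"
    by (simp_all add: algebra_simps)
  then show "c - d \<in> group_closure S \<Longrightarrow> (a + c) - (b + d) \<in> group_closure S"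
    "c - d \<in> group_closure S \<Longrightarrow> (a - c) - (b - d) \<in> group_closure S"
    "- a - - b \<in> group_closure S"
    using ab by (simp_all only: group_closure_add group_closure.diff group_closure_minus_iff)
qed

lemma equivp_group_closure:
  fixes S :: "'a::ab_group_add set"
  shows "equivp (\<lambda>a b. a - b \<in> group_closure S)"
proof (intro equivpI reflpI sympI transpI)
  fix a b c :: 'a
  show "a - a \<in> group_closure S" by simp
  show "b - a \<in> group_closure S" if "a - b \<in> group_closure S"
    using group_closure.diff[OF zero_in_group_closure that] by simp
  show "a - c \<in> group_closure S" if "a - b \<in> group_closure S" "b - c \<in> group_closure S"
    using group_closure_add[OF that] by simp
qed


section \<open>The algebra B(2)\<close>

definition b2_relations :: "path_alg set" where
  "b2_relations =
     {path_elt x [U i, l] - path_elt x [l, U i] | x i l. is_path x [l] \<and> i \<in> {1, 2}}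
   \<union> {path_elt x [R i, L i] - path_elt x [U i] | x i. is_path x [R i, L i]}
   \<union> {path_elt x [L i, R i] - path_elt x [U i] | x i. is_path x [L i, R i]}
   \<union> {path_elt x [R 1, R 2] | x. is_path x [R 1, R 2]}
   \<union> {path_elt x [L 2, L 1] | x. is_path x [L 2, L 1]}
   \<union> {path_elt x [U i] | x i. is_path x [U i] \<and> x \<inter> {i - 1, i} = {}}"

definition b2_ideal :: "path_alg set" where
  "b2_ideal = group_closure {u \<star> r \<star> v | u r v. r \<in> b2_relations}"

definition b2_cong :: "path_alg \<Rightarrow> path_alg \<Rightarrow> bool" where
  "b2_cong u v \<longleftrightarrow> u - v \<in> b2_ideal"

lemma path_cases: obtains x w where "is_path x w" "p = Abs_path (x, w)"
  by (metis (no_types, lifting) Abs_path_cases case_prodE mem_Collect_eq)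

lemma Rep_Abs_path [simp]: "is_path x w \<Longrightarrow> Rep_path (Abs_path (x, w)) = (x, w)"
  by (simp add: Abs_path_inverse)

lemma Abs_path_eq [simp]:
  "is_path x w \<Longrightarrow> is_path y v \<Longrightarrow> Abs_path (x, w) = Abs_path (y, v) \<longleftrightarrow> x = y \<and> w = v"
  by (metis Pair_inject Rep_Abs_path)

lemma src_Abs [simp]: "is_path x w \<Longrightarrow> src (Abs_path (x, w)) = x"
  and word_Abs [simp]: "is_path x w \<Longrightarrow> word (Abs_path (x, w)) = w"
  and tgt_Abs [simp]: "is_path x w \<Longrightarrow> tgt (Abs_path (x, w)) = endpoint x w"
  by (simp_all add: src_def word_def tgt_def)

lemma is_arrow_source: "is_arrow x l \<Longrightarrow> x \<subseteq> {0, 1, 2}"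
  by (cases l) simp_all

lemma is_path_append [simp]:
  "is_path x (w @ v) \<longleftrightarrow> is_path x w \<and> is_path (endpoint x w) v"
proof (induction w arbitrary: x)
  case Nil
  have "is_path x v \<Longrightarrow> x \<subseteq> {0, 1, 2}" for x
    by (metis is_arrow_source is_path.elims(2))
  then show ?case by auto
qed simp

lemma endpoint_append [simp]: "endpoint x (w @ v) = endpoint (endpoint x w) v"
  by (induction w arbitrary: x) auto

lemma path_comp_Abs [simp]:
  "is_path x w \<Longrightarrow> path_comp (Abs_path (x, w)) (Abs_path (y, v)) =
     Abs_path (x, w @ word (Abs_path (y, v)))"
  by (simp add: path_comp_def)

lemma is_path_source: "is_path x w \<Longrightarrow> x \<subseteq> {0, 1, 2}"
  using is_path_append[of x "[]" w] by simp

lemma tgt_path_comp [simp]: "tgt p = src q \<Longrightarrow> tgt (path_comp p q) = tgt q"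
  and src_path_comp [simp]: "tgt p = src q \<Longrightarrow> src (path_comp p q) = src p"
  by (cases p rule: path_cases; cases q rule: path_cases; simp)+

lemma path_comp_assoc:
  "tgt p = src q \<Longrightarrow> tgt q = src r \<Longrightarrow>
    path_comp (path_comp p q) r = path_comp p (path_comp q r)"
  by (cases p rule: path_cases; cases q rule: path_cases; cases r rule: path_cases; simp)

lemma bit_vector_double [simp]: "(u :: 'a \<Rightarrow>\<^sub>0 bit) + u = 0"
  by (rule poly_mapping_eqI) (simp add: lookup_add)

lemma path_alg_induct [case_names single add]:
  fixes u :: path_alg
  assumes single: "\<And>p a. P (Poly_Mapping.single p a)"
    and add: "\<And>u v. P u \<Longrightarrow> P v \<Longrightarrow> P (u + v)"
  shows "P u"
proof (induction u rule: update_induct)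
  case const
  show ?case using single[of undefined 0] by simp
next
  case (update f k c)
  have "Poly_Mapping.update k c f = f + Poly_Mapping.single k c"
    using update by (intro poly_mapping_eqI)
      (auto simp: lookup_add lookup_update lookup_single when_def in_keys_iff)
  then show ?case using update single add by metis
qed

lemma path_mult_single:
  "Poly_Mapping.single p a \<star> Poly_Mapping.single q b =
     (if tgt p = src q then Poly_Mapping.single (path_comp p q) (a * b) else 0)"
  by (cases "a = 0"; cases "b = 0") (auto simp: path_mult_def)

lemma path_mult_add_right: "u \<star> (v + w) = u \<star> v + u \<star> w"
proof -
  have "(\<Sum>q\<in>Poly_Mapping.keys (v + w). if tgt p = src q
      then Poly_Mapping.single (path_comp p q) (c * Poly_Mapping.lookup (v + w) q) else 0) =
    (\<Sum>q\<in>Poly_Mapping.keys v. if tgt p = src q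
      then Poly_Mapping.single (path_comp p q) (c * Poly_Mapping.lookup v q) else 0) +
    (\<Sum>q\<in>Poly_Mapping.keys w. if tgt p = src q
      then Poly_Mapping.single (path_comp p q) (c * Poly_Mapping.lookup w q) else 0)" for p c
    by (rule setsum_keys_plus_distrib[where f = "\<lambda>q d. if tgt p = src q
          then Poly_Mapping.single (path_comp p q) (c * d) else 0"])
       (auto simp: distrib_left single_add)
  then show ?thesis by (simp add: path_mult_def sum.distrib)
qed

lemma path_mult_add_left: "(u + v) \<star> w = u \<star> w + v \<star> w"
  unfolding path_mult_def
  by (rule setsum_keys_plus_distrib[where f = "\<lambda>p c. \<Sum>q\<in>Poly_Mapping.keys w. if tgt p = src q
          then Poly_Mapping.single (path_comp p q) (c * Poly_Mapping.lookup w q) else 0"])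
     (auto simp: distrib_right single_add sum.distrib[symmetric] intro!: sum.cong sum.neutral)

lemma path_mult_zero [simp]: "0 \<star> u = 0" "u \<star> 0 = 0"
  by (simp_all add: path_mult_def)

lemma path_mult_diff_right: "u \<star> (v - w) = u \<star> v - u \<star> w"
  by (metis add_diff_cancel diff_add_cancel path_mult_add_right)

lemma path_mult_diff_left: "(u - v) \<star> w = u \<star> w - v \<star> w"
  by (metis add_diff_cancel diff_add_cancel path_mult_add_left)

lemma path_mult_assoc: "u \<star> v \<star> w = u \<star> (v \<star> w)"
proof (induction u rule: path_alg_induct)
  case (single p a)
  show ?case
  proof (induction v rule: path_alg_induct)
    case (single q b)
    show ?case
    proof (induction w rule: path_alg_induct)
      case (single r c)
      show ?case
        by (cases "tgt p = src q"; cases "tgt q = src r")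
           (simp_all add: path_mult_single path_comp_assoc mult.assoc)
    qed (simp add: path_mult_add_right)
  qed (simp add: path_mult_add_right path_mult_add_left)
qed (simp add: path_mult_add_left)

lemma path_one_mult [simp]: "path_one \<star> u = u" "u \<star> path_one = u"
proof -
  have sumL: "sum f S \<star> u = (\<Sum>x\<in>S. f x \<star> u)" if "finite S" for f :: "nat set \<Rightarrow> path_alg" and S u
    using that by induction (auto simp: path_mult_add_left)
  have sumR: "u \<star> sum f S = (\<Sum>x\<in>S. u \<star> f x)" if "finite S" for f :: "nat set \<Rightarrow> path_alg" and S u
    using that by induction (auto simp: path_mult_add_right)
  have endp: "endpoint x w \<subseteq> {0, 1, 2}" if "is_path x w" for x w
    using is_path_append[of x w "[]"] that by simp
  show "path_one \<star> u = u"
  proof (induction u rule: path_alg_induct)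
    case (single p a)
    obtain x w where p: "is_path x w" "p = Abs_path (x, w)" by (rule path_cases)
    have "path_one \<star> Poly_Mapping.single p a =
        (\<Sum>y\<in>Pow {0, 1, 2}. if y = x then Poly_Mapping.single p a else 0)"
      unfolding path_one_def
      by (subst sumL, simp, rule sum.cong) (auto simp: path_elt_def path_mult_single p)
    also have "\<dots> = Poly_Mapping.single p a" using is_path_source[OF p(1)] by (simp add: sum.delta)
    finally show ?case .
  qed (simp add: path_mult_add_right)
  show "u \<star> path_one = u"
  proof (induction u rule: path_alg_induct)
    case (single p a)
    obtain x w where p: "is_path x w" "p = Abs_path (x, w)" by (rule path_cases)
    have "Poly_Mapping.single p a \<star> path_one =
        (\<Sum>y\<in>Pow {0, 1, 2}. if endpoint x w = y then Poly_Mapping.single p a else 0)"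
      unfolding path_one_def
      by (subst sumR, simp, rule sum.cong) (auto simp: path_elt_def path_mult_single p)
    also have "\<dots> = Poly_Mapping.single p a" using endp[OF p(1)] by (simp add: sum.delta)
    finally show ?case .
  qed (simp add: path_mult_add_left)
qed

lemma b2_ideal_mult:
  assumes "a \<in> b2_ideal" shows "w \<star> a \<in> b2_ideal" "a \<star> w \<in> b2_ideal"
proof -
  have "w \<star> a \<in> b2_ideal \<and> a \<star> w \<in> b2_ideal"
    using assms unfolding b2_ideal_def
  proof (induction rule: group_closure.induct)
    case (base s)
    then consider "s = 0" | u r v where "r \<in> b2_relations" "s = u \<star> r \<star> v" by auto
    then show ?case
    proof cases
      case 2
      then have "w \<star> s = (w \<star> u) \<star> r \<star> v" "s \<star> w = u \<star> r \<star> (v \<star> w)"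
        by (simp_all add: path_mult_assoc)
      then show ?thesis using 2 by (blast intro: group_closure.base)
    qed simp
  next
    case (diff s t)
    then show ?case
      by (simp add: path_mult_diff_left path_mult_diff_right group_closure.diff)
  qed
  then show "w \<star> a \<in> b2_ideal" "a \<star> w \<in> b2_ideal" by auto
qed

lemma b2_ideal_add: "a \<in> b2_ideal \<Longrightarrow> b \<in> b2_ideal \<Longrightarrow> a + b \<in> b2_ideal"
  and b2_ideal_diff: "a \<in> b2_ideal \<Longrightarrow> b \<in> b2_ideal \<Longrightarrow> a - b \<in> b2_ideal"
  and b2_ideal_zero: "0 \<in> b2_ideal"
  by (auto simp: b2_ideal_def group_closure_add group_closure.diff)

lemma equivp_b2_cong: "equivp b2_cong"
  unfolding b2_cong_def[abs_def] b2_ideal_def by (rule equivp_group_closure)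

quotient_type b2 = path_alg / b2_cong
  by (rule equivp_b2_cong)

text \<open>The coefficient of a trivial path is multiplicative and kills the relations, so it is
  defined on the quotient; this yields \<open>1 \<noteq> 0\<close> and the actions of the idempotent
  ring on spaces given by a basis.\<close>

lemma trivial_coeff_mult:
  assumes x: "x \<subseteq> {0, 1, 2}"
  shows "Poly_Mapping.lookup (u \<star> v) (Abs_path (x, [])) =
    Poly_Mapping.lookup u (Abs_path (x, [])) * Poly_Mapping.lookup v (Abs_path (x, []))"
proof (induction u rule: path_alg_induct)
  case (single p a)
  show ?case
  proof (induction v rule: path_alg_induct)
    case (single q b)
    obtain y w where p: "is_path y w" "p = Abs_path (y, w)" by (rule path_cases)
    obtain z t where q: "is_path z t" "q = Abs_path (z, t)" by (rule path_cases)
    show ?case using p q x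
      by (cases "endpoint y w = z"; cases "w = []"; cases "t = []"; cases "y = x"; cases "z = x")
         (simp_all add: path_mult_single lookup_single when_def)
  qed (simp add: path_mult_add_right lookup_add distrib_left)
qed (simp add: path_mult_add_left lookup_add distrib_right)

lemma trivial_coeff_ideal:
  assumes x: "x \<subseteq> {0, 1, 2}" and "u \<in> b2_ideal"
  shows "Poly_Mapping.lookup u (Abs_path (x, [])) = 0"
  using assms(2) unfolding b2_ideal_def
proof (induction rule: group_closure.induct)
  case (base s)
  have elt: "Poly_Mapping.lookup (path_elt y (l # w)) (Abs_path (x, [])) = 0" for y l w
    using x by (simp add: path_elt_def lookup_single when_def del: is_path.simps(2))
  have "Poly_Mapping.lookup r (Abs_path (x, [])) = 0" if "r \<in> b2_relations" for r
    using that unfolding b2_relations_def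
    by (elim UnE CollectE exE conjE; simp only: lookup_minus elt diff_self)
  then show ?case using base by (auto simp: trivial_coeff_mult[OF x])
qed (simp add: lookup_minus)

lemma trivial_coeff_one:
  assumes "x \<subseteq> {0, 1, 2}"
  shows "Poly_Mapping.lookup path_one (Abs_path (x, [])) = 1"
proof -
  have "Poly_Mapping.lookup path_one (Abs_path (x, [])) =
      (\<Sum>y\<in>Pow {0, 1, 2::nat}. if y = x then 1 else 0)"
    unfolding path_one_def lookup_sum using assms
    by (intro sum.cong) (auto simp: path_elt_def lookup_single when_def)
  also have "\<dots> = 1" using assms by (subst sum.delta) auto
  finally show ?thesis .
qed

instantiation b2 :: ring_1
begin

lift_definition zero_b2 :: b2 is 0 .
lift_definition one_b2 :: b2 is path_one .
lift_definition plus_b2 :: "b2 \<Rightarrow> b2 \<Rightarrow> b2" is "(+)"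
  unfolding b2_cong_def b2_ideal_def by (rule group_closure_cong(1))
lift_definition minus_b2 :: "b2 \<Rightarrow> b2 \<Rightarrow> b2" is "(-)"
  unfolding b2_cong_def b2_ideal_def by (rule group_closure_cong(2))
lift_definition uminus_b2 :: "b2 \<Rightarrow> b2" is uminus
  unfolding b2_cong_def b2_ideal_def by (rule group_closure_cong(3))
lift_definition times_b2 :: "b2 \<Rightarrow> b2 \<Rightarrow> b2" is path_mult
proof -
  fix u u' v v' assume "b2_cong u u'" "b2_cong v v'"
  then have "(u - u') \<star> v + u' \<star> (v - v') \<in> b2_ideal"
    by (auto simp: b2_cong_def intro: b2_ideal_add b2_ideal_mult)
  then show "b2_cong (u \<star> v) (u' \<star> v')"
    by (simp add: b2_cong_def path_mult_diff_left path_mult_diff_right)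
qed

instance
proof
  fix a b c :: b2
  have refl: "b2_cong u u" for u by (simp add: b2_cong_def b2_ideal_zero)
  show "a + b + c = a + (b + c)" by transfer (simp add: refl add.assoc)
  show "a + b = b + a" by transfer (simp add: refl add.commute)
  show "0 + a = a" by transfer (simp add: refl)
  show "- a + a = 0" by transfer (simp add: refl)
  show "a - b = a + - b" by transfer (simp add: refl)
  show "a * b * c = a * (b * c)" by transfer (simp add: refl path_mult_assoc)
  show "1 * a = a" by transfer (simp add: refl)
  show "a * 1 = a" by transfer (simp add: refl)
  show "(a + b) * c = a * c + b * c" by transfer (simp add: refl path_mult_add_left)
  show "a * (b + c) = a * b + a * c" by transfer (simp add: refl path_mult_add_right)
  show "(0::b2) \<noteq> 1"
  proof transfer
    show "\<not> b2_cong 0 path_one"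
    proof
      assume "b2_cong 0 path_one"
      then have "Poly_Mapping.lookup (0 - path_one) (Abs_path ({}, [])) = 0"
        unfolding b2_cong_def by (rule trivial_coeff_ideal[rotated]) simp
      then show False by (simp add: lookup_minus trivial_coeff_one)
    qed
  qed
qed

end

text \<open>The class in B(2) of the path with source \<open>x\<close> and labels \<open>w\<close> (zero if there is none).\<close>

lift_definition b2_path :: "nat set \<Rightarrow> label list \<Rightarrow> b2" is path_elt .

text \<open>\<open>\<I>(2)\<close>; the span is already closed under multiplication.\<close>

definition idem_ring :: "b2 set" where
  "idem_ring = group_closure {b2_path x [] | x. x \<subseteq> {0, 1, 2}}"

text \<open>Alexander degrees, in coordinates with respect to \<open>\<tau>\<^sub>1, \<beta>\<^sub>1, \<tau>\<^sub>2, \<beta>\<^sub>2\<close>.\<close>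

type_synonym alex = "int \<times> int \<times> int \<times> int"

definition tau :: "nat \<Rightarrow> alex" where
  "tau i = (if i = 1 then (1, 0, 0, 0) else (0, 0, 1, 0))"
definition beta :: "nat \<Rightarrow> alex" where
  "beta i = (if i = 1 then (0, 1, 0, 0) else (0, 0, 0, 1))"

fun label_deg :: "label \<Rightarrow> alex" where
  "label_deg (R i) = tau i"
| "label_deg (L i) = beta i"
| "label_deg (U i) = tau i + beta i"

definition b2_homog :: "alex \<Rightarrow> b2 set" where
  "b2_homog d = group_closure {b2_path x w | x w. is_path x w \<and> sum_list (map label_deg w) = d}"

text \<open>The coefficient of the idempotent at \<open>x\<close>, for \<open>x \<subseteq> {0, 1, 2}\<close>.\<close>

lift_definition idem_coeff :: "b2 \<Rightarrow> nat set \<Rightarrow> bit" is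
  "\<lambda>u x. if x \<subseteq> {0, 1, 2} then Poly_Mapping.lookup u (Abs_path (x, [])) else 0"
proof (rule ext)
  fix u v :: path_alg and x :: "nat set"
  assume "b2_cong u v"
  then have "Poly_Mapping.lookup (u - v) (Abs_path (x, [])) = 0" if "x \<subseteq> {0, 1, 2}"
    using trivial_coeff_ideal that by (simp add: b2_cong_def)
  then show "(if x \<subseteq> {0, 1, 2} then Poly_Mapping.lookup u (Abs_path (x, [])) else 0) =
    (if x \<subseteq> {0, 1, 2} then Poly_Mapping.lookup v (Abs_path (x, [])) else 0)"
    by (simp add: lookup_minus del: minus_bit_def)
qed

lemma idem_coeff_add: "idem_coeff (a + b) x = idem_coeff a x + idem_coeff b x"
  by transfer (simp add: lookup_add)

lemma idem_coeff_mult: "idem_coeff (a * b) x = idem_coeff a x * idem_coeff b x"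
  by transfer (simp add: trivial_coeff_mult)

lemma idem_coeff_b2_path:
  "x \<subseteq> {0, 1, 2} \<Longrightarrow> idem_coeff (b2_path y w) x = (if y = x \<and> w = [] then 1 else 0)"
  by transfer (auto simp: path_elt_def lookup_single when_def)

lemma idem_coeff_one: "x \<subseteq> {0, 1, 2} \<Longrightarrow> idem_coeff 1 x = 1"
  by transfer (simp add: trivial_coeff_one)


section \<open>DA bimodules over B(2)\<close>

text \<open>Bimodules over \<open>(\<I>(2), \<I>(2))\<close>: the actions are functions on all of \<^typ>\<open>b2\<close>, but are
  only constrained, and only used below, on \<^const>\<open>idem_ring\<close>.\<close>

class i2_bimodule = ab_group_add +
  fixes lact :: "b2 \<Rightarrow> 'a \<Rightarrow> 'a" (infixr "\<rhd>" 75)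
    and ract :: "'a \<Rightarrow> b2 \<Rightarrow> 'a" (infixl "\<lhd>" 75)
  assumes lact_add_left: "e \<in> idem_ring \<Longrightarrow> f \<in> idem_ring \<Longrightarrow> (e + f) \<rhd> x = (e \<rhd> x) + (f \<rhd> x)"
    and lact_add_right: "e \<in> idem_ring \<Longrightarrow> e \<rhd> (x + y) = (e \<rhd> x) + (e \<rhd> y)"
    and lact_mult: "e \<in> idem_ring \<Longrightarrow> f \<in> idem_ring \<Longrightarrow> (e * f) \<rhd> x = e \<rhd> (f \<rhd> x)"
    and lact_one: "1 \<rhd> x = x"
    and ract_add_left: "e \<in> idem_ring \<Longrightarrow> (x + y) \<lhd> e = (x \<lhd> e) + (y \<lhd> e)"
    and ract_add_right: "e \<in> idem_ring \<Longrightarrow> f \<in> idem_ring \<Longrightarrow> x \<lhd> (e + f) = (x \<lhd> e) + (x \<lhd> f)"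
    and ract_mult: "e \<in> idem_ring \<Longrightarrow> f \<in> idem_ring \<Longrightarrow> x \<lhd> (e * f) = (x \<lhd> e) \<lhd> f"
    and ract_one: "x \<lhd> 1 = x"
    and lact_ract: "e \<in> idem_ring \<Longrightarrow> f \<in> idem_ring \<Longrightarrow> (e \<rhd> x) \<lhd> f = e \<rhd> (x \<lhd> f)"

text \<open>The tensor product \<open>\<B>(2) \<otimes> X\<close> over \<open>\<I>(2)\<close>, as a quotient of the free
  \<open>\<F>\<^sub>2\<close>-vector space on \<open>\<B>(2) \<times> X\<close>.\<close>

abbreviation free_pair :: "b2 \<Rightarrow> 'x::i2_bimodule \<Rightarrow> (b2 \<times> 'x) \<Rightarrow>\<^sub>0 bit" where
  "free_pair a x \<equiv> Poly_Mapping.single (a, x) 1"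

definition tensor_relations :: "((b2 \<times> 'x::i2_bimodule) \<Rightarrow>\<^sub>0 bit) set" where
  "tensor_relations =
     {free_pair (a + b) x - free_pair a x - free_pair b x | a b x. True}
   \<union> {free_pair a (x + y) - free_pair a x - free_pair a y | a x y. True}
   \<union> {free_pair (a * e) x - free_pair a (e \<rhd> x) | a e x. e \<in> idem_ring}"

definition tensor_cong :: "((b2 \<times> 'x::i2_bimodule) \<Rightarrow>\<^sub>0 bit) \<Rightarrow> ((b2 \<times> 'x) \<Rightarrow>\<^sub>0 bit) \<Rightarrow> bool" where
  "tensor_cong s t \<longleftrightarrow> s - t \<in> group_closure tensor_relations"

lemma equivp_tensor_cong: "equivp tensor_cong"
  unfolding tensor_cong_def[abs_def] by (rule equivp_group_closure)

quotient_type (overloaded) 'x b2_tensor = "(b2 \<times> 'x::i2_bimodule) \<Rightarrow>\<^sub>0 bit" / tensor_cong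
  by (rule equivp_tensor_cong)

instantiation b2_tensor :: (i2_bimodule) ab_group_add
begin

lift_definition zero_b2_tensor :: "'a b2_tensor" is 0 .
lift_definition plus_b2_tensor :: "'a b2_tensor \<Rightarrow> 'a b2_tensor \<Rightarrow> 'a b2_tensor" is "(+)"
  unfolding tensor_cong_def by (rule group_closure_cong(1))
lift_definition minus_b2_tensor :: "'a b2_tensor \<Rightarrow> 'a b2_tensor \<Rightarrow> 'a b2_tensor" is "(-)"
  unfolding tensor_cong_def by (rule group_closure_cong(2))
lift_definition uminus_b2_tensor :: "'a b2_tensor \<Rightarrow> 'a b2_tensor" is uminus
  unfolding tensor_cong_def by (rule group_closure_cong(3))

instance
proof
  fix a b c :: "'a b2_tensor"
  have refl: "tensor_cong u u" for u :: "(b2 \<times> 'a) \<Rightarrow>\<^sub>0 bit" by (simp add: tensor_cong_def)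
  show "a + b + c = a + (b + c)" by transfer (simp add: refl add.assoc)
  show "a + b = b + a" by transfer (simp add: refl add.commute)
  show "0 + a = a" by transfer (simp add: refl)
  show "- a + a = 0" by transfer (simp add: refl)
  show "a - b = a + - b" by transfer (simp add: refl)
qed

end

lift_definition tensor :: "b2 \<Rightarrow> 'x::i2_bimodule \<Rightarrow> 'x b2_tensor" (infixr "\<otimes>" 73) is free_pair .

text \<open>The additive map on \<open>\<B>(2) \<otimes> X\<close> with \<open>a \<otimes> x \<mapsto> f a x\<close>, for \<open>f\<close> biadditive and
  \<open>\<I>(2)\<close>-balanced; evaluated on an arbitrary representative, see \<open>tensor_lift_tensor\<close>.\<close>

definition tensor_lift :: "(b2 \<Rightarrow> 'x::i2_bimodule \<Rightarrow> 'y::ab_group_add) \<Rightarrow> 'x b2_tensor \<Rightarrow> 'y" where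
  "tensor_lift f t = (\<Sum>(a, x)\<in>Poly_Mapping.keys (rep_b2_tensor t). f a x)"

lemma b2_double [simp]: "(a::b2) + a = 0"
proof transfer
  fix u :: path_alg
  show "b2_cong (u + u) 0" by (simp add: b2_cong_def b2_ideal_zero)
qed

lemma tensor_lift_welldef:
  fixes f :: "b2 \<Rightarrow> 'x::i2_bimodule \<Rightarrow> 'y::ab_group_add"
  assumes add1: "\<And>a b x. f (a + b) x = f a x + f b x"
    and add2: "\<And>a x y. f a (x + y) = f a x + f a y"
    and bal: "\<And>a e x. e \<in> idem_ring \<Longrightarrow> f (a * e) x = f a (e \<rhd> x)"
  shows "tensor_lift f (s + t) = tensor_lift f s + tensor_lift f t"
    and "tensor_lift f (a \<otimes> x) = f a x"
proof -
  define g where "g u = (\<Sum>(a, x)\<in>Poly_Mapping.keys u. f a x)" for u :: "(b2 \<times> 'x) \<Rightarrow>\<^sub>0 bit"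
  have zero: "f 0 x = 0" for x using add1[of 0 0 x] by simp
  have dbl: "f a x + f a x = 0" for a x
    using add1[of a a x] zero by simp
  have g_alt: "g u = (\<Sum>k\<in>Poly_Mapping.keys u.
      (\<lambda>k c. if c = (1::bit) then f (fst k) (snd k) else 0) k (Poly_Mapping.lookup u k))" for u
    unfolding g_def by (rule sum.cong) (auto simp: in_keys_iff)
  have g_add: "g (u + v) = g u + g v" for u v
    unfolding g_alt
  proof (rule setsum_keys_plus_distrib)
    fix k
    show "(if Poly_Mapping.lookup u k + Poly_Mapping.lookup v k = 1 then f (fst k) (snd k) else 0) =
      (if Poly_Mapping.lookup u k = 1 then f (fst k) (snd k) else 0) +
      (if Poly_Mapping.lookup v k = 1 then f (fst k) (snd k) else 0)"
      by (cases "Poly_Mapping.lookup u k"; cases "Poly_Mapping.lookup v k") (simp_all add: dbl)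
  qed simp
  have g_diff: "g (u - v) = g u - g v" for u v
    by (metis add_diff_cancel diff_add_cancel g_add)
  have g_single: "g (free_pair a x) = f a x" for a x by (simp add: g_def)
  have g_rel: "g u = 0" if "u \<in> group_closure tensor_relations" for u
    using that
    by (induction rule: group_closure.induct)
       (auto simp: tensor_relations_def g_diff g_single add1 add2 bal, simp_all add: g_def)
  have g_cong: "g u = g v" if "tensor_cong u v" for u v
  proof -
    have "g (u - v) = 0" using that by (intro g_rel) (simp only: tensor_cong_def)
    then have "g u - g v = 0" by (simp only: g_diff)
    then show ?thesis by (simp only: right_minus_eq)
  qed
  have lift: "tensor_lift f (abs_b2_tensor u) = g u" for u
  proof -
    have "tensor_cong (rep_b2_tensor (abs_b2_tensor u)) u"
      by (rule Quotient3_rep_abs[OF Quotient3_b2_tensor]) (rule equivp_reflp[OF equivp_tensor_cong])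
    then have "g (rep_b2_tensor (abs_b2_tensor u)) = g u" by (rule g_cong)
    then show ?thesis by (simp only: tensor_lift_def g_def)
  qed
  show "tensor_lift f (s + t) = tensor_lift f s + tensor_lift f t"
    by (induct s rule: b2_tensor.abs_induct; induct t rule: b2_tensor.abs_induct)
       (simp only: plus_b2_tensor.abs_eq lift g_add)
  show "tensor_lift f (a \<otimes> x) = f a x"
    by (simp only: tensor.abs_eq lift g_single)
qed

lemmas tensor_lift_add = tensor_lift_welldef(1)
lemmas tensor_lift_tensor = tensor_lift_welldef(2)

text \<open>The left \<open>\<B>(2)\<close>-action and the right \<open>\<I>(2)\<close>-action on \<open>\<B>(2) \<otimes> X\<close>.\<close>

definition tensor_lmult :: "b2 \<Rightarrow> 'x::i2_bimodule b2_tensor \<Rightarrow> 'x b2_tensor" where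
  "tensor_lmult a = tensor_lift (\<lambda>b x. (a * b) \<otimes> x)"

definition tensor_ract :: "'x::i2_bimodule b2_tensor \<Rightarrow> b2 \<Rightarrow> 'x b2_tensor" where
  "tensor_ract t e = tensor_lift (\<lambda>b x. b \<otimes> (x \<lhd> e)) t"

text \<open>A bigrading is indexed by (homological degree, Alexander degree).\<close>

definition tensor_homog :: "(int \<times> alex \<Rightarrow> 'x::i2_bimodule set) \<Rightarrow> int \<times> alex \<Rightarrow> 'x b2_tensor set" where
  "tensor_homog X = (\<lambda>(h, d). group_closure
     {a \<otimes> x | a x d1 d2. a \<in> b2_homog d1 \<and> x \<in> X (h, d2) \<and> d = d1 + d2})"

text \<open>The operation \<open>\<delta>\<^sup>1\<^sub>i\<close> is the restriction of \<open>\<delta>\<close> to input lists of length \<open>i - 1\<close>; a linear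
  map out of \<open>X \<otimes> \<B>(2) \<otimes> \<dots> \<otimes> \<B>(2)\<close> is given as a multiadditive \<open>\<I>(2)\<close>-balanced map.
  In the structure relation, \<open>\<lambda>t. tensor_lift (\<lambda>b y. tensor_lmult b (\<delta> y bs)) t\<close> is the composite
  of \<open>id \<otimes> \<delta>\<close> with \<open>\<mu> \<otimes> id\<close>; with \<open>i - 1\<close> inputs, the summation index of the first sum is
  \<open>j - 1 = 0, \<dots>, i - 1\<close> and that of the second sum \<open>j - 1 = 0, \<dots>, i - 3\<close>.\<close>

locale DA_bimodule =
  fixes X :: "int \<times> alex \<Rightarrow> 'x::i2_bimodule set"
    and \<delta> :: "'x \<Rightarrow> b2 list \<Rightarrow> 'x b2_tensor"
  assumes grading_subgroup: "\<And>d. 0 \<in> X d" "\<And>d x y. \<lbrakk>x \<in> X d; y \<in> X d\<rbrakk> \<Longrightarrow> x - y \<in> X d"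
    and grading_lact: "\<And>d e x. \<lbrakk>e \<in> idem_ring; x \<in> X d\<rbrakk> \<Longrightarrow> e \<rhd> x \<in> X d"
    and grading_ract: "\<And>d e x. \<lbrakk>e \<in> idem_ring; x \<in> X d\<rbrakk> \<Longrightarrow> x \<lhd> e \<in> X d"
    and grading_direct_sum:
      "\<And>x. \<exists>!c :: (int \<times> alex) \<Rightarrow>\<^sub>0 'x. (\<forall>d. Poly_Mapping.lookup c d \<in> X d) \<and>
         x = (\<Sum>d\<in>Poly_Mapping.keys c. Poly_Mapping.lookup c d)"
    and delta_add: "\<And>x y as. \<delta> (x + y) as = \<delta> x as + \<delta> y as"
    and delta_add_input:
      "\<And>x as a b bs. \<delta> x (as @ (a + b) # bs) = \<delta> x (as @ a # bs) + \<delta> x (as @ b # bs)"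
    and delta_balanced_first:
      "\<And>e x a as. e \<in> idem_ring \<Longrightarrow> \<delta> (x \<lhd> e) (a # as) = \<delta> x ((e * a) # as)"
    and delta_balanced:
      "\<And>e x as a b bs. e \<in> idem_ring \<Longrightarrow> \<delta> x (as @ (a * e) # b # bs) = \<delta> x (as @ a # (e * b) # bs)"
    and delta_left_linear:
      "\<And>e x as. e \<in> idem_ring \<Longrightarrow> \<delta> (e \<rhd> x) as = tensor_lmult e (\<delta> x as)"
    and delta_right_linear_Nil:
      "\<And>e x. e \<in> idem_ring \<Longrightarrow> \<delta> (x \<lhd> e) [] = tensor_ract (\<delta> x []) e"
    and delta_right_linear:
      "\<And>e x as a. e \<in> idem_ring \<Longrightarrow> \<delta> x (as @ [a * e]) = tensor_ract (\<delta> x (as @ [a])) e"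
    and delta_degree:
      "\<And>x h d as ds. \<lbrakk>x \<in> X (h, d); list_all2 (\<lambda>a d'. a \<in> b2_homog d') as ds\<rbrakk> \<Longrightarrow>
         \<delta> x as \<in> tensor_homog X (h + (2 - (int (length as) + 1)), d + sum_list ds)"
    and structure_relation:
      "\<And>x as. (\<Sum>j\<le>length as. tensor_lift (\<lambda>b y. tensor_lmult b (\<delta> y (drop j as))) (\<delta> x (take j as)))
       + (\<Sum>j<length as - 1. \<delta> x (take j as @ (as ! j * as ! (j + 1)) # drop (j + 2) as)) = 0"


section \<open>The standard basis of B(2)\<close>

abbreviation (input) "vA \<equiv> {0::nat}"
abbreviation (input) "vB \<equiv> {1::nat}"
abbreviation (input) "vC \<equiv> {2::nat}"
abbreviation (input) "vAB \<equiv> {0, 1::nat}"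
abbreviation (input) "vAC \<equiv> {0, 2::nat}"
abbreviation (input) "vBC \<equiv> {1, 2::nat}"
abbreviation (input) "vABC \<equiv> {0, 1, 2::nat}"

text \<open>A basis element is encoded by its source and a word of labels.\<close>

type_synonym source_word = "nat set \<times> label list"

definition b2_basis :: "source_word set" where
  "b2_basis =
     {({}, [])}
   \<union> (\<Union>i. {(vA, replicate i (U 1)), (vA, R 1 # replicate i (U 1)), (vB, L 1 # replicate i (U 1)),
        (vB, []), (vB, replicate (i + 1) (U 1)), (vB, replicate (i + 1) (U 2)),
        (vB, R 2 # replicate i (U 2)), (vC, L 2 # replicate i (U 2)), (vC, replicate i (U 2))})
   \<union> {(x, p @ replicate i (U 1) @ replicate j (U 2)) | x p i j.
        (x, p) \<in> {(vAB, []), (vAC, []), (vBC, []), (vAB, [R 2]), (vAB, [R 2, R 1]),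
          (vAC, [L 2]), (vAC, [R 1]), (vBC, [L 1, L 2]), (vBC, [L 1])}}
   \<union> {(vABC, replicate i (U 1) @ replicate j (U 2)) | i j. True}"

text \<open>Over \<open>\<F>\<^sub>2\<close>, expanding \<open>a\<close> in the basis means writing it as the sum of a finite set of
  basis elements.\<close>

definition b2_support :: "b2 \<Rightarrow> source_word set" where
  "b2_support a = (THE S. finite S \<and> S \<subseteq> b2_basis \<and> a = (\<Sum>(x, w)\<in>S. b2_path x w))"


section \<open>The bimodule\<close>

datatype gen = Z1 | Z2 | Z3 | Z4
  | X1 | X2 | X3 | X4 | X5 | X6 | X7 | X8 | X9 | X10 | X11 | X12
  | Y1 | Y2 | Y3 | Y4 | Y5 | Y6 | Y7 | Y8

instance gen :: finite
proof
  have "x \<in> {Z1, Z2, Z3, Z4, X1, X2, X3, X4, X5, X6, X7, X8, X9, X10, X11, X12,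
    Y1, Y2, Y3, Y4, Y5, Y6, Y7, Y8}" for x
    by (cases x) simp_all
  then show "finite (UNIV :: gen set)" by (meson finite.emptyI finite.insertI finite_subset subsetI)
qed

datatype kind = S_minus_t | W_t | S_minus_b | E_b | W_b | S_plus_b | E_t | S_plus_t

fun gen_kind :: "gen \<Rightarrow> kind" where
  "gen_kind Z1 = S_minus_t" | "gen_kind Z2 = S_minus_b"
| "gen_kind Z3 = S_plus_b" | "gen_kind Z4 = S_plus_t"
| "gen_kind X1 = S_minus_t" | "gen_kind X2 = S_minus_t" | "gen_kind X3 = W_t"
| "gen_kind X4 = S_minus_b" | "gen_kind X5 = S_minus_b" | "gen_kind X6 = E_b"
| "gen_kind X7 = W_b" | "gen_kind X8 = S_plus_b" | "gen_kind X9 = S_plus_b"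
| "gen_kind X10 = E_t" | "gen_kind X11 = S_plus_t" | "gen_kind X12 = S_plus_t"
| "gen_kind Y1 = S_minus_t" | "gen_kind Y2 = W_t" | "gen_kind Y3 = S_minus_b"
| "gen_kind Y4 = E_b" | "gen_kind Y5 = W_b" | "gen_kind Y6 = S_plus_b"
| "gen_kind Y7 = E_t" | "gen_kind Y8 = S_plus_t"

fun left_idem :: "gen \<Rightarrow> nat set" where
  "left_idem Z1 = {}" | "left_idem Z2 = {}" | "left_idem Z3 = {}" | "left_idem Z4 = {}"
| "left_idem X1 = vA" | "left_idem X2 = vC" | "left_idem X3 = vB" | "left_idem X4 = vA"
| "left_idem X5 = vC" | "left_idem X6 = vB" | "left_idem X7 = vB" | "left_idem X8 = vA"
| "left_idem X9 = vC" | "left_idem X10 = vB" | "left_idem X11 = vA" | "left_idem X12 = vC"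
| "left_idem Y1 = vAC" | "left_idem Y2 = vBC" | "left_idem Y3 = vAC" | "left_idem Y4 = vAB"
| "left_idem Y5 = vBC" | "left_idem Y6 = vAC" | "left_idem Y7 = vAB" | "left_idem Y8 = vAC"

fun right_idem :: "gen \<Rightarrow> nat set" where
  "right_idem Z1 = {}" | "right_idem Z2 = {}" | "right_idem Z3 = {}" | "right_idem Z4 = {}"
| "right_idem X1 = vA" | "right_idem X2 = vC" | "right_idem X3 = vA" | "right_idem X4 = vA"
| "right_idem X5 = vC" | "right_idem X6 = vC" | "right_idem X7 = vA" | "right_idem X8 = vA"
| "right_idem X9 = vC" | "right_idem X10 = vC" | "right_idem X11 = vA" | "right_idem X12 = vC"
| "right_idem Y1 = vAC" | "right_idem Y2 = vAC" | "right_idem Y3 = vAC" | "right_idem Y4 = vAC"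
| "right_idem Y5 = vAC" | "right_idem Y6 = vAC" | "right_idem Y7 = vAC" | "right_idem Y8 = vAC"

fun kind_degree :: "kind \<Rightarrow> int \<times> alex" where
  "kind_degree S_minus_t = (1, 0)"
| "kind_degree W_t = (0, beta 1)"
| "kind_degree S_minus_b = (0, tau 2 + beta 2)"
| "kind_degree E_b = (0, tau 2)"
| "kind_degree W_b = (-1, tau 2 + beta 1 + beta 2)"
| "kind_degree S_plus_b = (-1, tau 2 + beta 2)"
| "kind_degree E_t = (-1, tau 1 + tau 2 + beta 1)"
| "kind_degree S_plus_t = (-2, tau 1 + tau 2 + beta 1 + beta 2)"

typedef xda = "UNIV :: (gen \<Rightarrow> bit) set" morphisms coeff Abs_xda ..

setup_lifting type_definition_xda

lemma left_idem_subset: "left_idem g \<subseteq> {0, 1, 2}" by (cases g) auto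
lemma right_idem_subset: "right_idem g \<subseteq> {0, 1, 2}" by (cases g) auto

instantiation xda :: i2_bimodule
begin

lift_definition zero_xda :: xda is "\<lambda>_. 0" .
lift_definition plus_xda :: "xda \<Rightarrow> xda \<Rightarrow> xda" is "\<lambda>x y g. x g + y g" .
lift_definition minus_xda :: "xda \<Rightarrow> xda \<Rightarrow> xda" is "\<lambda>x y g. x g - y g" .
lift_definition uminus_xda :: "xda \<Rightarrow> xda" is "\<lambda>x g. - x g" .
lift_definition lact_xda :: "b2 \<Rightarrow> xda \<Rightarrow> xda" is
  "\<lambda>e x g. idem_coeff e (left_idem g) * x g" .
lift_definition ract_xda :: "xda \<Rightarrow> b2 \<Rightarrow> xda" is
  "\<lambda>x e g. x g * idem_coeff e (right_idem g)" .

instance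
proof
  fix x y z :: xda and e f :: b2
  show "x + y + z = x + (y + z)" by transfer (simp only: add.assoc)
  show "x + y = y + x" by transfer (simp only: add.commute)
  show "0 + x = x" by transfer (simp only: add_0_left)
  show "- x + x = 0" by transfer (simp only: add.left_inverse)
  show "x - y = x + - y" by transfer (simp only: diff_conv_add_uminus)
  show "(e + f) \<rhd> x = (e \<rhd> x) + (f \<rhd> x)"
    by transfer (simp only: idem_coeff_add distrib_right)
  show "e \<rhd> (x + y) = (e \<rhd> x) + (e \<rhd> y)" by transfer (simp only: distrib_left)
  show "(e * f) \<rhd> x = e \<rhd> (f \<rhd> x)" by transfer (simp only: idem_coeff_mult mult.assoc)
  show "1 \<rhd> x = x" by transfer (simp only: idem_coeff_one[OF left_idem_subset] mult_1_left)
  show "(x + y) \<lhd> e = (x \<lhd> e) + (y \<lhd> e)" by transfer (simp only: distrib_right)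
  show "x \<lhd> (e + f) = (x \<lhd> e) + (x \<lhd> f)"
    by transfer (simp only: idem_coeff_add distrib_left)
  show "x \<lhd> (e * f) = (x \<lhd> e) \<lhd> f" by transfer (simp only: idem_coeff_mult mult.assoc)
  show "x \<lhd> 1 = x" by transfer (simp only: idem_coeff_one[OF right_idem_subset] mult_1_right)
  show "(e \<rhd> x) \<lhd> f = e \<rhd> (x \<lhd> f)" by transfer (simp only: mult.assoc)
qed

end

lift_definition basis_elt :: "gen \<Rightarrow> xda" is "\<lambda>g h. if h = g then 1 else 0" .

definition xda_grading :: "int \<times> alex \<Rightarrow> xda set" where
  "xda_grading d = group_closure {basis_elt g | g. kind_degree (gen_kind g) = d}"


section \<open>The operations\<close>

text \<open>Each entry \<open>(w, h)\<close> of the list attached to \<open>g\<close> stands for the summand \<open>w \<otimes> h\<close>.\<close>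

fun op_none :: "gen \<Rightarrow> (label list \<times> gen) list" where
  "op_none Z3 = [([], Z2)]"
| "op_none X3 = [([L 1], X1)]"
| "op_none X5 = [([U 2], X2)]"
| "op_none X6 = [([R 2], X2)]"
| "op_none X7 = [([U 2], X3), ([L 1], X4)]"
| "op_none X8 = [([], X4)]"
| "op_none X9 = [([], X5), ([L 2], X6)]"
| "op_none X10 = [([U 1], X6)]"
| "op_none X11 = [([R 1], X7), ([U 1], X8)]"
| "op_none X12 = [([L 2], X10)]"
| "op_none Y2 = [([L 1], Y1)]"
| "op_none Y3 = [([U 2], Y1)]"
| "op_none Y4 = [([R 2], Y1)]"
| "op_none Y5 = [([U 2], Y2), ([L 1], Y3)]"
| "op_none Y6 = [([], Y3), ([L 2], Y4)]"
| "op_none Y7 = [([R 2, R 1], Y2), ([U 1], Y4)]"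
| "op_none Y8 = [([R 1], Y5), ([U 1], Y6), ([L 2], Y7)]"
| "op_none _ = []"

fun op_R1_R2 :: "gen \<Rightarrow> (label list \<times> gen) list" where
  "op_R1_R2 X1 = [([R 1], X6)]"
| "op_R1_R2 X3 = [([], X10)]"
| "op_R1_R2 X7 = [([R 2], X12)]"
| "op_R1_R2 _ = []"

fun op_L2_L1 :: "gen \<Rightarrow> (label list \<times> gen) list" where
  "op_L2_L1 X2 = [([L 2], X3)]"
| "op_L2_L1 X5 = [([L 2], X7)]"
| "op_L2_L1 X6 = [([], X7), ([L 1], X8)]"
| "op_L2_L1 X10 = [([L 1], X11)]"
| "op_L2_L1 _ = []"

fun op_P :: "gen \<Rightarrow> (label list \<times> gen) list" where
  "op_P Y1 = [([R 1, U 2], Y2), ([L 2, U 1], Y4)]"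
| "op_P Y2 = [([L 1, L 2], Y7)]"
| "op_P Y3 = [([R 1, U 2], Y5), ([U 1, U 2], Y6)]"
| "op_P Y4 = [([R 2, R 1], Y5), ([R 2, U 1], Y6)]"
| "op_P Y5 = [([L 1, U 2], Y8)]"
| "op_P Y7 = [([R 2, U 1], Y8)]"
| "op_P _ = []"

fun op_R1_U2_L1 :: "gen \<Rightarrow> (label list \<times> gen) list" where
  "op_R1_U2_L1 X1 = [([R 1], X7), ([U 1], X8)]"
| "op_R1_U2_L1 X3 = [([L 1], X11)]"
| "op_R1_U2_L1 Y1 = [([R 1], Y5), ([U 1], Y6)]"
| "op_R1_U2_L1 Y2 = [([L 1], Y8)]"
| "op_R1_U2_L1 _ = []"

fun op_L2_U1_R2 :: "gen \<Rightarrow> (label list \<times> gen) list" where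
  "op_L2_U1_R2 X2 = [([L 2], X10)]"
| "op_L2_U1_R2 X5 = [([U 2], X12)]"
| "op_L2_U1_R2 X6 = [([R 2], X12)]"
| "op_L2_U1_R2 Y1 = [([L 2], Y7)]"
| "op_L2_U1_R2 Y3 = [([U 2], Y8)]"
| "op_L2_U1_R2 Y4 = [([R 2], Y8)]"
| "op_L2_U1_R2 _ = []"

fun op_PP :: "gen \<Rightarrow> (label list \<times> gen) list" where
  "op_PP Y1 = [([U 1, U 2], Y8)]"
| "op_PP _ = []"

definition P_pairs :: "label list list set" where
  "P_pairs = {[[U 1], [U 2]], [[L 2, U 1], [R 2]], [[R 1], [L 1, U 2]]}"

text \<open>The empty word is an idempotent: the second case is \<open>\<delta>\<^sup>1\<^sub>2(x \<otimes> I') = I \<otimes> x\<close>.\<close>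

definition op_table :: "gen \<Rightarrow> label list list \<Rightarrow> (label list \<times> gen) list" where
  "op_table g ws =
    (if ws = [] then op_none g
     else if ws = [[]] then [([], g)]
     else if ws = [[R 1], [R 2]] then op_R1_R2 g
     else if ws = [[L 2], [L 1]] then op_L2_L1 g
     else if ws = [[R 1], [U 2], [L 1]] then op_R1_U2_L1 g
     else if ws = [[L 2], [U 1], [R 2]] then op_L2_U1_R2 g
     else if ws \<in> P_pairs then op_P g
     else if ws \<in> {p @ q | p q. p \<in> P_pairs \<and> q \<in> P_pairs} then op_PP g
     else [])"

text \<open>The idempotents of the labels are forced: the inputs must be composable starting from the
  right idempotent of \<open>g\<close>, and the output label starts at the left idempotent of \<open>g\<close>.\<close>

fun composable_from :: "nat set \<Rightarrow> source_word list \<Rightarrow> bool" where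
  "composable_from y [] \<longleftrightarrow> True"
| "composable_from y ((x, w) # bs) \<longleftrightarrow> x = y \<and> composable_from (endpoint x w) bs"

definition delta_basis :: "gen \<Rightarrow> source_word list \<Rightarrow> xda b2_tensor" where
  "delta_basis g bs =
    (if composable_from (right_idem g) bs
     then (\<Sum>(w, h)\<leftarrow>op_table g (map snd bs). b2_path (left_idem g) w \<otimes> basis_elt h)
     else 0)"

definition xda_delta :: "xda \<Rightarrow> b2 list \<Rightarrow> xda b2_tensor" where
  "xda_delta x as = (\<Sum>g\<in>{g. coeff x g = 1}. \<Sum>bs\<in>listset (map b2_support as). delta_basis g bs)"

end

theory Submission
  imports Defs
begin

text \<open>The Alexander degree separates the basis elements of \<open>\<B>(2)\<close> with a given source, and a product
  of basis elements is zero or the basis element of the sum of the degrees. Since all operations are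
  multilinear and balanced, the structure relation only has to be checked on composable sequences of
  basis elements. There both sums vanish termwise unless the sequence is a concatenation of two
  inputs of the table of operations, or arises from such an input by factoring one entry. This leaves
  finitely many sequences, for which the terms are seen to cancel in pairs by evaluation.\<close>

section \<open>Independence of the standard basis\<close>

text \<open>\<open>xda_delta\<close> evaluates its inputs through \<open>b2_support\<close>, a
  definite description, so not even additivity is accessible before the standard words are known to
  be linearly independent. Independence comes from linear functionals on the path algebra
  (\<open>weight_coeff\<close>) that kill the ideal. Behind them is a picture: a vertex is a set of
  points on the positions 0, 1, 2; \<open>R i\<close> and \<open>L i\<close> move a point between i
  - 1 and i, and \<open>U i\<close> has the degree of a round trip. The number of points is
  conserved. \<open>admissible\<close> says that a degree with a part in direction i needs a point
  at i - 1 or i, and that a degree with parts in both directions needs two points; this is the exact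
  shadow of the monomial relations. The finiteness in the last step has a similar source: the inputs
  in the table have degree at most 1 in every coordinate, which bounds the words into which they can
  be factored.\<close>

definition weight :: "label list \<Rightarrow> alex" where
  "weight w = sum_list (map label_deg w)"

text \<open>A path with source \<open>x\<close> and Alexander degree \<open>d\<close> is nonzero in the quotient exactly if
  \<open>admissible x d\<close> (\<open>b2_path_normal\<close> below).\<close>

definition admissible :: "nat set \<Rightarrow> alex \<Rightarrow> bool" where
  "admissible x d = (case d of (a, b, c, e) \<Rightarrow>
     (a \<noteq> 0 \<or> b \<noteq> 0 \<longrightarrow> 0 \<in> x \<or> 1 \<in> x) \<and> (c \<noteq> 0 \<or> e \<noteq> 0 \<longrightarrow> 1 \<in> x \<or> 2 \<in> x) \<and>
     ((a \<noteq> 0 \<or> b \<noteq> 0) \<and> (c \<noteq> 0 \<or> e \<noteq> 0) \<longrightarrow> 0 \<in> x \<or> 2 \<in> x))"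

lemma weight_simps [simp]:
  "weight [] = 0" "weight (l # w) = label_deg l + weight w" "weight (v @ w) = weight v + weight w"
  by (simp_all add: weight_def)

lemma weight_replicate:
  "weight (replicate n (U i)) = (if i = 1 then (int n, int n, 0, 0) else (0, 0, int n, int n))"
  by (induction n) (auto simp: tau_def beta_def zero_prod_def)

lemma subset_012_cases:
  assumes "x \<subseteq> {0, 1, 2::nat}"
  obtains "x = {}" | "x = {0}" | "x = {1}" | "x = {2}" | "x = {0, 1}" | "x = {0, 2}" | "x = {1, 2}"
    | "x = {0, 1, 2}"
proof -
  have "x \<in> Pow {0, 1, 2}" using assms by simp
  then show thesis using that by (simp add: Pow_insert) blast
qed

lemma target_subset: "is_arrow x l \<Longrightarrow> target x l \<subseteq> {0, 1, 2}"
  by (cases l) auto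

lemma endpoint_subset: "is_path x w \<Longrightarrow> endpoint x w \<subseteq> {0, 1, 2}"
  by (induction w arbitrary: x) auto

text \<open>Nonnegativity excludes cancellation when degrees of consecutive subpaths are added: a
  coordinate that is positive on a subpath stays positive on the whole path.\<close>

lemma path_weight_nonneg:
  "is_path x w \<Longrightarrow> weight w = (a, b, c, e) \<Longrightarrow> 0 \<le> a \<and> 0 \<le> b \<and> 0 \<le> c \<and> 0 \<le> e"
proof (induction w arbitrary: x a b c e)
  case (Cons l w)
  obtain a' b' c' e' where w: "weight w = (a', b', c', e')" by (cases "weight w") auto
  from Cons.IH[OF _ w] Cons.prems w show ?case
    by (cases l) (auto simp: tau_def beta_def split: if_splits)
qed (simp add: zero_prod_def)

lemma is_arrow_R: "is_arrow x (R i) \<Longrightarrow> (i = 1 \<or> i = 2) \<and> i - 1 \<in> x \<and> i \<notin> x"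
  and is_arrow_L: "is_arrow x (L i) \<Longrightarrow> (i = 1 \<or> i = 2) \<and> i \<in> x \<and> i - 1 \<notin> x"
  and is_arrow_U: "is_arrow x (U i) \<Longrightarrow> i = 1 \<or> i = 2"
proof -
  have ne: "i = 1 \<or> i = 2 \<Longrightarrow> i \<noteq> i - 1" for i :: nat by (elim disjE) simp_all
  show "(i = 1 \<or> i = 2) \<and> i - 1 \<in> x \<and> i \<notin> x" if "is_arrow x (R i)"
  proof -
    from that have i: "i = 1 \<or> i = 2" and eq: "x \<inter> {i - 1, i} = {i - 1}"
      unfolding is_arrow.simps insert_iff empty_iff by simp_all
    have "z \<in> x \<inter> {i - 1, i} \<longleftrightarrow> z \<in> {i - 1}" for z by (simp only: eq)
    from this[of i] this[of "i - 1"] i ne[OF i] show ?thesis by simp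
  qed
  show "(i = 1 \<or> i = 2) \<and> i \<in> x \<and> i - 1 \<notin> x" if "is_arrow x (L i)"
  proof -
    from that have i: "i = 1 \<or> i = 2" and eq: "x \<inter> {i - 1, i} = {i}"
      unfolding is_arrow.simps insert_iff empty_iff by simp_all
    have "z \<in> x \<inter> {i - 1, i} \<longleftrightarrow> z \<in> {i}" for z by (simp only: eq)
    from this[of i] this[of "i - 1"] i ne[OF i] show ?thesis by simp
  qed
  show "i = 1 \<or> i = 2" if "is_arrow x (U i)"
    using that unfolding is_arrow.simps insert_iff empty_iff by simp
qed

lemma arrow_cases:
  assumes "is_arrow x l"
  obtains "l = R 1" "0 \<in> x" "1 \<notin> x" | "l = R 2" "1 \<in> x" "2 \<notin> x"
    | "l = L 1" "1 \<in> x" "0 \<notin> x" | "l = L 2" "2 \<in> x" "1 \<notin> x" | "l = U 1" | "l = U 2"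
proof (cases l)
  case l: (R i)
  from is_arrow_R[OF assms[unfolded l]] have i: "i = 1 \<and> 0 \<in> x \<and> 1 \<notin> x \<or> i = 2 \<and> 1 \<in> x \<and> 2 \<notin> x"
    by (elim conjE disjE) simp_all
  show ?thesis using that(1,2) l i by blast
next
  case l: (L i)
  from is_arrow_L[OF assms[unfolded l]] have i: "i = 1 \<and> 1 \<in> x \<and> 0 \<notin> x \<or> i = 2 \<and> 2 \<in> x \<and> 1 \<notin> x"
    by (elim conjE disjE) simp_all
  show ?thesis using that(3,4) l i by blast
next
  case l: (U i)
  show ?thesis using that(5,6) l is_arrow_U[OF assms[unfolded l]] by blast
qed

text \<open>An \<open>R i\<close> step takes a point from i - 1 to i and an \<open>L i\<close> step
  takes it back, so the occupation number of each position changes by inflow minus outflow, both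
  read off the degree. A loop \<open>U i\<close> contributes equally to
  \<open>\<tau>\<^sub>i\<close> and \<open>\<beta>\<^sub>i\<close> and drops out.\<close>

lemma target_weight:
  assumes "is_arrow x l" "label_deg l = (a, b, c, e)"
  shows "of_bool (0 \<in> target x l) = of_bool (0 \<in> x) - a + b"
    and "of_bool (1 \<in> target x l) = of_bool (1 \<in> x) + a - b - c + e"
    and "of_bool (2 \<in> target x l) = of_bool (2 \<in> x) + c - e"
proof -
  have "of_bool (0 \<in> target x l) = of_bool (0 \<in> x) - a + b \<and>
    of_bool (1 \<in> target x l) = of_bool (1 \<in> x) + a - b - c + e \<and>
    of_bool (2 \<in> target x l) = of_bool (2 \<in> x) + c - e"
    using assms(1) by (rule arrow_cases; insert assms(2); auto simp: tau_def beta_def)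
  then show "of_bool (0 \<in> target x l) = of_bool (0 \<in> x) - a + b"
    "of_bool (1 \<in> target x l) = of_bool (1 \<in> x) + a - b - c + e"
    "of_bool (2 \<in> target x l) = of_bool (2 \<in> x) + c - e" by auto
qed

lemma endpoint_weight:
  assumes "is_path x w" "weight w = (a, b, c, e)"
  shows "of_bool (0 \<in> endpoint x w) = of_bool (0 \<in> x) - a + b"
    and "of_bool (1 \<in> endpoint x w) = of_bool (1 \<in> x) + a - b - c + e"
    and "of_bool (2 \<in> endpoint x w) = of_bool (2 \<in> x) + c - e"
proof -
  have "of_bool (0 \<in> endpoint x w) = of_bool (0 \<in> x) - a + b \<and>
    of_bool (1 \<in> endpoint x w) = of_bool (1 \<in> x) + a - b - c + e \<and>
    of_bool (2 \<in> endpoint x w) = of_bool (2 \<in> x) + c - e"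
    using assms
  proof (induction w arbitrary: x a b c e)
    case (Cons l w)
    obtain a1 b1 c1 e1 where l: "label_deg l = (a1, b1, c1, e1)" by (cases "label_deg l") auto
    obtain a2 b2 c2 e2 where w: "weight w = (a2, b2, c2, e2)" by (cases "weight w") auto
    have "a = a1 + a2 \<and> b = b1 + b2 \<and> c = c1 + c2 \<and> e = e1 + e2" using Cons.prems l w by auto
    then show ?case
      using Cons.IH[OF _ w, of "target x l"] target_weight[OF _ l, of x] Cons.prems(1) by auto
  qed (simp add: zero_prod_def)
  then show "of_bool (0 \<in> endpoint x w) = of_bool (0 \<in> x) - a + b"
    "of_bool (1 \<in> endpoint x w) = of_bool (1 \<in> x) + a - b - c + e"
    "of_bool (2 \<in> endpoint x w) = of_bool (2 \<in> x) + c - e" by auto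
qed

text \<open>The occupation numbers at the end depend only on the start and the degree. Hence
  homogeneous relations compare parallel paths, and a path may be replaced by its normal word
  without disturbing composability.\<close>

lemma endpoint_determined:
  assumes "is_path x v" "is_path x w" "weight v = weight w"
  shows "endpoint x v = endpoint x w"
proof -
  obtain a b c e where w: "weight w = (a, b, c, e)" by (cases "weight w") auto
  have "of_bool (i \<in> endpoint x v) = (of_bool (i \<in> endpoint x w) :: int)" if "i \<in> {0, 1, 2}" for i
    using endpoint_weight[OF assms(1), of a b c e] endpoint_weight[OF assms(2), of a b c e] that w assms(3)
    by auto
  then have "i \<in> endpoint x v \<longleftrightarrow> i \<in> endpoint x w" if "i \<in> {0, 1, 2}" for i
    using that by (metis of_bool_eq_iff)
  then show ?thesis using endpoint_subset[OF assms(1)] endpoint_subset[OF assms(2)] by blast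
qed

text \<open>Every relation is homogeneous, and the monomial ones force a degree that is not admissible.
  Hence this coefficient vanishes on the ideal.\<close>

definition weight_coeff :: "path_alg \<Rightarrow> nat set \<Rightarrow> alex \<Rightarrow> bit" where
  "weight_coeff u x d = (\<Sum>p\<in>Poly_Mapping.keys u.
     if src p = x \<and> weight (word p) = d \<and> admissible x d then Poly_Mapping.lookup u p else 0)"

lemma weight_coeff_add: "weight_coeff (u + v) x d = weight_coeff u x d + weight_coeff v x d"
  unfolding weight_coeff_def
  by (rule setsum_keys_plus_distrib[where f = "\<lambda>p c.
       if src p = x \<and> weight (word p) = d \<and> admissible x d then c else 0"]) auto

lemma weight_coeff_diff: "weight_coeff (u - v) x d = weight_coeff u x d - weight_coeff v x d"
  by (metis add_diff_cancel diff_add_cancel weight_coeff_add)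

lemma weight_coeff_zero [simp]: "weight_coeff 0 x d = 0"
  by (simp add: weight_coeff_def)

lemma weight_coeff_single:
  "weight_coeff (Poly_Mapping.single p c) x d =
    (if src p = x \<and> weight (word p) = d \<and> admissible x d then c else 0)"
  by (simp add: weight_coeff_def)

lemma word_path_comp: "tgt p = src q \<Longrightarrow> word (path_comp p q) = word p @ word q"
  by (cases p rule: path_cases; cases q rule: path_cases; simp)

lemma weight_coeff_context:
  "weight_coeff (Poly_Mapping.single p c \<star> path_elt x w \<star> Poly_Mapping.single q c') y d =
    (if is_path x w \<and> tgt p = x \<and> endpoint x w = src q \<and> src p = y \<and>
        weight (word p) + weight w + weight (word q) = d \<and> admissible y d then c * c' else 0)"
  by (auto simp: path_elt_def path_mult_single weight_coeff_single word_path_comp add.assoc)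

text \<open>The monomial relations of \<open>b2_relations\<close>, without the demand that the word
  be a path at \<open>x\<close>; off paths \<open>path_elt\<close> is zero anyway.\<close>

definition vanishing_word :: "nat set \<Rightarrow> label list \<Rightarrow> bool" where
  "vanishing_word x w \<longleftrightarrow>
     w = [R 1, R 2] \<or> w = [L 2, L 1] \<or> (\<exists>i. w = [U i] \<and> x \<inter> {i - 1, i} = {})"

lemma vanishing_word_cases:
  assumes "vanishing_word x w" "is_path x w"
  shows "w = [R 1, R 2] \<and> x = {0} \<or> w = [L 2, L 1] \<and> x = {2} \<or>
    w = [U 1] \<and> (x = {} \<or> x = {2}) \<or> w = [U 2] \<and> (x = {} \<or> x = {0})"
  by (rule subset_012_cases[OF is_path_source[OF assms(2)]]; insert assms)
     (auto simp: vanishing_word_def)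

text \<open>The three clauses of \<open>admissible\<close> now say that each of {0, 1}, {1, 2}, {0,
  2} meets \<open>y\<close>, which takes two points.\<close>

lemma admissible_mixed:
  assumes "admissible y (a, b, c, e)" "a \<noteq> 0 \<or> b \<noteq> 0" "c \<noteq> 0 \<or> e \<noteq> 0"
  shows "of_bool (0 \<in> y) + of_bool (1 \<in> y) + of_bool (2 \<in> y) \<ge> (2 :: int)"
  using assms by (auto simp: admissible_def)

text \<open>A vanishing word starts at a vertex with at most one point, and the number of points is
  conserved, so \<open>y\<close> has at most one point as well. The two-letter words have degree in
  both directions, which takes two points. For a loop at an empty pair of positions, admissibility
  puts a point of \<open>y\<close> into that pair; it can only have left by a move in the other
  direction, so the degree is mixed again.\<close>

lemma not_admissible_vanishing:
  assumes u: "is_path y u" and w: "is_path (endpoint y u) w" and v: "is_path (endpoint y (u @ w)) v"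
    and vanish: "vanishing_word (endpoint y u) w"
  shows "\<not> admissible y (weight (u @ w @ v))"
proof
  assume adm: "admissible y (weight (u @ w @ v))"
  obtain a b c e where wu: "weight u = (a, b, c, e)" by (cases "weight u") auto
  obtain a' b' c' e' where wv: "weight v = (a', b', c', e')" by (cases "weight v") auto
  note nonneg = path_weight_nonneg[OF u wu] path_weight_nonneg[OF v wv]
  note ends = endpoint_weight[OF u wu]
  note mixed = admissible_mixed[of y "a + _" "b + _" "c + _" "e + _"]
  show False using vanishing_word_cases[OF vanish w]
  proof (elim disjE conjE)
    assume w: "w = [R 1, R 2]" and x: "endpoint y u = {0}"
    have "admissible y (a + (1 + a'), b + b', c + (1 + c'), e + e')"
      using adm by (simp add: w wu wv tau_def)
    from mixed[OF this] nonneg ends show False by (simp add: x)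
  next
    assume w: "w = [L 2, L 1]" and x: "endpoint y u = {2}"
    have "admissible y (a + a', b + (1 + b'), c + c', e + (1 + e'))"
      using adm by (simp add: w wu wv beta_def)
    from mixed[OF this] nonneg ends show False by (simp add: x)
  next
    assume w: "w = [U 1]" and x: "endpoint y u = {}"
    have "admissible y (a + (1 + a'), b + (1 + b'), c + c', e + e')"
      using adm by (simp add: w wu wv tau_def beta_def)
    then have "of_bool (0 \<in> y) + of_bool (1 \<in> y) \<ge> (1 :: int)"
      using nonneg by (auto simp: admissible_def)
    moreover have "of_bool (0 \<in> y) \<ge> (0 :: int)" "of_bool (2 \<in> y) \<ge> (0 :: int)" by simp_all
    moreover have "of_bool (0 \<in> y) + of_bool (1 \<in> y) + of_bool (2 \<in> y) = (0 :: int)"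
      using ends by (simp add: x)
    ultimately show False by linarith
  next
    assume w: "w = [U 1]" and x: "endpoint y u = {2}"
    have adm: "admissible y (a + (1 + a'), b + (1 + b'), c + c', e + e')"
      using adm by (simp add: w wu wv tau_def beta_def)
    then have "of_bool (0 \<in> y) + of_bool (1 \<in> y) \<ge> (1 :: int)"
      using nonneg by (auto simp: admissible_def)
    \<comment> \<open>The only point starts at 0 or 1 and ends at 2, so \<open>u\<close> has
      positive degree in \<open>\<tau>\<^sub>2\<close>.\<close>
    moreover from this have "c + c' \<noteq> 0" using ends nonneg by (simp add: x)
    ultimately show False using mixed[OF adm] nonneg ends by (simp add: x)
  next
    assume w: "w = [U 2]" and x: "endpoint y u = {}"
    have "admissible y (a + a', b + b', c + (1 + c'), e + (1 + e'))"
      using adm by (simp add: w wu wv tau_def beta_def)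
    then have "of_bool (1 \<in> y) + of_bool (2 \<in> y) \<ge> (1 :: int)"
      using nonneg by (auto simp: admissible_def)
    moreover have "of_bool (0 \<in> y) \<ge> (0 :: int)" "of_bool (2 \<in> y) \<ge> (0 :: int)" by simp_all
    moreover have "of_bool (0 \<in> y) + of_bool (1 \<in> y) + of_bool (2 \<in> y) = (0 :: int)"
      using ends by (simp add: x)
    ultimately show False by linarith
  next
    assume w: "w = [U 2]" and x: "endpoint y u = {0}"
    have adm: "admissible y (a + a', b + b', c + (1 + c'), e + (1 + e'))"
      using adm by (simp add: w wu wv tau_def beta_def)
    then have "of_bool (1 \<in> y) + of_bool (2 \<in> y) \<ge> (1 :: int)"
      using nonneg by (auto simp: admissible_def)
    \<comment> \<open>The mirror image: the only point starts at 1 or 2 and ends at 0, so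
      \<open>u\<close> has positive degree in \<open>\<beta>\<^sub>1\<close>.\<close>
    moreover from this have "b + b' \<noteq> 0" using ends nonneg by (simp add: x)
    ultimately show False using mixed[OF adm] nonneg ends by (simp add: x)
  qed
qed

text \<open>By bilinearity the outer factors are multiples of single paths. A binomial relation then
  gives two parallel paths of equal degree, whose coefficients cancel; a monomial one gives a path
  of inadmissible degree, which the coefficient ignores by definition.\<close>

lemma weight_coeff_relation:
  assumes "r \<in> b2_relations"
  shows "weight_coeff (u \<star> r \<star> v) y d = 0"
proof (induction u rule: path_alg_induct)
  case (single p c)
  show ?case
  proof (induction v rule: path_alg_induct)
    case (single q c')
    let ?P = "Poly_Mapping.single p c" and ?Q = "Poly_Mapping.single q c'"
    have same: "weight_coeff (?P \<star> (path_elt x w - path_elt x w') \<star> ?Q) y d = 0"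
      if "is_path x w" "is_path x w'" "weight w = weight w'" for x w w'
      using endpoint_determined[OF that] that
      by (simp add: path_mult_diff_left path_mult_diff_right weight_coeff_diff weight_coeff_context
          del: minus_bit_def)
    have zero: "weight_coeff (?P \<star> path_elt x w \<star> ?Q) y d = 0"
      if "vanishing_word x w" for x w
    proof -
      obtain y' u' where p: "is_path y' u'" "p = Abs_path (y', u')" by (rule path_cases)
      obtain z v' where q: "is_path z v'" "q = Abs_path (z, v')" by (rule path_cases)
      show ?thesis using not_admissible_vanishing[of y' u' w v'] p q that
        by (auto simp: weight_coeff_context add.assoc simp del: is_path.simps)
    qed
    from assms consider
      (comm) x i l where "r = path_elt x [U i, l] - path_elt x [l, U i]" "is_path x [l]" "i \<in> {1, 2}"
    | (RL) x i where "r = path_elt x [R i, L i] - path_elt x [U i]" "is_path x [R i, L i]"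
    | (LR) x i where "r = path_elt x [L i, R i] - path_elt x [U i]" "is_path x [L i, R i]"
    | (zero) x w where "r = path_elt x w"
       "vanishing_word x w"
      unfolding b2_relations_def vanishing_word_def by blast
    then show ?case
    proof cases
      case comm
      then show ?thesis using target_subset[of x l] is_arrow_source[of x l]
        by (simp only:, intro same) auto
    next
      case RL
      then show ?thesis by (simp only:, intro same) auto
    next
      case LR
      then show ?thesis by (simp only:, intro same) auto
    next
      case zero
      then show ?thesis using \<open>\<And>x w. _ \<Longrightarrow> weight_coeff (?P \<star> path_elt x w \<star> ?Q) y d = 0\<close> by blast
    qed
  qed (simp add: path_mult_add_right weight_coeff_add)
qed (simp add: path_mult_add_left weight_coeff_add)

lemma weight_coeff_ideal:
  assumes "u \<in> b2_ideal" shows "weight_coeff u x d = 0"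
  using assms unfolding b2_ideal_def
proof (induction rule: group_closure.induct)
  case (base s)
  then consider "s = 0" | u r v where "r \<in> b2_relations" "s = u \<star> r \<star> v" by auto
  then show ?case by cases (simp_all add: weight_coeff_relation)
qed (simp add: weight_coeff_diff)

text \<open>Relations can only show that paths agree in the quotient; these functionals are the
  means to show that they differ.\<close>

lift_definition b2_coeff :: "b2 \<Rightarrow> nat set \<Rightarrow> alex \<Rightarrow> bit" is weight_coeff
proof (intro ext)
  fix u v x d assume "b2_cong u v"
  then have "weight_coeff u x d - weight_coeff v x d = 0"
    unfolding b2_cong_def weight_coeff_diff[symmetric] by (rule weight_coeff_ideal)
  then show "weight_coeff u x d = weight_coeff v x d" by (simp only: right_minus_eq)
qed

lemma b2_coeff_add: "b2_coeff (a + b) x d = b2_coeff a x d + b2_coeff b x d"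
  by transfer (rule weight_coeff_add)

lemma b2_coeff_zero [simp]: "b2_coeff 0 x d = 0"
  by transfer simp

lemma b2_coeff_path:
  "b2_coeff (b2_path y w) x d =
    (if is_path y w \<and> y = x \<and> weight w = d \<and> admissible x d then 1 else 0)"
  by transfer (auto simp: path_elt_def weight_coeff_single)

section \<open>Spanning\<close>

lemma b2_path_eq_0: "\<not> is_path x w \<Longrightarrow> b2_path x w = 0"
  by transfer (simp add: path_elt_def b2_cong_def b2_ideal_zero)

lemma b2_path_mult:
  "b2_path x w * b2_path y v = (if endpoint x w = y then b2_path x (w @ v) else 0)"
  by transfer (auto simp: path_elt_def path_mult_single b2_cong_def b2_ideal_zero)

lemma b2_path_append: "b2_path x (w @ v) = b2_path x w * b2_path (endpoint x w) v"
  by (simp add: b2_path_mult)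

lemma b2_relation_ideal: "r \<in> b2_relations \<Longrightarrow> r \<in> b2_ideal"
proof -
  assume "r \<in> b2_relations"
  then have "path_one \<star> r \<star> path_one \<in> {u \<star> r \<star> v | u r v. r \<in> b2_relations}" by blast
  then show ?thesis unfolding b2_ideal_def by (simp add: group_closure.base)
qed

text \<open>If \<open>l\<close> does not start at \<open>x\<close>, both sides are zero; loops can
  thus be moved through arbitrary words.\<close>

lemma b2_path_comm1: "i \<in> {1, 2} \<Longrightarrow> b2_path x [U i, l] = b2_path x [l, U i]"
proof (cases "is_path x [l]")
  case True
  assume "i \<in> {1, 2}"
  then have "path_elt x [U i, l] - path_elt x [l, U i] \<in> b2_relations"
    using True unfolding b2_relations_def by blast
  then show ?thesis by transfer (simp only: b2_cong_def b2_relation_ideal)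
next
  case False
  then have "\<not> is_path x [U i, l]" "\<not> is_path x [l, U i]"
    using is_arrow_source target_subset by auto
  then show ?thesis using b2_path_eq_0 by metis
qed

lemma b2_path_RL1: "is_path x [R i, L i] \<Longrightarrow> b2_path x [R i, L i] = b2_path x [U i]"
  and b2_path_LR1: "is_path x [L i, R i] \<Longrightarrow> b2_path x [L i, R i] = b2_path x [U i]"
  by (transfer, unfold b2_cong_def, rule b2_relation_ideal, unfold b2_relations_def, blast)+

lemma b2_path_vanishing1: "vanishing_word x w \<Longrightarrow> b2_path x w = 0"
proof (cases "is_path x w")
  case True
  assume "vanishing_word x w"
  then have "path_elt x w \<in> b2_relations"
    using True unfolding b2_relations_def vanishing_word_def by blast
  then have "path_elt x w - 0 \<in> b2_ideal" by (simp only: b2_relation_ideal diff_zero)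
  then show ?thesis by transfer (simp only: b2_cong_def)
qed (simp add: b2_path_eq_0)

lemma b2_path_context:
  assumes "b2_path x w = b2_path x w'" "endpoint x w = endpoint x w'"
  shows "b2_path x (w @ v) = b2_path x (w' @ v)"
  using assms by (simp add: b2_path_append)

lemma arrow_source_cases:
  assumes "is_arrow x l"
  obtains "l = R 1" "x = {0}" "target x l = {1}" | "l = R 1" "x = {0, 2}" "target x l = {1, 2}"
    | "l = R 2" "x = {1}" "target x l = {2}" | "l = R 2" "x = {0, 1}" "target x l = {0, 2}"
    | "l = L 1" "x = {1}" "target x l = {0}" | "l = L 1" "x = {1, 2}" "target x l = {0, 2}"
    | "l = L 2" "x = {2}" "target x l = {1}" | "l = L 2" "x = {0, 2}" "target x l = {0, 1}"
    | "l = U 1" "target x l = x" | "l = U 2" "target x l = x"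
proof -
  have x: "x \<subseteq> {0, 1, 2}" using assms by (rule is_arrow_source)
  show thesis
  proof (rule arrow_cases[OF assms])
    assume l: "l = R 1" "0 \<in> x" "1 \<notin> x"
    then have "x = {0} \<or> x = {0, 2}" using x by (elim subset_012_cases) simp_all
    then show thesis using l(1) by (elim disjE) (rule that(1), simp_all, rule that(2), simp_all)
  next
    assume l: "l = R 2" "1 \<in> x" "2 \<notin> x"
    then have "x = {1} \<or> x = {0, 1}" using x by (elim subset_012_cases) simp_all
    then show thesis using l(1)
      by (elim disjE) (rule that(3), simp_all, rule that(4), simp_all, auto)
  next
    assume l: "l = L 1" "1 \<in> x" "0 \<notin> x"
    then have "x = {1} \<or> x = {1, 2}" using x by (elim subset_012_cases) simp_all
    then show thesis using l(1) by (elim disjE) (rule that(5), simp_all, rule that(6), simp_all)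
  next
    assume l: "l = L 2" "2 \<in> x" "1 \<notin> x"
    then have "x = {2} \<or> x = {0, 2}" using x by (elim subset_012_cases) simp_all
    then show thesis using l(1)
      by (elim disjE) (rule that(7), simp_all, rule that(8), simp_all, auto)
  qed (use that(9,10) in simp_all)
qed

lemma b2_path_U_Cons:
  assumes "i \<in> {1, 2}"
  shows "b2_path x (U i # l # w) = b2_path x (l # U i # w)"
  using b2_path_context[OF b2_path_comm1[OF assms, of x l], of w] by simp

lemma b2_path_Cons_cong:
  assumes "b2_path (target x l) w = b2_path (target x l) v"
  shows "b2_path x (l # w) = b2_path x (l # v)"
  using assms b2_path_append[of x "[l]" w] b2_path_append[of x "[l]" v] by simp

lemma b2_path_Cons_0:
  assumes "b2_path (target x l) w = 0"
  shows "b2_path x (l # w) = 0"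
  using assms b2_path_append[of x "[l]" w] by simp

lemma b2_path_U_append:
  assumes "i \<in> {1, 2}"
  shows "b2_path x (U i # u @ v) = b2_path x (u @ U i # v)"
proof (induction u arbitrary: x)
  case (Cons l u)
  have "b2_path x (U i # (l # u) @ v) = b2_path x (l # U i # u @ v)"
    by (simp add: b2_path_U_Cons[OF assms])
  also have "\<dots> = b2_path x (l # u @ U i # v)"
    by (rule b2_path_Cons_cong) (rule Cons.IH)
  finally show ?case by simp
qed simp

lemma b2_path_cancel:
  "is_arrow x (R i) \<Longrightarrow> b2_path x (R i # L i # w) = b2_path x (U i # w)"
  "is_arrow x (L i) \<Longrightarrow> b2_path x (L i # R i # w) = b2_path x (U i # w)"
proof -
  assume x: "is_arrow x (R i)"
  have "is_path x [R i, L i] \<and> endpoint x [R i, L i] = x"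
    using x by (rule arrow_source_cases) (use x in auto)
  with b2_path_context[of x "[R i, L i]" "[U i]" w] b2_path_RL1[of x i]
  show "b2_path x (R i # L i # w) = b2_path x (U i # w)" by (simp del: is_path.simps)
next
  assume x: "is_arrow x (L i)"
  have "is_path x [L i, R i] \<and> endpoint x [L i, R i] = x"
    using x by (rule arrow_source_cases) (use x in auto)
  with b2_path_context[of x "[L i, R i]" "[U i]" w] b2_path_LR1[of x i]
  show "b2_path x (L i # R i # w) = b2_path x (U i # w)" by (simp del: is_path.simps)
qed

lemma b2_path_vanishing: "vanishing_word x w \<Longrightarrow> b2_path x (w @ v) = 0"
  by (simp add: b2_path_append b2_path_vanishing1)

lemma b2_path_zero:
  "b2_path {} (U i # w) = 0"
  "b2_path {0} (U 2 # w) = 0" "b2_path {2} (U 1 # w) = 0"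
  "b2_path {0} (R 1 # R 2 # w) = 0" "b2_path {2} (L 2 # L 1 # w) = 0"
proof -
  have "vanishing_word {} [U i]" "vanishing_word {0} [U 2]" "vanishing_word {2} [U 1]"
    unfolding vanishing_word_def by (intro disjI2 exI conjI; (rule refl)?; simp)+
  from this[THEN b2_path_vanishing, of w]
  show "b2_path {} (U i # w) = 0" "b2_path {0} (U 2 # w) = 0" "b2_path {2} (U 1 # w) = 0"
    by simp_all
  have "vanishing_word {0} [R 1, R 2]" "vanishing_word {2} [L 2, L 1]"
    unfolding vanishing_word_def by blast+
  from this[THEN b2_path_vanishing, of w]
  show "b2_path {0} (R 1 # R 2 # w) = 0" "b2_path {2} (L 2 # L 1 # w) = 0" by simp_all
qed

text \<open>Distinctness of vertices as literal sets lets simplification discard the families of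
  \<open>b2_basis\<close> that sit at another vertex.\<close>

lemma vertex_neq:
  "{0::nat, 1} \<noteq> {0, 2}" "{0::nat, 1} \<noteq> {1, 2}" "{0::nat, 2} \<noteq> {1, 2}"
  "{0::nat, 2} \<noteq> {0, 1}" "{1::nat, 2} \<noteq> {0, 1}" "{1::nat, 2} \<noteq> {0, 2}"
  "{0::nat, 1, 2} \<noteq> {0, 1}" "{0::nat, 1, 2} \<noteq> {0, 2}" "{0::nat, 1, 2} \<noteq> {1, 2}"
  "{0::nat, 1} \<noteq> {0, 1, 2}" "{0::nat, 2} \<noteq> {0, 1, 2}" "{1::nat, 2} \<noteq> {0, 1, 2}"
  "{0} \<noteq> {1::nat}" "{0} \<noteq> {2::nat}" "{1} \<noteq> {2::nat}"
  "{1} \<noteq> {0::nat}" "{2} \<noteq> {0::nat}" "{2} \<noteq> {1::nat}"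
  by (simp_all add: doubleton_eq_iff, (rule notI, drule arg_cong[where f = card], simp)+)

lemma singleton_vertex_neq:
  "{a::nat} \<noteq> {0, 1}" "{a} \<noteq> {0, 2}" "{a} \<noteq> {1, 2}" "{a} \<noteq> {0, 1, 2}"
  "{0, 1} \<noteq> {a::nat}" "{0, 2} \<noteq> {a}" "{1, 2} \<noteq> {a}" "{0, 1, 2} \<noteq> {a}"
  by (rule notI, drule arg_cong[where f = card], simp)+

lemma b2_basis_at:
  "({}, v) \<in> b2_basis \<longleftrightarrow> v = []"
  "({0}, v) \<in> b2_basis \<longleftrightarrow> (\<exists>i. v = replicate i (U 1) \<or> v = R 1 # replicate i (U 1))"
  "({1}, v) \<in> b2_basis \<longleftrightarrow> (\<exists>i. v = L 1 # replicate i (U 1) \<or> v = [] \<or> v = replicate (Suc i) (U 1) \<or>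
     v = replicate (Suc i) (U 2) \<or> v = R 2 # replicate i (U 2))"
  "({2}, v) \<in> b2_basis \<longleftrightarrow> (\<exists>i. v = replicate i (U 2) \<or> v = L 2 # replicate i (U 2))"
  "({0, 1}, v) \<in> b2_basis \<longleftrightarrow> (\<exists>p i j. (p = [] \<or> p = [R 2] \<or> p = [R 2, R 1]) \<and>
     v = p @ replicate i (U 1) @ replicate j (U 2))"
  "({0, 2}, v) \<in> b2_basis \<longleftrightarrow> (\<exists>p i j. (p = [] \<or> p = [L 2] \<or> p = [R 1]) \<and>
     v = p @ replicate i (U 1) @ replicate j (U 2))"
  "({1, 2}, v) \<in> b2_basis \<longleftrightarrow> (\<exists>p i j. (p = [] \<or> p = [L 1, L 2] \<or> p = [L 1]) \<and>
     v = p @ replicate i (U 1) @ replicate j (U 2))"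
  "({0, 1, 2}, v) \<in> b2_basis \<longleftrightarrow> (\<exists>i j. v = replicate i (U 1) @ replicate j (U 2))"
proof -
  note [simp del] = One_nat_def insert_iff
  note facts = b2_basis_def Un_iff UN_iff mem_Collect_eq Pair_inject insert_iff empty_iff
    vertex_neq singleton_vertex_neq insert_not_empty insert_not_empty[symmetric] Suc_eq_plus1
  have [simp]: "(0::nat) \<noteq> 1" "(0::nat) \<noteq> 2" "(1::nat) \<noteq> 2" by simp_all
  show "({}, v) \<in> b2_basis \<longleftrightarrow> v = []" by (simp add: facts)
  show "({0}, v) \<in> b2_basis \<longleftrightarrow> (\<exists>i. v = replicate i (U 1) \<or> v = R 1 # replicate i (U 1))"
    by (simp add: facts)
  show "({1}, v) \<in> b2_basis \<longleftrightarrow> (\<exists>i. v = L 1 # replicate i (U 1) \<or> v = [] \<or> v = replicate (Suc i) (U 1) \<or>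
     v = replicate (Suc i) (U 2) \<or> v = R 2 # replicate i (U 2))"
    by (simp add: facts)
  show "({2}, v) \<in> b2_basis \<longleftrightarrow> (\<exists>i. v = replicate i (U 2) \<or> v = L 2 # replicate i (U 2))"
    by (simp add: facts) blast
  show "({0, 1}, v) \<in> b2_basis \<longleftrightarrow> (\<exists>p i j. (p = [] \<or> p = [R 2] \<or> p = [R 2, R 1]) \<and>
     v = p @ replicate i (U 1) @ replicate j (U 2))"
    by (simp add: facts) blast
  show "({0, 2}, v) \<in> b2_basis \<longleftrightarrow> (\<exists>p i j. (p = [] \<or> p = [L 2] \<or> p = [R 1]) \<and>
     v = p @ replicate i (U 1) @ replicate j (U 2))"
    by (simp add: facts) blast
  show "({1, 2}, v) \<in> b2_basis \<longleftrightarrow> (\<exists>p i j. (p = [] \<or> p = [L 1, L 2] \<or> p = [L 1]) \<and>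
     v = p @ replicate i (U 1) @ replicate j (U 2))"
    by (simp add: facts) blast
  show "({0, 1, 2}, v) \<in> b2_basis \<longleftrightarrow> (\<exists>i j. v = replicate i (U 1) @ replicate j (U 2))"
    by (simp add: facts)
qed

text \<open>All relations are monomial or equate two words, so a path reduces to zero or to one
  basis word, never to a longer combination. In this sharp form the induction along the path
  proceeds letter by letter.\<close>

definition spanned :: "nat set \<Rightarrow> label list \<Rightarrow> bool" where
  "spanned x w \<longleftrightarrow> b2_path x w = 0 \<or> (\<exists>v. (x, v) \<in> b2_basis \<and> b2_path x w = b2_path x v)"

lemma spanned_0: "b2_path x w = 0 \<Longrightarrow> spanned x w"
  and spanned_basis: "(x, w) \<in> b2_basis \<Longrightarrow> spanned x w"
  and spanned_cong: "b2_path x w = b2_path x v \<Longrightarrow> spanned x v \<Longrightarrow> spanned x w"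
  by (auto simp: spanned_def)

lemma b2_path_U_powers:
  "b2_path x (U 1 # u @ replicate i (U 1) @ v) = b2_path x (u @ replicate (Suc i) (U 1) @ v)"
  "b2_path x (U 2 # u @ replicate i (U 1) @ replicate j (U 2)) =
    b2_path x (u @ replicate i (U 1) @ replicate (Suc j) (U 2))"
  using b2_path_U_append[of 1 x u "replicate i (U 1) @ v"]
    b2_path_U_append[of 2 x "u @ replicate i (U 1)" "replicate j (U 2)"] by simp_all

declare One_nat_def [simp del]

lemma basis_words:
  "({0}, replicate i (U 1)) \<in> b2_basis" "({0}, R 1 # replicate i (U 1)) \<in> b2_basis"
  "({1}, L 1 # replicate i (U 1)) \<in> b2_basis" "({1}, replicate i (U 1)) \<in> b2_basis"
  "({1}, replicate i (U 2)) \<in> b2_basis" "({1}, R 2 # replicate i (U 2)) \<in> b2_basis"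
  "({2}, replicate i (U 2)) \<in> b2_basis" "({2}, L 2 # replicate i (U 2)) \<in> b2_basis"
proof -
  show "({1}, replicate i (U 1)) \<in> b2_basis" "({1}, replicate i (U 2)) \<in> b2_basis"
    by (cases i; unfold b2_basis_at; simp; blast)+
qed (unfold b2_basis_at, blast+)

text \<open>At {1} the loop \<open>U 1\<close> is the detour \<open>L 1\<close>, \<open>R 1\<close>
  through {0}, and \<open>U 2\<close> slides back to {0}, where it vanishes.\<close>

lemma b2_path_U1_U2: "b2_path {1} (U 1 # U 2 # w) = 0"
proof -
  have "b2_path {1} (U 1 # U 2 # w) = b2_path {1} (L 1 # R 1 # U 2 # w)"
    by (rule b2_path_cancel(2)[symmetric]) simp
  also have "\<dots> = 0"
    by (rule b2_path_Cons_0) (simp add: b2_path_U_Cons[symmetric] b2_path_zero)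
  finally show ?thesis .
qed

text \<open>The loop slides to the block of its own kind. With two or three points this always
  yields a basis word; with one point the loop may reach a vertex where it is zero, or meet the
  other loop at {1}.\<close>

lemma spanned_U:
  assumes v: "(x, v) \<in> b2_basis" and x: "x \<subseteq> {0, 1, 2}" and l: "l = U 1 \<or> l = U 2"
  shows "spanned x (l # v)"
  using x
proof (rule subset_012_cases)
  assume "x = {}"
  then show ?thesis using l by (intro spanned_0) (auto simp: b2_path_zero)
next
  assume x: "x = {0}"
  show ?thesis
  proof (cases "l = U 1")
    case True
    from v obtain i where "v = replicate i (U 1) \<or> v = R 1 # replicate i (U 1)"
      unfolding x b2_basis_at by blast
    then show ?thesis
    proof
      assume "v = replicate i (U 1)"
      then show ?thesis using basis_words(1)[of "Suc i"] spanned_basis by (simp add: True x)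
    next
      assume "v = R 1 # replicate i (U 1)"
      then show ?thesis using spanned_cong[OF b2_path_U_Cons spanned_basis] basis_words(2)[of "Suc i"]
        by (simp add: True x)
    qed
  next
    case False
    then show ?thesis using l x by (intro spanned_0) (auto simp: b2_path_zero)
  qed
next
  assume x: "x = {2}"
  show ?thesis
  proof (cases "l = U 2")
    case True
    from v obtain i where "v = replicate i (U 2) \<or> v = L 2 # replicate i (U 2)"
      unfolding x b2_basis_at by blast
    then show ?thesis
    proof
      assume "v = replicate i (U 2)"
      then show ?thesis using basis_words(7)[of "Suc i"] spanned_basis by (simp add: True x)
    next
      assume "v = L 2 # replicate i (U 2)"
      then show ?thesis using spanned_cong[OF b2_path_U_Cons spanned_basis] basis_words(8)[of "Suc i"]
        by (simp add: True x)
    qed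
  next
    case False
    then show ?thesis using l x by (intro spanned_0) (auto simp: b2_path_zero)
  qed
next
  assume x: "x = {1}"
  from v consider i where "v = L 1 # replicate i (U 1)" | "v = []" | i where "v = U 1 # replicate i (U 1)"
    | i where "v = U 2 # replicate i (U 2)" | i where "v = R 2 # replicate i (U 2)"
    unfolding x b2_basis_at replicate_Suc by blast
  then show ?thesis
  proof cases
    case (1 i)
    from l show ?thesis
    proof
      assume "l = U 1"
      then show ?thesis using spanned_cong[OF b2_path_U_Cons spanned_basis] basis_words(3)[of "Suc i"]
        by (simp add: 1 x)
    next
      assume "l = U 2"
      then show ?thesis
        using spanned_0[OF trans[OF b2_path_U_Cons b2_path_Cons_0]] by (simp add: 1 x b2_path_zero)
    qed
  next
    case 2
    then show ?thesis using l basis_words(4,5)[of "Suc 0"] spanned_basis by (auto simp: x)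
  next
    case (3 i)
    have "b2_path {1} (U 2 # U 1 # replicate i (U 1)) = 0"
      using b2_path_U_Cons[of 2 "{1}" "U 1"] b2_path_U1_U2 by simp
    then show ?thesis using l basis_words(4)[of "Suc (Suc i)"]
      by (auto simp: 3 x spanned_0 spanned_basis)
  next
    case (4 i)
    then show ?thesis using l basis_words(5)[of "Suc (Suc i)"] b2_path_U1_U2
      by (auto simp: x spanned_0 spanned_basis)
  next
    case (5 i)
    from l show ?thesis
    proof
      assume "l = U 2"
      then show ?thesis using spanned_cong[OF b2_path_U_Cons spanned_basis] basis_words(6)[of "Suc i"]
        by (simp add: 5 x)
    next
      assume "l = U 1"
      then show ?thesis
        using spanned_0[OF trans[OF b2_path_U_Cons b2_path_Cons_0]] by (simp add: 5 x b2_path_zero)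
    qed
  qed
next
  assume x: "x = {0, 1}"
  from v obtain p i j where p: "p = [] \<or> p = [R 2] \<or> p = [R 2, R 1]"
    and v: "v = p @ replicate i (U 1) @ replicate j (U 2)" unfolding x b2_basis_at by blast
  have "(x, p @ replicate i' (U 1) @ replicate j' (U 2)) \<in> b2_basis" for i' j'
    unfolding x b2_basis_at using p by blast
  then show ?thesis using l b2_path_U_powers[of x p i] spanned_cong spanned_basis unfolding v by metis
next
  assume x: "x = {0, 2}"
  from v obtain p i j where p: "p = [] \<or> p = [L 2] \<or> p = [R 1]"
    and v: "v = p @ replicate i (U 1) @ replicate j (U 2)" unfolding x b2_basis_at by blast
  have "(x, p @ replicate i' (U 1) @ replicate j' (U 2)) \<in> b2_basis" for i' j'
    unfolding x b2_basis_at using p by blast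
  then show ?thesis using l b2_path_U_powers[of x p i] spanned_cong spanned_basis unfolding v by metis
next
  assume x: "x = {1, 2}"
  from v obtain p i j where p: "p = [] \<or> p = [L 1, L 2] \<or> p = [L 1]"
    and v: "v = p @ replicate i (U 1) @ replicate j (U 2)" unfolding x b2_basis_at by blast
  have "(x, p @ replicate i' (U 1) @ replicate j' (U 2)) \<in> b2_basis" for i' j'
    unfolding x b2_basis_at using p by blast
  then show ?thesis using l b2_path_U_powers[of x p i] spanned_cong spanned_basis unfolding v by metis
next
  assume x: "x = {0, 1, 2}"
  from v obtain i j where v: "v = [] @ replicate i (U 1) @ replicate j (U 2)"
    unfolding x b2_basis_at by auto
  have "(x, [] @ replicate i' (U 1) @ replicate j' (U 2)) \<in> b2_basis" for i' j'
    unfolding x b2_basis_at append_Nil by blast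
  then show ?thesis using l b2_path_U_powers[of x "[]" i] spanned_cong spanned_basis unfolding v by metis
qed

lemma spanned_cancel:
  assumes x: "is_arrow x l" and l: "l = R i \<and> l' = L i \<or> l = L i \<and> l' = R i"
    and v: "(x, v) \<in> b2_basis"
  shows "spanned x (l # l' # v)"
proof -
  have "b2_path x (l # l' # v) = b2_path x (U i # v)" using b2_path_cancel x l by blast
  moreover have "i = 1 \<or> i = 2" using x l is_arrow_R is_arrow_L by blast
  then have "spanned x (U i # v)" using spanned_U[OF v is_arrow_source[OF x]] by blast
  ultimately show ?thesis by (rule spanned_cong)
qed

text \<open>A move in front of a basis word extends its prefix to another listed prefix, or cancels
  against the opposite first letter and leaves a loop for \<open>spanned_U\<close>, or produces
  zero. The last happens only with one point: the second letter continues the move, or a leading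
  loop is pulled back to a vertex where it vanishes.\<close>

lemma spanned_Cons:
  assumes arrow: "is_arrow x l" and v: "(target x l, v) \<in> b2_basis"
  shows "spanned x (l # v)"
  using arrow
proof (rule arrow_source_cases)
  assume l: "l = R 1" and x: "x = {0}" and t: "target x l = {1}"
  note c = spanned_cancel[OF arrow, of 1 "L 1"]
  from v consider i where "v = L 1 # replicate i (U 1)" | i where "v = replicate i (U 1)"
    | i where "v = U 2 # replicate i (U 2)" | i where "v = R 2 # replicate i (U 2)"
    unfolding t b2_basis_at replicate_Suc by (metis replicate_0 replicate_Suc)
  then show ?thesis
  proof cases
    case 1 then show ?thesis using c basis_words(1) by (simp add: l x)
  next
    case 2 then show ?thesis using basis_words(2) by (simp add: l x spanned_basis)
  next
    case 3 then show ?thesis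
      by (intro spanned_0) (simp add: l x b2_path_U_Cons[symmetric] b2_path_zero)
  next
    case 4 then show ?thesis by (intro spanned_0) (simp add: l x b2_path_zero)
  qed
next
  assume l: "l = L 2" and x: "x = {2}" and t: "target x l = {1}"
  note c = spanned_cancel[OF arrow, of 2 "R 2"]
  from v consider i where "v = L 1 # replicate i (U 1)" | i where "v = replicate i (U 2)"
    | i where "v = U 1 # replicate i (U 1)" | i where "v = R 2 # replicate i (U 2)"
    unfolding t b2_basis_at replicate_Suc by (metis replicate_0 replicate_Suc)
  then show ?thesis
  proof cases
    case 1 then show ?thesis by (intro spanned_0) (simp add: l x b2_path_zero)
  next
    case 2 then show ?thesis using basis_words(8) by (simp add: l x spanned_basis)
  next
    case 3 then show ?thesis
      by (intro spanned_0) (simp add: l x b2_path_U_Cons[symmetric] b2_path_zero)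
  next
    case 4 then show ?thesis using c basis_words(7) by (simp add: l x)
  qed
next
  assume l: "l = R 2" and x: "x = {1}" and t: "target x l = {2}"
  from v obtain i where "v = replicate i (U 2) \<or> v = L 2 # replicate i (U 2)"
    unfolding t b2_basis_at by blast
  then show ?thesis
    using spanned_cancel[OF arrow, of 2 "L 2"] basis_words(5,6) spanned_basis by (auto simp: l x)
next
  assume l: "l = L 1" and x: "x = {1}" and t: "target x l = {0}"
  from v obtain i where "v = replicate i (U 1) \<or> v = R 1 # replicate i (U 1)"
    unfolding t b2_basis_at by blast
  then show ?thesis
    using spanned_cancel[OF arrow, of 1 "R 1"] basis_words(3,4) spanned_basis by (auto simp: l x)
next
  assume l: "l = R 1" and x: "x = {0, 2}" and t: "target x l = {1, 2}"
  from v obtain p i j where p: "p = [] \<or> p = [L 1, L 2] \<or> p = [L 1]"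
    and v: "v = p @ replicate i (U 1) @ replicate j (U 2)" unfolding t b2_basis_at by blast
  have "(x, q @ replicate i (U 1) @ replicate j (U 2)) \<in> b2_basis" if "q = [] \<or> q = [L 2] \<or> q = [R 1]" for q
    unfolding x b2_basis_at using that by blast
  from this[of "[]"] this[of "[L 2]"] this[of "[R 1]"] p show ?thesis
    using spanned_cancel[OF arrow, of 1 "L 1"] spanned_basis by (auto simp: v l)
next
  assume l: "l = L 1" and x: "x = {1, 2}" and t: "target x l = {0, 2}"
  from v obtain p i j where p: "p = [] \<or> p = [L 2] \<or> p = [R 1]"
    and v: "v = p @ replicate i (U 1) @ replicate j (U 2)" unfolding t b2_basis_at by blast
  have "(x, q @ replicate i (U 1) @ replicate j (U 2)) \<in> b2_basis" if "q = [] \<or> q = [L 1, L 2] \<or> q = [L 1]" for q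
    unfolding x b2_basis_at using that by blast
  from this[of "[]"] this[of "[L 1, L 2]"] this[of "[L 1]"] p show ?thesis
    using spanned_cancel[OF arrow, of 1 "R 1"] spanned_basis by (auto simp: v l)
next
  assume l: "l = R 2" and x: "x = {0, 1}" and t: "target x l = {0, 2}"
  from v obtain p i j where p: "p = [] \<or> p = [L 2] \<or> p = [R 1]"
    and v: "v = p @ replicate i (U 1) @ replicate j (U 2)" unfolding t b2_basis_at by blast
  have "(x, q @ replicate i (U 1) @ replicate j (U 2)) \<in> b2_basis" if "q = [] \<or> q = [R 2] \<or> q = [R 2, R 1]" for q
    unfolding x b2_basis_at using that by blast
  from this[of "[]"] this[of "[R 2]"] this[of "[R 2, R 1]"] p show ?thesis
    using spanned_cancel[OF arrow, of 2 "L 2"] spanned_basis by (auto simp: v l)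
next
  assume l: "l = L 2" and x: "x = {0, 2}" and t: "target x l = {0, 1}"
  from v obtain p i j where p: "p = [] \<or> p = [R 2] \<or> p = [R 2, R 1]"
    and v: "v = p @ replicate i (U 1) @ replicate j (U 2)" unfolding t b2_basis_at by blast
  have "(x, q @ replicate i (U 1) @ replicate j (U 2)) \<in> b2_basis" if "q = [] \<or> q = [L 2] \<or> q = [R 1]" for q
    unfolding x b2_basis_at using that by blast
  from this[of "[]"] this[of "[L 2]"] this[of "[R 1]"] p show ?thesis
    using spanned_cancel[OF arrow, of 2 "R 2"] spanned_basis by (auto simp: v l)
qed (use spanned_U[OF _ is_arrow_source[OF arrow]] v in auto)

lemma b2_path_spanned: "spanned x w"
proof (induction w arbitrary: x)
  case Nil
  show ?case
  proof (cases "is_path x []")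
    case True
    then have "x \<subseteq> {0, 1, 2}" by simp
    then show ?thesis
      by (rule subset_012_cases; intro spanned_basis; simp only: b2_basis_at)
         (use replicate_0 in \<open>metis append_Nil\<close>)+
  qed (simp add: b2_path_eq_0 spanned_0)
next
  case (Cons l w)
  show ?case
  proof (cases "is_arrow x l")
    case True
    from Cons[of "target x l"] consider "b2_path (target x l) w = 0"
      | v where "(target x l, v) \<in> b2_basis" "b2_path (target x l) w = b2_path (target x l) v"
      unfolding spanned_def by blast
    then show ?thesis
    proof cases
      case 1
      then show ?thesis by (intro spanned_0 b2_path_Cons_0)
    next
      case (2 v)
      then show ?thesis using spanned_cong[OF b2_path_Cons_cong spanned_Cons[OF True]] by blast
    qed
  qed (simp add: b2_path_eq_0 spanned_0)
qed

section \<open>Normal words and degrees\<close>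

lemma replicate_U_path [simp]:
  "i \<in> {1, 2} \<Longrightarrow> is_path x (replicate n (U i)) \<longleftrightarrow> x \<subseteq> {0, 1, 2}"
  "endpoint x (replicate n (U i)) = x"
  by (induction n) auto

text \<open>The word of a basis element is determined by its Alexander degree alone, whatever its source.
  On degrees that no basis element has, such as \<open>\<tau>\<^sub>1 + \<beta>\<^sub>2\<close>, the value is junk.\<close>

fun normal_word :: "alex \<Rightarrow> label list" where
  "normal_word (a, b, c, e) =
    (if a = b then (if c = e then [] else if e < c then [R 2] else [L 2])
     else if b < a then (if c = e then [R 1] else [R 2, R 1])
     else (if c = e then [L 1] else [L 1, L 2]))
    @ replicate (nat (min a b)) (U 1) @ replicate (nat (min c e)) (U 2)"

text \<open>That \<open>normal_word\<close> inverts \<open>weight\<close> on basis words is the core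
  of independence: basis words at one vertex have distinct degrees, all of them admissible and hence
  visible to \<open>b2_coeff\<close>.\<close>

lemma b2_basis_props:
  assumes "(x, w) \<in> b2_basis"
  shows "is_path x w \<and> admissible x (weight w) \<and> normal_word (weight w) = w"
proof -
  note [simp] = weight_replicate admissible_def tau_def beta_def zero_prod_def nat_add_distrib
  have "x \<subseteq> {0, 1, 2}" using assms unfolding b2_basis_def by auto
  then show ?thesis
  proof (rule subset_012_cases)
    assume x: "x = {}"
    then show ?thesis using assms by (simp add: b2_basis_at)
  next
    assume x: "x = {0}"
    with assms obtain i where "w = replicate i (U 1) \<or> w = R 1 # replicate i (U 1)"
      unfolding x b2_basis_at by blast
    then show ?thesis by (elim disjE) (simp_all add: x)
  next
    assume x: "x = {1}"
    with assms obtain i where "w = L 1 # replicate i (U 1) \<or> w = [] \<or> w = replicate (Suc i) (U 1)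
      \<or> w = replicate (Suc i) (U 2) \<or> w = R 2 # replicate i (U 2)"
      unfolding x b2_basis_at by blast
    then show ?thesis by (elim disjE) (simp_all add: x)
  next
    assume x: "x = {2}"
    with assms obtain i where "w = replicate i (U 2) \<or> w = L 2 # replicate i (U 2)"
      unfolding x b2_basis_at by blast
    then show ?thesis by (elim disjE) (simp_all add: x)
  next
    assume x: "x = {0, 1}"
    with assms obtain p i j where "p = [] \<or> p = [R 2] \<or> p = [R 2, R 1]"
      "w = p @ replicate i (U 1) @ replicate j (U 2)" unfolding x b2_basis_at by blast
    then show ?thesis by (elim disjE; simp add: x; auto)
  next
    assume x: "x = {0, 2}"
    with assms obtain p i j where "p = [] \<or> p = [L 2] \<or> p = [R 1]"
      "w = p @ replicate i (U 1) @ replicate j (U 2)" unfolding x b2_basis_at by blast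
    then show ?thesis by (elim disjE; simp add: x; auto)
  next
    assume x: "x = {1, 2}"
    with assms obtain p i j where "p = [] \<or> p = [L 1, L 2] \<or> p = [L 1]"
      "w = p @ replicate i (U 1) @ replicate j (U 2)" unfolding x b2_basis_at by blast
    then show ?thesis by (elim disjE; simp add: x; auto)
  next
    assume x: "x = {0, 1, 2}"
    with assms obtain i j where "w = replicate i (U 1) @ replicate j (U 2)"
      unfolding x b2_basis_at by blast
    then show ?thesis by (simp add: x)
  qed
qed

lemma b2_basis_is_path: "(x, w) \<in> b2_basis \<Longrightarrow> is_path x w"
  and b2_basis_admissible: "(x, w) \<in> b2_basis \<Longrightarrow> admissible x (weight w)"
  and b2_basis_normal: "(x, w) \<in> b2_basis \<Longrightarrow> normal_word (weight w) = w"
  using b2_basis_props by blast+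

text \<open>Spanning leaves two alternatives, and the coefficient at the degree of \<open>w\<close>
  decides between them: it is 1 exactly if that degree is admissible. In the nonzero case the
  coefficients also force the basis word to have the degree of \<open>w\<close>.\<close>

lemma b2_path_normal:
  assumes "is_path x w"
  shows "if admissible x (weight w)
    then (x, normal_word (weight w)) \<in> b2_basis \<and> weight (normal_word (weight w)) = weight w \<and>
      b2_path x w = b2_path x (normal_word (weight w))
    else b2_path x w = 0"
proof -
  have coeff: "b2_coeff (b2_path x w) x d = (if weight w = d \<and> admissible x d then 1 else 0)" for d
    using assms by (simp add: b2_coeff_path)
  from b2_path_spanned[of x w] show ?thesis unfolding spanned_def
  proof
    assume 0: "b2_path x w = 0"
    then show ?thesis using coeff[of "weight w"] by (auto split: if_splits)
  next
    assume "\<exists>v. (x, v) \<in> b2_basis \<and> b2_path x w = b2_path x v"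
    then obtain v where v: "(x, v) \<in> b2_basis" "b2_path x w = b2_path x v" by blast
    have "weight w = weight v"
      using coeff[of "weight v"] b2_basis_props[OF v(1)] by (simp add: v(2) b2_coeff_path split: if_splits)
    then show ?thesis using v b2_basis_props[OF v(1)] by simp
  qed
qed

lemma b2_coeff_basis:
  "(x, w) \<in> b2_basis \<Longrightarrow> b2_coeff (b2_path x w) y d = (if x = y \<and> weight w = d then 1 else 0)"
  using b2_basis_props[of x w] by (auto simp: b2_coeff_path)

lemma b2_basis_unique:
  "(x, v) \<in> b2_basis \<Longrightarrow> (x, w) \<in> b2_basis \<Longrightarrow> weight v = weight w \<Longrightarrow> v = w"
  by (metis b2_basis_normal)

section \<open>Expansion in the standard basis\<close>

lemma abs_b2_plus: "abs_b2 u + abs_b2 v = abs_b2 (u + v)"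
  by (rule plus_b2.abs_eq)

lemma b2_basis_induct [case_names zero basis add]:
  assumes zero: "P 0" and basis: "\<And>x w. (x, w) \<in> b2_basis \<Longrightarrow> P (b2_path x w)"
    and add: "\<And>a b. P a \<Longrightarrow> P b \<Longrightarrow> P (a + b)"
  shows "P a"
proof (induct a rule: b2.abs_induct)
  case (1 u)
  show ?case
  proof (induction u rule: path_alg_induct)
    case (single p c)
    obtain x w where p: "is_path x w" "p = Abs_path (x, w)" by (rule path_cases)
    show ?case
    proof (cases "c = 1")
      case True
      then have "abs_b2 (Poly_Mapping.single p c) = b2_path x w"
        by (simp add: b2_path.abs_eq path_elt_def p)
      then show ?thesis using b2_path_spanned[of x w] zero basis by (auto simp: spanned_def)
    next
      case False
      then have "abs_b2 (Poly_Mapping.single p c) = 0" by (simp add: zero_b2.abs_eq)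
      then show ?thesis using zero by simp
    qed
  qed (simp add: abs_b2_plus[symmetric] add)
qed

definition basis_sum :: "source_word set \<Rightarrow> b2" where
  "basis_sum S = (\<Sum>(x, w)\<in>S. b2_path x w)"

text \<open>Terms common to both sets occur twice and cancel. Sums over supports become additive in
  this way, since supports add by symmetric difference.\<close>

lemma sum_symmetric_diff:
  fixes f :: "'a \<Rightarrow> 'b::ab_group_add"
  assumes "finite S" "finite T" "\<And>x. f x + f x = 0"
  shows "sum f S + sum f T = sum f (sym_diff S T)"
proof -
  have "sum f S = sum f (S - T) + sum f (S \<inter> T)" "sum f T = sum f (T - S) + sum f (S \<inter> T)"
    using assms sum.Int_Diff[of S f T] sum.Int_Diff[of T f S] by (simp_all add: ac_simps)
  moreover have "sum f (S \<inter> T) + sum f (S \<inter> T) = 0"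
    by (simp add: sum.distrib[symmetric] assms(3))
  moreover have "sum f (sym_diff S T) = sum f (S - T) + sum f (T - S)"
    using assms by (intro sum.union_disjoint) auto
  ultimately show ?thesis by (simp add: algebra_simps)
qed

text \<open>Among the basis elements with source \<open>x\<close> only \<open>(x, w)\<close> has
  degree \<open>weight w\<close>, so this coefficient reads off membership.\<close>

lemma b2_coeff_basis_sum:
  assumes "finite S" "S \<subseteq> b2_basis" "(x, w) \<in> b2_basis"
  shows "b2_coeff (basis_sum S) x (weight w) = (if (x, w) \<in> S then 1 else 0)"
  using assms(1,2) unfolding basis_sum_def
proof (induction rule: finite_induct)
  case (insert m S)
  obtain y v where m: "m = (y, v)" by (cases m)
  have "(y, v) \<in> b2_basis" using insert.prems m by simp
  with b2_basis_unique[of x v w] assms(3) insert show ?case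
    by (auto simp: b2_coeff_add b2_coeff_basis m)
qed simp

lemma basis_sum_exists: "\<exists>S. finite S \<and> S \<subseteq> b2_basis \<and> a = basis_sum S"
proof (induction a rule: b2_basis_induct)
  case zero
  then show ?case by (intro exI[of _ "{}"]) (simp add: basis_sum_def)
next
  case (basis x w)
  then show ?case by (intro exI[of _ "{(x, w)}"]) (simp add: basis_sum_def)
next
  case (add a b)
  then obtain S T where "finite S" "S \<subseteq> b2_basis" "a = basis_sum S" "finite T" "T \<subseteq> b2_basis"
    "b = basis_sum T" by blast
  then show ?case
    by (intro exI[of _ "sym_diff S T"]) (auto simp: basis_sum_def intro!: sum_symmetric_diff)
qed

text \<open>Coefficients recover the set from its sum, so the definite description in
  \<open>b2_support\<close> denotes; that every element is such a sum is
  \<open>basis_sum_exists\<close>.\<close>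

lemma b2_support_basis_sum:
  assumes "finite S" "S \<subseteq> b2_basis"
  shows "b2_support (basis_sum S) = S"
  unfolding b2_support_def basis_sum_def[symmetric]
proof (rule the_equality)
  fix T assume T: "finite T \<and> T \<subseteq> b2_basis \<and> basis_sum S = basis_sum T"
  have "m \<in> T \<longleftrightarrow> m \<in> S" if "m \<in> b2_basis" for m
    using b2_coeff_basis_sum[OF assms, of "fst m" "snd m"] b2_coeff_basis_sum[of T "fst m" "snd m"] T that
    by (auto split: if_splits)
  then show "T = S" using T assms by blast
qed (use assms in simp)

lemma finite_b2_support [simp]: "finite (b2_support a)"
  and b2_support_subset: "b2_support a \<subseteq> b2_basis"
  and basis_sum_support: "basis_sum (b2_support a) = a"
  using basis_sum_exists[of a] b2_support_basis_sum by auto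

lemma b2_support_add: "b2_support (a + b) = sym_diff (b2_support a) (b2_support b)"
proof -
  have "a + b = basis_sum (sym_diff (b2_support a) (b2_support b))"
    using sum_symmetric_diff[of "b2_support a" "b2_support b" "\<lambda>(x, w). b2_path x w"]
      basis_sum_support[of a] basis_sum_support[of b]
    by (simp add: basis_sum_def split_def)
  moreover have "sym_diff (b2_support a) (b2_support b) \<subseteq> b2_basis"
    using b2_support_subset[of a] b2_support_subset[of b] by blast
  ultimately show ?thesis by (simp add: b2_support_basis_sum)
qed

lemma b2_support_zero [simp]: "b2_support 0 = {}"
  using b2_support_basis_sum[of "{}"] by (simp add: basis_sum_def)

lemma b2_support_path: "(x, w) \<in> b2_basis \<Longrightarrow> b2_support (b2_path x w) = {(x, w)}"
  using b2_support_basis_sum[of "{(x, w)}"] by (simp add: basis_sum_def)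

lemma b2_coeff_diff: "b2_coeff (a - b) x d = b2_coeff a x d - b2_coeff b x d"
  by transfer (rule weight_coeff_diff)

text \<open>The generators of \<open>b2_homog d\<close> are arbitrary paths of degree
  \<open>d\<close>, not only basis words; coefficients at any other degree vanish on them and hence
  on the whole group.\<close>

lemma b2_support_weight:
  assumes "a \<in> b2_homog d" "(x, w) \<in> b2_support a"
  shows "weight w = d"
proof (rule ccontr)
  assume ne: "weight w \<noteq> d"
  have basis: "(x, w) \<in> b2_basis" using assms(2) b2_support_subset by blast
  have "b2_coeff a x (weight w) = 0" using assms(1) unfolding b2_homog_def
  proof (induction rule: group_closure.induct)
    case (base s)
    then show ?case using ne by (auto simp: b2_coeff_path weight_def)
  next
    case (diff s t)
    then show ?case by (simp add: b2_coeff_diff del: minus_bit_def)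
  qed
  moreover have "b2_coeff a x (weight w) = 1"
    using b2_coeff_basis_sum[OF _ b2_support_subset basis, of a] assms(2)
    by (simp add: basis_sum_support)
  ultimately show False by simp
qed

section \<open>Tensors and the bimodule\<close>

lemma b2_tensor_double [simp]: "(t :: 'x::i2_bimodule b2_tensor) + t = 0"
proof transfer
  fix u :: "(b2 \<times> 'x) \<Rightarrow>\<^sub>0 bit"
  show "tensor_cong (u + u) 0" by (simp add: tensor_cong_def)
qed

lemma tensor_add_left: "(a + b) \<otimes> x = a \<otimes> x + b \<otimes> x"
  and tensor_add_right: "a \<otimes> (x + y) = a \<otimes> x + a \<otimes> y"
  and tensor_balanced: "e \<in> idem_ring \<Longrightarrow> (a * e) \<otimes> x = a \<otimes> (e \<rhd> x)"
  by (transfer, unfold tensor_cong_def, rule group_closure.base,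
      simp only: tensor_relations_def diff_diff_eq[symmetric], blast)+

lemma tensor_zero_left [simp]: "0 \<otimes> x = 0"
  using tensor_add_left[of 0 0 x] by simp

lemma tensor_zero_right [simp]: "a \<otimes> 0 = 0"
  using tensor_add_right[of a 0 0] by simp

lemma tensor_induct [case_names tensor add]:
  fixes t :: "'x::i2_bimodule b2_tensor"
  assumes tensor: "\<And>a x. P (a \<otimes> x)" and add: "\<And>s t. P s \<Longrightarrow> P t \<Longrightarrow> P (s + t)"
  shows "P t"
proof (induct t rule: b2_tensor.abs_induct)
  case (1 u)
  show ?case
  proof (induction u rule: update_induct)
    case const
    show ?case using tensor[of 0 0] by (simp add: zero_b2_tensor.abs_eq)
  next
    case (update f k c)
    obtain a x where k: "k = (a, x)" by (cases k)
    have "Poly_Mapping.update k c f = f + Poly_Mapping.single k c"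
      using update by (intro poly_mapping_eqI)
        (auto simp: lookup_add lookup_update lookup_single when_def in_keys_iff)
    moreover have "c = 1" using update by simp
    ultimately show ?case using add[OF update(3) tensor[of a x]]
      by (simp add: k plus_b2_tensor.abs_eq tensor.abs_eq)
  qed
qed

lemma
  fixes s t :: "'x::i2_bimodule b2_tensor" and x :: 'x
  shows tensor_lmult_add: "tensor_lmult a (s + t) = tensor_lmult a s + tensor_lmult a t"
  and tensor_lmult_tensor [simp]: "tensor_lmult a (b \<otimes> x) = (a * b) \<otimes> x"
proof -
  have bal: "(a * (b * e)) \<otimes> x = (a * b) \<otimes> (e \<rhd> x)" if "e \<in> idem_ring" for b e and x :: 'x
    using tensor_balanced[OF that, of "a * b" x] by (simp add: mult.assoc)
  show "tensor_lmult a (s + t) = tensor_lmult a s + tensor_lmult a t"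
    unfolding tensor_lmult_def
    by (rule tensor_lift_add) (simp_all add: distrib_left tensor_add_left tensor_add_right bal)
  show "tensor_lmult a (b \<otimes> x) = (a * b) \<otimes> x"
    unfolding tensor_lmult_def
    by (rule tensor_lift_tensor) (simp_all add: distrib_left tensor_add_left tensor_add_right bal)
qed

lemma tensor_lmult_zero [simp]: "tensor_lmult a 0 = 0"
  using tensor_lmult_add[of a 0 0] by simp

lemma tensor_lmult_add_left: "tensor_lmult (a + b) t = tensor_lmult a t + tensor_lmult b t"
  by (induction t rule: tensor_induct)
     (simp_all add: tensor_lmult_add distrib_right tensor_add_left ac_simps)

lemma tensor_lmult_mult: "tensor_lmult (a * b) t = tensor_lmult a (tensor_lmult b t)"
  by (induction t rule: tensor_induct) (simp_all add: tensor_lmult_add mult.assoc)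

lemma tensor_lmult_zero_left [simp]: "tensor_lmult 0 t = 0"
  using tensor_lmult_add_left[of 0 0 t] by simp

lemma
  fixes s t :: "'x::i2_bimodule b2_tensor" and x :: 'x
  shows tensor_ract_add: "e \<in> idem_ring \<Longrightarrow> tensor_ract (s + t) e = tensor_ract s e + tensor_ract t e"
  and tensor_ract_tensor: "e \<in> idem_ring \<Longrightarrow> tensor_ract (b \<otimes> x) e = b \<otimes> (x \<lhd> e)"
proof -
  have *: "tensor_ract (s + t) e = tensor_ract s e + tensor_ract t e \<and>
      tensor_ract (b \<otimes> x) e = b \<otimes> (x \<lhd> e)" if e: "e \<in> idem_ring"
  proof
    have bal: "(a * f) \<otimes> (x \<lhd> e) = a \<otimes> ((f \<rhd> x) \<lhd> e)" if "f \<in> idem_ring" for a f and x :: 'x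
      using tensor_balanced[OF that, of a "x \<lhd> e"] by (simp add: lact_ract[OF that e])
    show "tensor_ract (s + t) e = tensor_ract s e + tensor_ract t e"
      unfolding tensor_ract_def
      by (rule tensor_lift_add) (simp_all add: tensor_add_left tensor_add_right bal ract_add_left[OF e])
    show "tensor_ract (b \<otimes> x) e = b \<otimes> (x \<lhd> e)"
      unfolding tensor_ract_def
      by (rule tensor_lift_tensor) (simp_all add: tensor_add_left tensor_add_right bal ract_add_left[OF e])
  qed
  show "e \<in> idem_ring \<Longrightarrow> tensor_ract (s + t) e = tensor_ract s e + tensor_ract t e"
    "e \<in> idem_ring \<Longrightarrow> tensor_ract (b \<otimes> x) e = b \<otimes> (x \<lhd> e)"
    using * by auto
qed

lemma b2_minus: "(a :: b2) - b = a + b"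
  by (metis add_diff_cancel_right' b2_double add.assoc add_0_right)

lemma idem_ring_path: "x \<subseteq> {0, 1, 2} \<Longrightarrow> b2_path x [] \<in> idem_ring"
  unfolding idem_ring_def by (rule group_closure.base) blast

lemma idem_ring_add: "a \<in> idem_ring \<Longrightarrow> b \<in> idem_ring \<Longrightarrow> a + b \<in> idem_ring"
  and idem_ring_0 [simp]: "0 \<in> idem_ring"
  unfolding idem_ring_def by (simp_all add: group_closure_add)

lemma idem_ring_induct [consumes 1, case_names zero idem add]:
  assumes "e \<in> idem_ring" and zero: "P 0" and idem: "\<And>x. x \<subseteq> {0, 1, 2} \<Longrightarrow> P (b2_path x [])"
    and add: "\<And>a b. a \<in> idem_ring \<Longrightarrow> b \<in> idem_ring \<Longrightarrow> P a \<Longrightarrow> P b \<Longrightarrow> P (a + b)"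
  shows "P e"
proof -
  have "e \<in> idem_ring \<and> P e" using assms(1) unfolding idem_ring_def
  proof (induction rule: group_closure.induct)
    case (base s)
    then consider "s = 0" | x where "x \<subseteq> {0, 1, 2}" "s = b2_path x []" by auto
    then show ?case by cases (use zero idem idem_ring_path in \<open>auto simp: idem_ring_def\<close>)
  next
    case (diff s t)
    then show ?case using add[of s t] idem_ring_add[of s t] by (simp add: b2_minus idem_ring_def)
  qed
  then show ?thesis by simp
qed

lemma tensor_ract_0 [simp]: "e \<in> idem_ring \<Longrightarrow> tensor_ract 0 e = (0 :: 'x::i2_bimodule b2_tensor)"
  using tensor_ract_add[of e 0 "0 :: 'x b2_tensor"] by simp

lemma ract_zero:
  fixes x :: "'x::i2_bimodule"
  shows "x \<lhd> 0 = 0" "0 \<rhd> x = 0"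
  using ract_add_right[of 0 0 x] lact_add_left[of 0 0 x] by simp_all

lemma tensor_ract_add_right:
  assumes e: "e \<in> idem_ring" and f: "f \<in> idem_ring"
  shows "tensor_ract t (e + f) = tensor_ract t e + tensor_ract t f"
proof (induction t rule: tensor_induct)
  case (tensor a x)
  show ?case using e f by (simp add: tensor_ract_tensor idem_ring_add ract_add_right tensor_add_right)
next
  case (add s t)
  then show ?case using e f by (simp add: tensor_ract_add idem_ring_add algebra_simps)
qed

lemma tensor_ract_zero_right [simp]: "tensor_ract t 0 = 0"
  using tensor_ract_add_right[of 0 0 t] by simp

section \<open>The space \<open>xda\<close> in coordinates\<close>

lemma coeff_simps [simp]:
  "coeff 0 g = 0" "coeff (x + y) g = coeff x g + coeff y g"
  "coeff (basis_elt h) g = (if g = h then 1 else 0)"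
  "coeff (e \<rhd> x) g = idem_coeff e (left_idem g) * coeff x g"
  "coeff (x \<lhd> e) g = coeff x g * idem_coeff e (right_idem g)"
  by (simp_all only: zero_xda.rep_eq plus_xda.rep_eq basis_elt.rep_eq lact_xda.rep_eq ract_xda.rep_eq)

lemma coeff_minus [simp]: "coeff (x - y) g = coeff x g - coeff y g"
  by (simp only: minus_xda.rep_eq)

lemma xda_eqI: "(\<And>g. coeff x g = coeff y g) \<Longrightarrow> x = y"
  by (rule coeff_inject[THEN iffD1]) (rule ext)

lemma coeff_sum: "coeff (sum f S) g = (\<Sum>x\<in>S. coeff (f x) g)"
  by (induction S rule: infinite_finite_induct) simp_all

lemma xda_expand: "x = (\<Sum>g\<in>{g. coeff x g = 1}. basis_elt g)"
proof (rule xda_eqI)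
  fix g
  show "coeff x g = coeff (\<Sum>g\<in>{g. coeff x g = 1}. basis_elt g) g"
    by (cases "coeff x g") (simp_all add: coeff_sum sum.delta)
qed

lemma xda_induct [case_names zero basis add]:
  assumes zero: "P 0" and basis: "\<And>g. P (basis_elt g)" and add: "\<And>x y. P x \<Longrightarrow> P y \<Longrightarrow> P (x + y)"
  shows "P x"
proof -
  have "P (\<Sum>g\<in>S. basis_elt g)" for S
    by (induction S rule: infinite_finite_induct) (use assms in simp_all)
  then show ?thesis by (subst xda_expand)
qed

lemma idem_lact_basis:
  assumes "y \<subseteq> {0, 1, 2}"
  shows "b2_path y [] \<rhd> basis_elt g = (if y = left_idem g then basis_elt g else 0)"
proof (rule xda_eqI)
  fix h
  show "coeff (b2_path y [] \<rhd> basis_elt g) h = coeff (if y = left_idem g then basis_elt g else 0) h"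
    by (cases "h = g"; cases "y = left_idem g") (simp_all add: idem_coeff_b2_path[OF left_idem_subset])
qed

lemma idem_ract_basis:
  assumes "y \<subseteq> {0, 1, 2}"
  shows "basis_elt g \<lhd> b2_path y [] = (if y = right_idem g then basis_elt g else 0)"
proof (rule xda_eqI)
  fix h
  show "coeff (basis_elt g \<lhd> b2_path y []) h = coeff (if y = right_idem g then basis_elt g else 0) h"
    by (cases "h = g"; cases "y = right_idem g") (simp_all add: idem_coeff_b2_path[OF right_idem_subset])
qed

section \<open>The bigrading\<close>

lemma xda_grading_iff: "x \<in> xda_grading d \<longleftrightarrow> (\<forall>g. coeff x g = 1 \<longrightarrow> kind_degree (gen_kind g) = d)"
proof
  assume "x \<in> xda_grading d"
  then show "\<forall>g. coeff x g = 1 \<longrightarrow> kind_degree (gen_kind g) = d" unfolding xda_grading_def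
  proof (induction rule: group_closure.induct)
    case (base s)
    then show ?case by (auto split: if_splits)
  next
    case (diff s t)
    have "coeff s g = 1 \<or> coeff t g = 1" if "coeff (s - t) g = 1" for g
      using that by (cases "coeff s g"; cases "coeff t g") simp_all
    with diff show ?case by blast
  qed
next
  assume *: "\<forall>g. coeff x g = 1 \<longrightarrow> kind_degree (gen_kind g) = d"
  have "(\<Sum>g\<in>S. basis_elt g) \<in> xda_grading d" if "S \<subseteq> {g. coeff x g = 1}" for S
    using finite[of S] that
  proof (induction S rule: finite_induct)
    case (insert g S)
    then have "basis_elt g \<in> xda_grading d"
      unfolding xda_grading_def using * by (intro group_closure.base) auto
    then show ?case using insert unfolding xda_grading_def by (simp add: group_closure_add)
  qed (simp add: xda_grading_def)
  from this[of "{g. coeff x g = 1}"] show "x \<in> xda_grading d" by (simp flip: xda_expand)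
qed

lift_definition grading_part :: "xda \<Rightarrow> int \<times> alex \<Rightarrow> xda" is
  "\<lambda>x d g. if kind_degree (gen_kind g) = d then x g else 0" .

lemma coeff_grading_part [simp]:
  "coeff (grading_part x d) g = (if kind_degree (gen_kind g) = d then coeff x g else 0)"
  by (simp only: grading_part.rep_eq)

text \<open>A component in degree \<open>d\<close> has nonzero coordinates only at generators of
  degree \<open>d\<close>, so at \<open>g\<close> a single summand survives. Existence and
  uniqueness of the decomposition both rest on this.\<close>

lemma coeff_sum_keys:
  assumes "\<forall>d. Poly_Mapping.lookup c d \<in> xda_grading d"
  shows "coeff (\<Sum>d\<in>Poly_Mapping.keys c. Poly_Mapping.lookup c d) g =
    coeff (Poly_Mapping.lookup c (kind_degree (gen_kind g))) g"
proof -
  have "coeff (Poly_Mapping.lookup c d) g =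
      (if d = kind_degree (gen_kind g) then coeff (Poly_Mapping.lookup c d) g else 0)" for d
    using assms[rule_format, of d] by (cases "coeff (Poly_Mapping.lookup c d) g") (auto simp: xda_grading_iff)
  then have "coeff (\<Sum>d\<in>Poly_Mapping.keys c. Poly_Mapping.lookup c d) g =
      (\<Sum>d\<in>Poly_Mapping.keys c. if d = kind_degree (gen_kind g) then coeff (Poly_Mapping.lookup c d) g else 0)"
    unfolding coeff_sum by (intro sum.cong) auto
  then show ?thesis by (simp add: in_keys_iff)
qed

lemma xda_grading_direct_sum:
  "\<exists>!c :: (int \<times> alex) \<Rightarrow>\<^sub>0 xda. (\<forall>d. Poly_Mapping.lookup c d \<in> xda_grading d) \<and>
     x = (\<Sum>d\<in>Poly_Mapping.keys c. Poly_Mapping.lookup c d)"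
proof (rule ex1I)
  define c where "c = Abs_poly_mapping (grading_part x)"
  \<comment> \<open>\<open>Abs_poly_mapping\<close> can be evaluated only for finite support; here
    the support lies among the degrees of the finitely many generators.\<close>
  have "{d. grading_part x d \<noteq> 0} \<subseteq> range (\<lambda>g. kind_degree (gen_kind g))"
  proof
    fix d assume "d \<in> {d. grading_part x d \<noteq> 0}"
    then have "\<exists>g. coeff (grading_part x d) g \<noteq> coeff 0 g" using xda_eqI[of "grading_part x d" 0] by blast
    then show "d \<in> range (\<lambda>g. kind_degree (gen_kind g))" by (auto split: if_splits)
  qed
  then have "finite {d. grading_part x d \<noteq> 0}" by (rule finite_subset) simp
  then have lookup: "Poly_Mapping.lookup c d = grading_part x d" for d
    by (simp add: c_def Abs_poly_mapping_inverse)
  have graded: "\<forall>d. Poly_Mapping.lookup c d \<in> xda_grading d"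
    by (simp add: lookup xda_grading_iff)
  moreover have "x = (\<Sum>d\<in>Poly_Mapping.keys c. Poly_Mapping.lookup c d)"
    by (rule xda_eqI) (simp add: coeff_sum_keys[OF graded], simp add: lookup)
  ultimately show "(\<forall>d. Poly_Mapping.lookup c d \<in> xda_grading d) \<and>
     x = (\<Sum>d\<in>Poly_Mapping.keys c. Poly_Mapping.lookup c d)" ..
  fix c' assume c': "(\<forall>d. Poly_Mapping.lookup c' d \<in> xda_grading d) \<and>
     x = (\<Sum>d\<in>Poly_Mapping.keys c'. Poly_Mapping.lookup c' d)"
  have "coeff (Poly_Mapping.lookup c' d) g = coeff (grading_part x d) g" for d g
  proof (cases "kind_degree (gen_kind g) = d")
    case True
    then show ?thesis using coeff_sum_keys[of c' g] c' by simp
  next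
    case False
    have "Poly_Mapping.lookup c' d \<in> xda_grading d" using c' by blast
    with False have "coeff (Poly_Mapping.lookup c' d) g \<noteq> 1" unfolding xda_grading_iff by blast
    with False show ?thesis by simp
  qed
  then show "c' = c" by (intro poly_mapping_eqI) (simp add: lookup xda_eqI)
qed

section \<open>Sums over products of supports\<close>

lemma finite_listset: "\<forall>A\<in>set As. finite A \<Longrightarrow> finite (listset As)"
  by (induction As) (auto simp: set_Cons_def finite_image_set2)

lemma sum_listset_Cons:
  fixes f :: "'a list \<Rightarrow> 'b::comm_monoid_add"
  assumes "finite A" "\<forall>A\<in>set As. finite A"
  shows "(\<Sum>ms\<in>listset (A # As). f ms) = (\<Sum>m\<in>A. \<Sum>ms\<in>listset As. f (m # ms))"
proof -
  have "listset (A # As) = (\<lambda>(m, ms). m # ms) ` (A \<times> listset As)"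
    by (auto simp: set_Cons_def)
  moreover have "inj_on (\<lambda>(m, ms). m # ms) (A \<times> listset As)" by (auto simp: inj_on_def)
  ultimately show ?thesis using assms finite_listset[of As]
    by (simp add: sum.reindex sum.cartesian_product split_def del: listset.simps)
qed

lemma sum_listset_append:
  fixes f :: "'a list \<Rightarrow> 'b::comm_monoid_add"
  assumes "\<forall>A\<in>set As. finite A" "\<forall>B\<in>set Bs. finite B"
  shows "(\<Sum>ms\<in>listset (As @ Bs). f ms) = (\<Sum>us\<in>listset As. \<Sum>vs\<in>listset Bs. f (us @ vs))"
  using assms(1)
proof (induction As arbitrary: f)
  case (Cons A As)
  have fin: "finite A" "\<forall>C\<in>set As. finite C" "\<forall>C\<in>set (As @ Bs). finite C"
    using Cons.prems assms(2) by auto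
  show ?case
    unfolding append_Cons sum_listset_Cons[OF fin(1,3)] sum_listset_Cons[OF fin(1,2)]
    by (intro sum.cong refl Cons.IH fin)
qed simp

section \<open>The finite part of the structure relation\<close>

text \<open>\<open>op_table\<close> branches on sets given by comprehension, whereas a list of
  inputs can be both looked up and enumerated by evaluation. The last nine rows are the
  concatenations of two elements of \<open>P_pairs\<close>.\<close>

definition op_entries :: "(label list list \<times> (gen \<Rightarrow> (label list \<times> gen) list)) list" where
  "op_entries =
    [([], op_none),
     ([[]], \<lambda>g. [([], g)]),
     ([[R 1], [R 2]], op_R1_R2),
     ([[L 2], [L 1]], op_L2_L1),
     ([[R 1], [U 2], [L 1]], op_R1_U2_L1),
     ([[L 2], [U 1], [R 2]], op_L2_U1_R2),
     ([[U 1], [U 2]], op_P),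
     ([[L 2, U 1], [R 2]], op_P),
     ([[R 1], [L 1, U 2]], op_P),
     ([[U 1], [U 2], [U 1], [U 2]], op_PP),
     ([[U 1], [U 2], [L 2, U 1], [R 2]], op_PP),
     ([[U 1], [U 2], [R 1], [L 1, U 2]], op_PP),
     ([[L 2, U 1], [R 2], [U 1], [U 2]], op_PP),
     ([[L 2, U 1], [R 2], [L 2, U 1], [R 2]], op_PP),
     ([[L 2, U 1], [R 2], [R 1], [L 1, U 2]], op_PP),
     ([[R 1], [L 1, U 2], [U 1], [U 2]], op_PP),
     ([[R 1], [L 1, U 2], [L 2, U 1], [R 2]], op_PP),
     ([[R 1], [L 1, U 2], [R 1], [L 1, U 2]], op_PP)]"

lemma op_table_code [code]:
  "op_table g ws = (case map_of op_entries ws of None \<Rightarrow> [] | Some f \<Rightarrow> f g)"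
proof -
  have "{p @ q |p q. p \<in> P_pairs \<and> q \<in> P_pairs} = (\<Union>p\<in>P_pairs. (@) p ` P_pairs)" by blast
  then show ?thesis
    unfolding op_table_def P_pairs_def op_entries_def by simp
qed

text \<open>The inputs are pairwise distinct, so every row is the one found by lookup.\<close>

lemma op_entries_op_table: "(ws, f) \<in> set op_entries \<Longrightarrow> f g = op_table g ws"
proof -
  have "distinct (map fst op_entries)" by (simp add: op_entries_def)
  then show "(ws, f) \<in> set op_entries \<Longrightarrow> f g = op_table g ws" by (simp add: op_table_code)
qed

lemma op_table_nonempty:
  assumes "op_table g ws \<noteq> []" obtains f where "(ws, f) \<in> set op_entries"
  using assms map_of_SomeD[of op_entries ws] that by (auto simp: op_table_code split: option.splits)

text \<open>The words and the starting vertex determine all later vertices, so sources are dropped.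
  Admissibility is an executable necessary condition that stands in for membership in
  \<open>b2_basis\<close>.\<close>

fun composable_words :: "nat set \<Rightarrow> label list list \<Rightarrow> bool" where
  "composable_words x [] \<longleftrightarrow> True"
| "composable_words x (w # ws) \<longleftrightarrow>
     is_path x w \<and> admissible x (weight w) \<and> composable_words (endpoint x w) ws"

text \<open>The summands of the two sums in the structure relation. An output is recorded by its Alexander
  degree and its generator, which suffices because the left idempotent is fixed.\<close>

definition composite_terms :: "gen \<Rightarrow> label list list \<Rightarrow> (alex \<times> gen) list" where
  "composite_terms g ws = concat (map (\<lambda>j. concat (map (\<lambda>(w, h).
     map (\<lambda>(w', h'). (weight (w @ w'), h')) (op_table h (drop j ws))) (op_table g (take j ws))))
     [0..<Suc (length ws)])"

definition merge_terms :: "gen \<Rightarrow> label list list \<Rightarrow> (alex \<times> gen) list" where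
  "merge_terms g ws = concat (map (\<lambda>j.
     let d = weight (ws ! j @ ws ! (j + 1)) in
     if admissible (foldl endpoint (right_idem g) (take j ws)) d
     then map (\<lambda>(w, h). (weight w, h)) (op_table g (take j ws @ normal_word d # drop (j + 2) ws))
     else []) [0..<length ws - 1])"

text \<open>Decides whether every element occurs an even number of times, which makes a sum over the
  list vanish in characteristic two.\<close>

function cancels :: "'a list \<Rightarrow> bool" where
  "cancels [] \<longleftrightarrow> True"
| "cancels (x # xs) \<longleftrightarrow> x \<in> set xs \<and> cancels (remove1 x xs)"
  by pat_completeness auto
termination by (relation "measure length") (auto simp: length_remove1)

text \<open>The values of \<open>normal_word\<close> on the degrees with all coordinates 0 or
  1.\<close>

definition small_words :: "label list list" where
  "small_words = [[], [R 1], [L 1], [R 2], [L 2], [U 1], [U 2], [R 2, R 1], [L 1, L 2],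
     [U 1, U 2], [R 1, U 2], [L 1, U 2], [R 2, U 1], [L 2, U 1]]"

text \<open>One line for each word that occurs as an input in the table. Pairs are matched by degree
  alone, so some do not compose, such as \<open>[L 1, L 2]\<close> before \<open>[R 1]\<close>;
  \<open>composable_words\<close> removes those later.\<close>

definition factorizations :: "label list \<Rightarrow> (label list \<times> label list) list" where
  "factorizations t =
    (if t = [] then [([], [])]
     else if t = [R 1] then [([], [R 1]), ([R 1], [])]
     else if t = [R 2] then [([], [R 2]), ([R 2], [])]
     else if t = [L 1] then [([], [L 1]), ([L 1], [])]
     else if t = [L 2] then [([], [L 2]), ([L 2], [])]
     else if t = [U 1] then [([], [U 1]), ([L 1], [R 1]), ([R 1], [L 1]), ([U 1], [])]
     else if t = [U 2] then [([], [U 2]), ([L 2], [R 2]), ([R 2], [L 2]), ([U 2], [])]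
     else if t = [L 2, U 1] then [([], [L 2, U 1]), ([L 2], [U 1]), ([L 1, L 2], [R 1]), ([R 1], [L 1, L 2]), ([U 1], [L 2]), ([L 2, U 1], [])]
     else if t = [L 1, U 2] then [([], [L 1, U 2]), ([R 2], [L 1, L 2]), ([U 2], [L 1]), ([L 1], [U 2]), ([L 1, L 2], [R 2]), ([L 1, U 2], [])]
     else [])"

text \<open>Only these input sequences can contribute: concatenations of two table inputs, and table inputs
  with one entry factored. All other sequences make every summand zero.\<close>

definition critical_words :: "gen \<Rightarrow> label list list list" where
  "critical_words g = concat (map (\<lambda>(t, f).
     concat (map (\<lambda>(w, h). map ((@) t) (map fst (filter (\<lambda>(s, f'). f' h \<noteq> []) op_entries))) (f g))
     @ (if f g = [] then [] else concat (map (\<lambda>j.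
         map (\<lambda>(u, v). take j t @ u # v # drop (j + 1) t) (factorizations (t ! j)))
         [0..<length t]))) op_entries)"

lemma factorizations_complete:
  "list_all (\<lambda>(t, f). list_all (\<lambda>w. list_all (\<lambda>u. list_all (\<lambda>v.
     weight (u @ v) = weight w \<longrightarrow> (u, v) \<in> set (factorizations w)) small_words) small_words) t)
     op_entries"
  by code_simp

text \<open>Outputs of inadmissible degree are zero in the algebra, so they require no partner to
  cancel with.\<close>

definition relation_holds :: "gen \<Rightarrow> label list list \<Rightarrow> bool" where
  "relation_holds g ws \<longleftrightarrow> cancels (filter (\<lambda>(d, h). admissible (left_idem g) d)
     (composite_terms g ws @ merge_terms g ws))"

definition critical_check :: "gen \<Rightarrow> bool" where
  "critical_check g \<longleftrightarrow> list_all (\<lambda>ws. composable_words (right_idem g) ws \<longrightarrow> relation_holds g ws)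
     (critical_words g)"

lemma critical_check_Z: "list_all critical_check [Z1, Z2, Z3, Z4]"
  by code_simp

lemma critical_check_X: "list_all critical_check [X1, X2, X3, X4, X5, X6, X7, X8, X9, X10, X11, X12]"
  by code_simp

lemma critical_check_Y1: "critical_check Y1"
  by code_simp

lemma critical_check_Y: "list_all critical_check [Y2, Y3, Y4, Y5, Y6, Y7, Y8]"
  by code_simp

section \<open>Linearity and degrees of the operations\<close>

definition basis_path :: "source_word \<Rightarrow> b2" where
  "basis_path m = b2_path (fst m) (snd m)"

lemma basis_path_Pair [simp]: "basis_path (x, w) = b2_path x w"
  by (simp add: basis_path_def)

definition gen_delta :: "gen \<Rightarrow> b2 list \<Rightarrow> xda b2_tensor" where
  "gen_delta g as = (\<Sum>ms\<in>listset (map b2_support as). delta_basis g ms)"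

lemma xda_delta_eq: "xda_delta x as = (\<Sum>g\<in>{g. coeff x g = 1}. gen_delta g as)"
  by (simp add: xda_delta_def gen_delta_def)

lemma xda_delta_add: "xda_delta (x + y) as = xda_delta x as + xda_delta y as"
proof -
  have "{g. coeff (x + y) g = 1} = sym_diff {g. coeff x g = 1} {g. coeff y g = 1}" (is "?A = ?B")
  proof (intro set_eqI)
    fix g
    show "g \<in> ?A \<longleftrightarrow> g \<in> ?B" by (cases "coeff x g"; cases "coeff y g") simp_all
  qed
  then show ?thesis unfolding xda_delta_eq by (simp add: sum_symmetric_diff)
qed

lemma xda_delta_zero [simp]: "xda_delta 0 as = 0"
  using xda_delta_add[of 0 0 as] by simp

lemma xda_delta_basis [simp]: "xda_delta (basis_elt g) as = gen_delta g as"
  by (simp add: xda_delta_eq)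

lemma gen_delta_append:
  "gen_delta g (as @ a # bs) = (\<Sum>us\<in>listset (map b2_support as). \<Sum>m\<in>b2_support a.
     \<Sum>vs\<in>listset (map b2_support bs). delta_basis g (us @ m # vs))"
  unfolding gen_delta_def map_append list.map
  by (subst sum_listset_append) (auto simp: sum_listset_Cons simp del: listset.simps)

lemma gen_delta_add_input:
  "gen_delta g (as @ (a + b) # bs) = gen_delta g (as @ a # bs) + gen_delta g (as @ b # bs)"
  by (simp add: gen_delta_append b2_support_add sum_symmetric_diff sum.distrib[symmetric])

lemma xda_delta_add_input:
  "xda_delta x (as @ (a + b) # bs) = xda_delta x (as @ a # bs) + xda_delta x (as @ b # bs)"
  by (simp add: xda_delta_eq gen_delta_add_input sum.distrib)

lemma xda_delta_zero_input [simp]: "xda_delta x (as @ 0 # bs) = 0"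
  using xda_delta_add_input[of x as 0 0 bs] by simp

lemma listset_singletons: "listset (map (\<lambda>m. {m}) ms) = {ms}"
  by (induction ms) (auto simp: set_Cons_def)

lemma basis_path_support: "m \<in> b2_basis \<Longrightarrow> b2_support (basis_path m) = {m}"
  by (cases m) (simp add: b2_support_path)

lemma gen_delta_basis:
  assumes "set ms \<subseteq> b2_basis"
  shows "gen_delta g (map basis_path ms) = delta_basis g ms"
proof -
  have "map b2_support (map basis_path ms) = map (\<lambda>m. {m}) ms"
    unfolding map_map by (rule map_cong) (use assms in \<open>auto simp only: comp_apply basis_path_support dest: subsetD\<close>)
  then show ?thesis by (simp only: gen_delta_def listset_singletons) simp
qed

lemma composable_from_append:
  "composable_from y (us @ vs) \<longleftrightarrow>
     composable_from y us \<and> composable_from (foldl endpoint y (map snd us)) vs"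
  by (induction us arbitrary: y) auto

lemma delta_basis_not_composable: "\<not> composable_from (right_idem g) ms \<Longrightarrow> delta_basis g ms = 0"
  by (simp add: delta_basis_def)

lemma gen_delta_first:
  assumes "(x, w) \<in> b2_basis" "x \<noteq> right_idem g"
  shows "gen_delta g (b2_path x w # as) = 0"
  using gen_delta_append[of g "[]" "b2_path x w" as] assms
  by (simp add: b2_support_path delta_basis_not_composable)

lemma gen_delta_not_composable:
  assumes "(x, w) \<in> b2_basis" "(y, v) \<in> b2_basis" "endpoint x w \<noteq> y"
  shows "gen_delta g (as @ b2_path x w # b2_path y v # bs) = 0"
proof -
  have "delta_basis g (us @ (x, w) # (y, v) # vs) = 0" for us vs
    using assms(3) by (simp add: delta_basis_not_composable composable_from_append)
  then show ?thesis
    unfolding gen_delta_append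
    by (simp add: b2_support_path[OF assms(1)] b2_support_path[OF assms(2)] sum_listset_Cons del: listset.simps)
qed

lemma b2_idem_mult:
  assumes "(x, w) \<in> b2_basis"
  shows "b2_path y [] * b2_path x w = (if y = x then b2_path x w else 0)"
    and "b2_path x w * b2_path y [] = (if endpoint x w = y then b2_path x w else 0)"
  by (simp_all add: b2_path_mult)

text \<open>For the idempotent at \<open>y\<close>, a generator and a basis input, the left side
  survives if \<open>y\<close> is the right idempotent of the generator, the right side if
  \<open>y\<close> is the source of the input. The conditions differ only if the input does not
  match the generator, and then the operation vanishes.\<close>

lemma xda_delta_balanced_first:
  assumes "e \<in> idem_ring"
  shows "xda_delta (x \<lhd> e) (a # as) = xda_delta x ((e * a) # as)"
  using assms
proof (induction e rule: idem_ring_induct)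
  case zero
  then show ?case using xda_delta_zero_input[of x "[]" as] by (simp add: ract_zero)
next
  case (add e f)
  then show ?case using xda_delta_add_input[of x "[]" "e * a" "f * a" as]
    by (simp add: ract_add_right xda_delta_add distrib_right)
next
  case (idem y)
  show ?case
  proof (induction x rule: xda_induct)
    case zero
    then show ?case using ract_add_left[OF idem_ring_path[OF idem], of "0 :: xda" 0] by simp
  next
    case (add x x')
    then show ?case by (simp add: ract_add_left idem_ring_path idem xda_delta_add)
  next
    case (basis g)
    show ?case
    proof (induction a rule: b2_basis_induct)
      case zero
      show ?case using xda_delta_zero_input[of _ "[]" as] by simp
    next
      case (add a b)
      then show ?case using xda_delta_add_input[of _ "[]" _ _ as] by (simp add: distrib_left)
    next
      case (basis x w)
      then show ?case using xda_delta_zero_input[of "basis_elt g" "[]" as] gen_delta_first[OF basis]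
        by (simp add: idem_ract_basis[OF idem] b2_idem_mult)
    qed
  qed
qed

text \<open>An idempotent between two basis inputs tests the target of one or the source of the
  other. The tests disagree only on inputs that do not compose, where the operation is zero.\<close>

lemma xda_delta_balanced:
  assumes "e \<in> idem_ring"
  shows "xda_delta x (as @ (a * e) # b # bs) = xda_delta x (as @ a # (e * b) # bs)"
proof -
  note add1 = xda_delta_add_input[of x as _ _ "_ # bs"]
    and add2 = xda_delta_add_input[of x "as @ [_]" _ _ bs, simplified]
    and zero1 = xda_delta_zero_input[of x as "_ # bs"]
    and zero2 = xda_delta_zero_input[of x "as @ [_]" bs, simplified]
  show ?thesis using assms
  proof (induction e rule: idem_ring_induct)
    case (idem y)
    show ?case
    proof (induction a rule: b2_basis_induct)
      case (basis x1 w)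
      note m1 = this
      show ?case
      proof (induction b rule: b2_basis_induct)
        case (basis x2 v)
        have "endpoint x1 w \<noteq> x2 \<Longrightarrow> xda_delta x (as @ b2_path x1 w # b2_path x2 v # bs) = 0"
          using gen_delta_not_composable[OF m1 basis] by (simp add: xda_delta_eq)
        then show ?case
          by (auto simp: b2_idem_mult[OF m1] b2_idem_mult[OF basis] zero1 zero2)
      qed (simp_all add: distrib_left add2 zero2)
    qed (simp_all add: distrib_right add1 zero1)
  qed (simp_all add: distrib_left distrib_right add1 add2 zero1 zero2)
qed

section \<open>Idempotents and degrees in the table\<close>

definition all_gens :: "gen list" where
  "all_gens = [Z1, Z2, Z3, Z4, X1, X2, X3, X4, X5, X6, X7, X8, X9, X10, X11, X12,
     Y1, Y2, Y3, Y4, Y5, Y6, Y7, Y8]"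

lemma all_gens: "g \<in> set all_gens"
  by (cases g) (simp_all add: all_gens_def)

text \<open>The facts about single table entries that later arguments use, verified in one
  evaluation. With \<open>length ws\<close> inputs the operation is
  \<open>\<delta>\<^sup>1\<^sub>i\<close> for \<open>i = length ws + 1\<close>, so the shift
  \<open>2 - i\<close> appears as \<open>1 - length ws\<close>.\<close>

lemma op_table_check:
  "list_all (\<lambda>g. list_all (\<lambda>(ws, f). list_all (\<lambda>(w, h).
      is_path (left_idem g) w \<and> endpoint (left_idem g) w = left_idem h \<and>
      foldl endpoint (right_idem g) ws = right_idem h \<and>
      fst (kind_degree (gen_kind g)) + (1 - int (length ws)) = fst (kind_degree (gen_kind h)) \<and>
      snd (kind_degree (gen_kind g)) + sum_list (map weight ws) = weight w + snd (kind_degree (gen_kind h)))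
    (f g)) op_entries) all_gens"
  by code_simp

lemma op_table_props:
  assumes "(w, h) \<in> set (op_table g ws)"
  shows "is_path (left_idem g) w" "endpoint (left_idem g) w = left_idem h"
    "foldl endpoint (right_idem g) ws = right_idem h"
    "fst (kind_degree (gen_kind g)) + (1 - int (length ws)) = fst (kind_degree (gen_kind h))"
    "snd (kind_degree (gen_kind g)) + sum_list (map weight ws) = weight w + snd (kind_degree (gen_kind h))"
proof -
  have "op_table g ws \<noteq> []" using assms by force
  then obtain f where f: "(ws, f) \<in> set op_entries" by (rule op_table_nonempty)
  then have "list_all (\<lambda>(w, h).
      is_path (left_idem g) w \<and> endpoint (left_idem g) w = left_idem h \<and>
      foldl endpoint (right_idem g) ws = right_idem h \<and>
      fst (kind_degree (gen_kind g)) + (1 - int (length ws)) = fst (kind_degree (gen_kind h)) \<and>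
      snd (kind_degree (gen_kind g)) + sum_list (map weight ws) = weight w + snd (kind_degree (gen_kind h)))
    (op_table g ws)"
    using op_table_check all_gens[of g] f op_entries_op_table[OF f] unfolding list_all_iff by force
  then have "is_path (left_idem g) w \<and> endpoint (left_idem g) w = left_idem h \<and>
      foldl endpoint (right_idem g) ws = right_idem h \<and>
      fst (kind_degree (gen_kind g)) + (1 - int (length ws)) = fst (kind_degree (gen_kind h)) \<and>
      snd (kind_degree (gen_kind g)) + sum_list (map weight ws) = weight w + snd (kind_degree (gen_kind h))"
    using assms unfolding list_all_iff by blast
  then show "is_path (left_idem g) w" "endpoint (left_idem g) w = left_idem h"
    "foldl endpoint (right_idem g) ws = right_idem h"
    "fst (kind_degree (gen_kind g)) + (1 - int (length ws)) = fst (kind_degree (gen_kind h))"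
    "snd (kind_degree (gen_kind g)) + sum_list (map weight ws) = weight w + snd (kind_degree (gen_kind h))"
    by blast+
qed

lemma additive_sum:
  fixes f :: "'a::ab_group_add \<Rightarrow> 'b::ab_group_add"
  assumes add: "\<And>s t. f (s + t) = f s + f t"
  shows "f 0 = 0" "f (sum h S) = (\<Sum>x\<in>S. f (h x))" "f (sum_list xs) = (\<Sum>x\<leftarrow>xs. f x)"
proof -
  show 0: "f 0 = 0" using add[of 0 0] by simp
  show "f (sum h S) = (\<Sum>x\<in>S. f (h x))"
    by (induction S rule: infinite_finite_induct) (simp_all add: 0 add)
  show "f (sum_list xs) = (\<Sum>x\<leftarrow>xs. f x)"
    by (induction xs) (simp_all add: 0 add)
qed

definition entry_tensor :: "gen \<Rightarrow> label list \<times> gen \<Rightarrow> xda b2_tensor" where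
  "entry_tensor g p = b2_path (left_idem g) (fst p) \<otimes> basis_elt (snd p)"

lemma delta_basis_eq:
  "delta_basis g ms = (if composable_from (right_idem g) ms
     then (\<Sum>p\<leftarrow>op_table g (map snd ms). entry_tensor g p) else 0)"
  by (simp add: delta_basis_def entry_tensor_def split_def)

lemma delta_basis_lmult:
  assumes "y \<subseteq> {0, 1, 2}"
  shows "tensor_lmult (b2_path y []) (delta_basis g ms) = (if y = left_idem g then delta_basis g ms else 0)"
proof -
  have "tensor_lmult (b2_path y []) (\<Sum>p\<leftarrow>ps. entry_tensor g p) =
      (if y = left_idem g then \<Sum>p\<leftarrow>ps. entry_tensor g p else 0)" for ps
    by (induction ps) (simp_all add: tensor_lmult_add, simp_all add: entry_tensor_def b2_path_mult)
  then show ?thesis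
    by (cases "composable_from (right_idem g) ms")
       (simp_all only: delta_basis_eq if_True if_False tensor_lmult_zero if_cancel)
qed

text \<open>By the table check every output generator has as right idempotent the vertex where the
  inputs end, so an idempotent on the right keeps all terms or none.\<close>

lemma delta_basis_ract:
  assumes y: "y \<subseteq> {0, 1, 2}"
  shows "tensor_ract (delta_basis g ms) (b2_path y []) =
    (if y = foldl endpoint (right_idem g) (map snd ms) then delta_basis g ms else 0)"
proof -
  \<comment> \<open>Stated for all lists of table entries, so that the induction over the list keeps
    the facts about each entry at hand.\<close>
  have "tensor_ract (\<Sum>p\<leftarrow>ps. entry_tensor g p) (b2_path y []) =
      (if y = foldl endpoint (right_idem g) (map snd ms) then \<Sum>p\<leftarrow>ps. entry_tensor g p else 0)"
    if "set ps \<subseteq> set (op_table g (map snd ms))" for ps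
    using that
  proof (induction ps)
    case (Cons p ps)
    then have end_p: "right_idem (snd p) = foldl endpoint (right_idem g) (map snd ms)"
      using op_table_props(3)[of "fst p" "snd p" g "map snd ms"] by simp
    have "tensor_ract (entry_tensor g p) (b2_path y []) =
        (if y = foldl endpoint (right_idem g) (map snd ms) then entry_tensor g p else 0)"
      unfolding entry_tensor_def tensor_ract_tensor[OF idem_ring_path[OF y]] idem_ract_basis[OF y]
      using end_p by simp
    with Cons show ?case by (simp add: tensor_ract_add idem_ring_path y)
  qed (simp add: idem_ring_path y)
  from this[OF subset_refl] show ?thesis
    by (cases "composable_from (right_idem g) ms")
       (simp_all only: delta_basis_eq if_True if_False if_cancel tensor_ract_0[OF idem_ring_path[OF y]])
qed

lemma xda_delta_left_linear:
  assumes "e \<in> idem_ring"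
  shows "xda_delta (e \<rhd> x) as = tensor_lmult e (xda_delta x as)"
  using assms
proof (induction e rule: idem_ring_induct)
  case zero
  then show ?case by (simp add: ract_zero)
next
  case (add e f)
  then show ?case by (simp add: lact_add_left xda_delta_add tensor_lmult_add_left)
next
  case (idem y)
  show ?case
  proof (induction x rule: xda_induct)
    case zero
    then show ?case using lact_add_right[OF idem_ring_path[OF idem], of "0 :: xda" 0] by simp
  next
    case (add x x')
    then show ?case by (simp add: lact_add_right idem_ring_path idem xda_delta_add tensor_lmult_add)
  next
    case (basis g)
    show ?case
      by (simp add: idem_lact_basis[OF idem] gen_delta_def delta_basis_lmult[OF idem]
          additive_sum[of "tensor_lmult _", OF tensor_lmult_add])
  qed
qed

lemma xda_delta_right_linear_Nil:
  assumes "e \<in> idem_ring"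
  shows "xda_delta (x \<lhd> e) [] = tensor_ract (xda_delta x []) e"
  using assms
proof (induction e rule: idem_ring_induct)
  case zero
  then show ?case by (simp add: ract_zero)
next
  case (add e f)
  then show ?case by (simp add: ract_add_right xda_delta_add tensor_ract_add_right)
next
  case (idem y)
  show ?case
  proof (induction x rule: xda_induct)
    case zero
    then show ?case using ract_add_left[OF idem_ring_path[OF idem], of "0 :: xda" 0] idem_ring_path[OF idem] by simp
  next
    case (add x x')
    then show ?case by (simp add: ract_add_left idem_ring_path idem xda_delta_add tensor_ract_add)
  next
    case (basis g)
    show ?case
      using delta_basis_ract[OF idem, of g "[]"] idem_ring_path[OF idem]
      by (simp add: idem_ract_basis[OF idem] gen_delta_def)
  qed
qed

lemma xda_delta_right_linear:
  assumes "e \<in> idem_ring"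
  shows "xda_delta x (as @ [a * e]) = tensor_ract (xda_delta x (as @ [a])) e"
  using assms
proof (induction e rule: idem_ring_induct)
  case zero
  then show ?case by simp
next
  case (add e f)
  then show ?case by (simp add: distrib_left xda_delta_add_input tensor_ract_add_right)
next
  case (idem y)
  note ract_add = tensor_ract_add[OF idem_ring_path[OF idem]]
  show ?case
  proof (induction a rule: b2_basis_induct)
    case zero
    then show ?case using idem_ring_path[OF idem] by simp
  next
    case (add a b)
    then show ?case by (simp add: distrib_right xda_delta_add_input ract_add)
  next
    case (basis z w)
    show ?case
    proof (induction x rule: xda_induct)
      case (basis g)
      have eq: "gen_delta g (as @ [b2_path z w]) = (\<Sum>us\<in>listset (map b2_support as). delta_basis g (us @ [(z, w)]))"
        using \<open>(z, w) \<in> b2_basis\<close> by (simp add: gen_delta_append b2_support_path)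
      have act: "tensor_ract (delta_basis g (us @ [(z, w)])) (b2_path y []) =
          (if y = endpoint z w then delta_basis g (us @ [(z, w)]) else 0)" for us
        by (cases "composable_from (right_idem g) (us @ [(z, w)])")
           (simp_all add: delta_basis_ract[OF idem] delta_basis_not_composable idem_ring_path idem composable_from_append)
      have "tensor_ract (gen_delta g (as @ [b2_path z w])) (b2_path y []) =
          (if y = endpoint z w then gen_delta g (as @ [b2_path z w]) else 0)"
        unfolding eq additive_sum(2)[of "\<lambda>t. tensor_ract t (b2_path y [])", OF ract_add] act by simp
      then show ?case
        using xda_delta_zero_input[of "basis_elt g" as "[]"]
        by (cases "endpoint z w = y") (simp_all add: b2_idem_mult[OF \<open>(z, w) \<in> b2_basis\<close>])
    qed (simp_all add: xda_delta_add ract_add idem_ring_path idem)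
  qed
qed

section \<open>Degrees of the operations\<close>

lemma tensor_homog_sum:
  "(\<And>x. x \<in> S \<Longrightarrow> f x \<in> tensor_homog X d) \<Longrightarrow> sum f S \<in> tensor_homog X d"
  and tensor_homog_sum_list:
  "(\<And>x. x \<in> set xs \<Longrightarrow> h x \<in> tensor_homog X d) \<Longrightarrow> (\<Sum>x\<leftarrow>xs. h x) \<in> tensor_homog X d"
  and tensor_homog_0: "0 \<in> tensor_homog X d"
proof -
  show 0: "0 \<in> tensor_homog X d" unfolding tensor_homog_def by (cases d) simp
  have add: "s + t \<in> tensor_homog X d" if "s \<in> tensor_homog X d" "t \<in> tensor_homog X d" for s t
    using that unfolding tensor_homog_def by (cases d) (simp add: group_closure_add)
  show "(\<And>x. x \<in> S \<Longrightarrow> f x \<in> tensor_homog X d) \<Longrightarrow> sum f S \<in> tensor_homog X d"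
    by (induction S rule: infinite_finite_induct) (auto simp: 0 add)
  show "(\<And>x. x \<in> set xs \<Longrightarrow> h x \<in> tensor_homog X d) \<Longrightarrow> (\<Sum>x\<leftarrow>xs. h x) \<in> tensor_homog X d"
    by (induction xs) (auto simp: 0 add)
qed

lemma listset_weights:
  assumes "list_all2 (\<lambda>a d. a \<in> b2_homog d) as ds" "ms \<in> listset (map b2_support as)"
  shows "length ms = length as \<and> sum_list (map weight (map snd ms)) = sum_list ds"
  using assms
proof (induction as ds arbitrary: ms rule: list_all2_induct)
  case (Cons a as d ds)
  then obtain m ms' where "ms = m # ms'" "m \<in> b2_support a" "ms' \<in> listset (map b2_support as)"
    by (auto simp: set_Cons_def)
  then show ?case using Cons.IH[of ms'] b2_support_weight[OF Cons.hyps(1), of "fst m" "snd m"] by simp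
qed simp

lemma xda_delta_degree:
  assumes x: "x \<in> xda_grading (h, d)" and as: "list_all2 (\<lambda>a d'. a \<in> b2_homog d') as ds"
  shows "xda_delta x as \<in> tensor_homog xda_grading (h + (2 - (int (length as) + 1)), d + sum_list ds)"
  unfolding xda_delta_eq gen_delta_def
proof (intro tensor_homog_sum)
  fix g ms assume "g \<in> {g. coeff x g = 1}" and ms: "ms \<in> listset (map b2_support as)"
  then have g: "kind_degree (gen_kind g) = (h, d)" using x by (simp add: xda_grading_iff)
  note ws = listset_weights[OF as ms]
  have "entry_tensor g p \<in> tensor_homog xda_grading (h + (2 - (int (length as) + 1)), d + sum_list ds)"
    if p: "p \<in> set (op_table g (map snd ms))" for p
  proof -
    obtain w h' where wh: "p = (w, h')" by (cases p)
    note props = op_table_props[OF p[unfolded wh]]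
    have "b2_path (left_idem g) w \<in> b2_homog (weight w)"
      unfolding b2_homog_def weight_def by (rule group_closure.base) (use props(1) in blast)
    moreover have "basis_elt h' \<in> xda_grading (h + (2 - (int (length as) + 1)), snd (kind_degree (gen_kind h')))"
      using props(4) ws by (cases "kind_degree (gen_kind h')") (auto simp: xda_grading_iff g)
    moreover have "d + sum_list ds = weight w + snd (kind_degree (gen_kind h'))"
      using props(5) ws by (simp add: g)
    ultimately show ?thesis
      unfolding tensor_homog_def entry_tensor_def wh prod.case fst_conv snd_conv
      by (intro group_closure.base insertI2) blast
  qed
  then show "delta_basis g ms \<in> tensor_homog xda_grading (h + (2 - (int (length as) + 1)), d + sum_list ds)"
    by (auto simp: delta_basis_eq tensor_homog_0 intro!: tensor_homog_sum_list)
qed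

section \<open>The structure relation\<close>

lemma normal_word_small:
  assumes "a \<in> {0, 1}" "b \<in> {0, 1}" "c \<in> {0, 1}" "e \<in> {0, 1}"
  shows "normal_word (a, b, c, e) \<in> set small_words"
  using assms by (elim insertE emptyE) (simp_all add: small_words_def)

text \<open>Degrees of paths are nonnegative, so this bound passes to the factors of an input word
  and leaves finitely many candidates.\<close>

lemma op_entries_small:
  "list_all (\<lambda>(t, f). list_all (\<lambda>w. case weight w of (a, b, c, e) \<Rightarrow>
     a \<le> 1 \<and> b \<le> 1 \<and> c \<le> 1 \<and> e \<le> 1) t) op_entries"
  by code_simp

text \<open>The factors have nonnegative degrees whose sum is at most 1 in every coordinate, so both
  are small words, and \<open>factorizations_complete\<close> has examined all pairs of
  those.\<close>

lemma factorization:
  assumes t: "op_table g t \<noteq> []" and j: "j < length t"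
    and u: "(x, u) \<in> b2_basis" and v: "(y, v) \<in> b2_basis" and uv: "weight (u @ v) = weight (t ! j)"
  shows "(u, v) \<in> set (factorizations (t ! j))"
proof -
  obtain f where f: "(t, f) \<in> set op_entries" using op_table_nonempty[OF t] by blast
  obtain a b c e where wu: "weight u = (a, b, c, e)" by (cases "weight u") auto
  obtain a' b' c' e' where wv: "weight v = (a', b', c', e')" by (cases "weight v") auto
  have "weight (t ! j) = (a + a', b + b', c + c', e + e')" using uv by (simp add: wu wv)
  moreover have "t ! j \<in> set t" using j by simp
  ultimately have "a + a' \<le> 1 \<and> b + b' \<le> 1 \<and> c + c' \<le> 1 \<and> e + e' \<le> 1"
    using op_entries_small f unfolding list_all_iff by fastforce
  with path_weight_nonneg[OF b2_basis_is_path[OF u] wu] path_weight_nonneg[OF b2_basis_is_path[OF v] wv]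
  have "a \<in> {0, 1} \<and> b \<in> {0, 1} \<and> c \<in> {0, 1} \<and> e \<in> {0, 1}"
    "a' \<in> {0, 1} \<and> b' \<in> {0, 1} \<and> c' \<in> {0, 1} \<and> e' \<in> {0, 1}" by auto
  then have "u \<in> set small_words" "v \<in> set small_words"
    using normal_word_small[of a b c e] normal_word_small[of a' b' c' e']
      b2_basis_normal[OF u] b2_basis_normal[OF v] unfolding wu wv by metis+
  then show ?thesis
    using factorizations_complete f \<open>t ! j \<in> set t\<close> uv unfolding list_all_iff by fastforce
qed

lemma composable_words_map_snd:
  "composable_from y ms \<Longrightarrow> set ms \<subseteq> b2_basis \<Longrightarrow> composable_words y (map snd ms)"
  by (induction ms arbitrary: y) (auto simp: b2_basis_is_path b2_basis_admissible)

lemma critical_check: "critical_check g"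
  using critical_check_Z critical_check_X critical_check_Y1 critical_check_Y by (cases g) simp_all

lemma critical_words_composite:
  assumes "(t, f) \<in> set op_entries" "p \<in> set (f g)" "(s, f') \<in> set op_entries" "f' (snd p) \<noteq> []"
  shows "t @ s \<in> set (critical_words g)"
proof -
  have "t @ s \<in> set (map ((@) t) (map fst (filter (\<lambda>(s, f'). f' (snd p) \<noteq> []) op_entries)))"
    using assms(3,4) by force
  then have "t @ s \<in> set (concat (map (\<lambda>(w, h).
      map ((@) t) (map fst (filter (\<lambda>(s, f'). f' h \<noteq> []) op_entries))) (f g)))"
    unfolding set_concat set_map image_image using assms(2) by (intro UN_I[of p]) (simp_all add: split_def)
  then show ?thesis
    unfolding critical_words_def set_concat set_map image_image using assms(1)
    by (intro UN_I[of "(t, f)"]) simp_all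
qed

lemma critical_words_merge:
  assumes "(t, f) \<in> set op_entries" "f g \<noteq> []" "j < length t" "(u, v) \<in> set (factorizations (t ! j))"
  shows "take j t @ u # v # drop (j + 1) t \<in> set (critical_words g)"
proof -
  have "take j t @ u # v # drop (j + 1) t \<in> set (concat (map (\<lambda>j.
      map (\<lambda>(u, v). take j t @ u # v # drop (j + 1) t) (factorizations (t ! j))) [0..<length t]))"
    unfolding set_concat set_map image_image using assms(3,4) by (intro UN_I[of j]) force+
  then show ?thesis
    unfolding critical_words_def set_concat set_map image_image using assms(1,2)
    by (intro UN_I[of "(t, f)"]) simp_all
qed

lemma composite_terms_critical:
  assumes "composite_terms g ws \<noteq> []"
  shows "ws \<in> set (critical_words g)"
proof -
  from assms obtain r where "r \<in> set (composite_terms g ws)" by (meson last_in_set)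
  then have "\<exists>j. \<exists>p \<in> set (op_table g (take j ws)). \<exists>q. q \<in> set (op_table (snd p) (drop j ws))"
    unfolding composite_terms_def set_concat set_map by (auto simp: split_def simp del: upt_Suc)
  then obtain j p q where p: "p \<in> set (op_table g (take j ws))"
    and q: "q \<in> set (op_table (snd p) (drop j ws))" by blast
  have "op_table g (take j ws) \<noteq> []" "op_table (snd p) (drop j ws) \<noteq> []" using p q by force+
  then obtain f f' where f: "(take j ws, f) \<in> set op_entries" "(drop j ws, f') \<in> set op_entries"
    by (metis op_table_nonempty)
  then show ?thesis
    using critical_words_composite[of "take j ws" f p g "drop j ws" f'] p
      op_entries_op_table[OF f(1), of g] op_entries_op_table[OF f(2), of "snd p"]
      \<open>op_table (snd p) (drop j ws) \<noteq> []\<close> by simp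
qed

text \<open>A surviving merge term exhibits a table input \<open>t\<close> whose entry at
  \<open>j\<close> is the product of two neighbours of the given sequence; factoring this entry
  gives the sequence back.\<close>

lemma merge_terms_critical:
  assumes ms: "set ms \<subseteq> b2_basis" "composable_from (right_idem g) ms" and ne: "merge_terms g (map snd ms) \<noteq> []"
  shows "map snd ms \<in> set (critical_words g)"
proof -
  define ws where "ws = map snd ms"
  from ne obtain j where j: "j < length ws - 1"
    and adm: "admissible (foldl endpoint (right_idem g) (take j ws)) (weight (ws ! j @ ws ! (j + 1)))"
    and op: "op_table g (take j ws @ normal_word (weight (ws ! j @ ws ! (j + 1))) # drop (j + 2) ws) \<noteq> []"
    unfolding merge_terms_def ws_def concat_eq_Nil_conv by (fastforce simp: Let_def split: if_splits)
  define d where "d = weight (ws ! j @ ws ! (j + 1))"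
  define t where "t = take j ws @ normal_word d # drop (j + 2) ws"
  have t: "j < length t" "t ! j = normal_word d" "take j t = take j ws" "drop (j + 1) t = drop (j + 2) ws"
    using j by (simp_all add: t_def nth_append One_nat_def)
  obtain x u where m1: "ms ! j = (x, u)" by (cases "ms ! j")
  obtain y v where m2: "ms ! (j + 1) = (y, v)" by (cases "ms ! (j + 1)")
  have uv: "ws ! j = u" "ws ! (j + 1) = v" using j m1 m2 by (simp_all add: ws_def)
  have basis: "(x, u) \<in> b2_basis" "(y, v) \<in> b2_basis"
    using ms(1) j nth_mem[of j ms] nth_mem[of "j + 1" ms] by (auto simp: ws_def m1 m2)
  have split: "ms = take j ms @ (x, u) # (y, v) # drop (j + 2) ms"
    using j m1 m2 id_take_nth_drop[of j ms] Cons_nth_drop_Suc[of "j + 1" ms]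
    by (simp add: ws_def One_nat_def)
  have "composable_from (right_idem g) (take j ms @ (x, u) # (y, v) # drop (j + 2) ms)"
    using ms(2) split by simp
  then have "x = foldl endpoint (right_idem g) (take j ws)" "endpoint x u = y"
    by (simp_all add: composable_from_append ws_def take_map)
  \<comment> \<open>\<open>normal_word\<close> has junk values, so the neighbours must be known to
    compose to a nonzero path before \<open>t ! j\<close> is known to have degree
    \<open>d\<close>.\<close>
  then have "is_path x (u @ v)" "admissible x (weight (u @ v))"
    using basis adm by (simp_all add: uv b2_basis_is_path)
  then have "weight (t ! j) = weight (u @ v)"
    using b2_path_normal[of x "u @ v"] by (simp add: t d_def uv)
  then have "(u, v) \<in> set (factorizations (t ! j))"
    using factorization[OF _ t(1) basis] op by (simp add: t_def d_def)
  moreover obtain f where f: "(t, f) \<in> set op_entries" "f g \<noteq> []"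
    using op op_table_nonempty[of g t] op_entries_op_table by (metis d_def t_def)
  moreover have "ws = take j t @ u # v # drop (j + 1) t"
  proof -
    have "ws = map snd (take j ms @ (x, u) # (y, v) # drop (j + 2) ms)"
      using split by (simp only: ws_def)
    also have "\<dots> = take j ws @ u # v # drop (j + 2) ws"
      by (simp only: ws_def map_append list.map snd_conv take_map drop_map)
    finally show ?thesis unfolding t .
  qed
  ultimately show ?thesis using t(1) critical_words_merge[of t f g j u v] by (simp add: ws_def)
qed

lemma relation_holds_basis:
  assumes "set ms \<subseteq> b2_basis" "composable_from (right_idem g) ms"
  shows "relation_holds g (map snd ms)"
proof (cases "map snd ms \<in> set (critical_words g)")
  case True
  then show ?thesis using critical_check[of g] composable_words_map_snd[OF assms(2,1)]
    unfolding critical_check_def list_all_iff by blast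
next
  case False
  then have "composite_terms g (map snd ms) = []" "merge_terms g (map snd ms) = []"
    using composite_terms_critical merge_terms_critical[OF assms] by blast+
  then show ?thesis by (simp add: relation_holds_def)
qed

section \<open>From term lists to tensors\<close>

lemma cancels_sum_list:
  fixes f :: "'a \<Rightarrow> 'b::ab_group_add"
  assumes "\<And>x. f x + f x = 0"
  shows "cancels xs \<Longrightarrow> (\<Sum>x\<leftarrow>xs. f x) = 0"
proof (induction xs rule: cancels.induct)
  case (2 x xs)
  then have "(\<Sum>x\<leftarrow>xs. f x) = f x + (\<Sum>x\<leftarrow>remove1 x xs. f x)"
    by (intro sum_list_map_remove1) simp
  then show ?case using 2 assms by simp
qed simp

text \<open>Undoes the recording of an output by its degree: the left idempotent of \<open>g\<close>
  and the degree fix the algebra element, zero included.\<close>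

definition term_tensor :: "gen \<Rightarrow> alex \<times> gen \<Rightarrow> xda b2_tensor" where
  "term_tensor g p = (if admissible (left_idem g) (fst p)
     then b2_path (left_idem g) (normal_word (fst p)) \<otimes> basis_elt (snd p) else 0)"

lemma term_tensor_path:
  assumes "is_path (left_idem g) w"
  shows "b2_path (left_idem g) w \<otimes> basis_elt h = term_tensor g (weight w, h)"
  using b2_path_normal[OF assms] by (auto simp: term_tensor_def split: if_splits)

lemma sum_relation_holds:
  assumes "relation_holds g ws"
  shows "(\<Sum>p\<leftarrow>composite_terms g ws. term_tensor g p) + (\<Sum>p\<leftarrow>merge_terms g ws. term_tensor g p) = 0"
proof -
  have "(\<Sum>p\<leftarrow>ps. term_tensor g p) = (\<Sum>p\<leftarrow>filter (\<lambda>(d, h). admissible (left_idem g) d) ps. term_tensor g p)" for ps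
    by (induction ps) (auto simp: term_tensor_def)
  also have "(\<Sum>p\<leftarrow>filter (\<lambda>(d, h). admissible (left_idem g) d) (composite_terms g ws @ merge_terms g ws).
      term_tensor g p) = 0"
    using assms unfolding relation_holds_def by (intro cancels_sum_list) simp_all
  finally show ?thesis by (simp only: map_append sum_list_append)
qed

definition lift_delta :: "b2 list \<Rightarrow> xda b2_tensor \<Rightarrow> xda b2_tensor" where
  "lift_delta bs = tensor_lift (\<lambda>b y. tensor_lmult b (xda_delta y bs))"

text \<open>\<open>tensor_lift\<close> can be evaluated only on balanced maps; the balance is
  supplied by left linearity of \<open>xda_delta\<close>.\<close>

lemma lift_delta_add: "lift_delta bs (s + t) = lift_delta bs s + lift_delta bs t"
  and lift_delta_tensor [simp]: "lift_delta bs (b \<otimes> y) = tensor_lmult b (xda_delta y bs)"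
  unfolding lift_delta_def
  by (rule tensor_lift_add tensor_lift_tensor;
      simp add: tensor_lmult_add_left tensor_lmult_add xda_delta_add tensor_lmult_mult xda_delta_left_linear)+

lemma lift_delta_add_input:
  "lift_delta (us @ (a + b) # vs) t = lift_delta (us @ a # vs) t + lift_delta (us @ b # vs) t"
  by (induction t rule: tensor_induct)
     (simp_all add: xda_delta_add_input tensor_lmult_add lift_delta_add algebra_simps)

text \<open>The generator between the two operations has as right idempotent the vertex where
  \<open>us\<close> ends, so the conditions on \<open>us\<close> for the first operation and on
  \<open>vs\<close> for the second combine to composability of the whole sequence.\<close>

lemma lift_delta_basis:
  assumes us: "set us \<subseteq> b2_basis" and vs: "set vs \<subseteq> b2_basis"
  shows "lift_delta (map basis_path vs) (gen_delta g (map basis_path us)) =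
    (if composable_from (right_idem g) (us @ vs)
     then (\<Sum>p\<leftarrow>concat (map (\<lambda>(w, h). map (\<lambda>(w', h'). (weight (w @ w'), h')) (op_table h (map snd vs)))
            (op_table g (map snd us))). term_tensor g p)
     else 0)"
proof (cases "composable_from (right_idem g) us")
  case False
  then show ?thesis
    using additive_sum(1)[of "lift_delta _", OF lift_delta_add]
    by (simp add: gen_delta_basis[OF us] delta_basis_not_composable composable_from_append)
next
  case True
  define y where "y = foldl endpoint (right_idem g) (map snd us)"
  have entry: "lift_delta (map basis_path vs) (entry_tensor g (w, h)) =
      (if composable_from y vs
       then (\<Sum>p\<leftarrow>map (\<lambda>(w', h'). (weight (w @ w'), h')) (op_table h (map snd vs)). term_tensor g p) else 0)"
    if wh: "(w, h) \<in> set (op_table g (map snd us))" for w h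
  proof -
    note props = op_table_props[OF wh]
    have "(\<Sum>p\<leftarrow>ps. tensor_lmult (b2_path (left_idem g) w) (entry_tensor h p)) =
        (\<Sum>p\<leftarrow>map (\<lambda>(w', h'). (weight (w @ w'), h')) ps. term_tensor g p)"
      if "set ps \<subseteq> set (op_table h (map snd vs))" for ps
      using that
    proof (induction ps)
      case (Cons p ps)
      obtain w' h' where p: "p = (w', h')" by (cases p)
      have "is_path (left_idem g) (w @ w')"
        using Cons.prems op_table_props(1)[of w' h' h "map snd vs"] props(1,2) by (simp add: p)
      then show ?case using Cons term_tensor_path[of g "w @ w'" h'] props(2)
        by (simp add: p entry_tensor_def b2_path_mult)
    qed simp
    from this[OF subset_refl] show ?thesis
      using props(3)
      by (simp add: entry_tensor_def[of g] gen_delta_basis[OF vs] delta_basis_eq o_def y_def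
          additive_sum(3)[of "tensor_lmult _", OF tensor_lmult_add])
  qed
  have "lift_delta (map basis_path vs) (\<Sum>p\<leftarrow>ps. entry_tensor g p) =
      (if composable_from y vs
       then (\<Sum>p\<leftarrow>concat (map (\<lambda>(w, h). map (\<lambda>(w', h'). (weight (w @ w'), h')) (op_table h (map snd vs))) ps).
           term_tensor g p) else 0)"
    if "set ps \<subseteq> set (op_table g (map snd us))" for ps
    using that
  proof (induction ps)
    case Nil
    show ?case using additive_sum(1)[of "lift_delta _", OF lift_delta_add] by simp
  next
    case (Cons p ps)
    then show ?case using entry[of "fst p" "snd p"] by (simp add: lift_delta_add split_def)
  qed
  from this[OF subset_refl] show ?thesis
    using True by (simp add: gen_delta_basis[OF us] delta_basis_eq composable_from_append y_def)
qed

text \<open>The product of two basis elements is governed by its degree: it is zero if they do not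
  meet or the degree is inadmissible, and otherwise the basis element of that degree. Only the last
  case yields terms.\<close>

lemma gen_delta_merge:
  assumes ms: "set ms \<subseteq> b2_basis" and j: "j < length ms - 1"
  shows "gen_delta g (take j (map basis_path ms) @
      (map basis_path ms ! j * map basis_path ms ! (j + 1)) # drop (j + 2) (map basis_path ms)) =
    (if composable_from (right_idem g) ms
     then (\<Sum>p\<leftarrow>(let ws = map snd ms; d = weight (ws ! j @ ws ! (j + 1)) in
        if admissible (foldl endpoint (right_idem g) (take j ws)) d
        then map (\<lambda>(w, h). (weight w, h)) (op_table g (take j ws @ normal_word d # drop (j + 2) ws))
        else []). term_tensor g p)
     else 0)"
proof -
  define us where "us = take j ms"
  define vs where "vs = drop (j + 2) ms"
  obtain x u where m1: "ms ! j = (x, u)" by (cases "ms ! j")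
  obtain y v where m2: "ms ! (j + 1) = (y, v)" by (cases "ms ! (j + 1)")
  have split: "ms = us @ (x, u) # (y, v) # vs"
    using j m1 m2 id_take_nth_drop[of j ms] Cons_nth_drop_Suc[of "j + 1" ms]
    by (simp add: us_def vs_def One_nat_def)
  have nth: "map basis_path ms ! j = b2_path x u" "map basis_path ms ! (j + 1) = b2_path y v"
    "map snd ms ! j = u" "map snd ms ! (j + 1) = v"
    using j m1 m2 by simp_all
  have take_drop: "take j (map f ms) = map f us" "drop (j + 2) (map f ms) = map f vs" for f :: "source_word \<Rightarrow> 'z"
    by (simp_all only: us_def vs_def take_map drop_map)
  have basis: "set us \<subseteq> b2_basis" "set vs \<subseteq> b2_basis" "(x, u) \<in> b2_basis" "(y, v) \<in> b2_basis"
    using ms by (auto simp: split)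
  define z where "z = foldl endpoint (right_idem g) (map snd us)"
  define d where "d = weight (u @ v)"
  have comp: "composable_from (right_idem g) ms \<longleftrightarrow>
      composable_from (right_idem g) us \<and> x = z \<and> y = endpoint x u \<and> composable_from (endpoint y v) vs"
    unfolding split by (auto simp: composable_from_append z_def)
  have zero: "gen_delta g (map basis_path us @ 0 # map basis_path vs) = 0"
    using xda_delta_zero_input[of "basis_elt g" "map basis_path us"] unfolding xda_delta_basis .
  consider (nomatch) "endpoint x u \<noteq> y" | (vanish) "endpoint x u = y" "\<not> admissible x d"
    | (adm) "endpoint x u = y" "admissible x d" by blast
  then show ?thesis
  proof cases
    case nomatch
    then have "b2_path x u * b2_path y v = 0" by (simp add: b2_path_mult)
    then show ?thesis using zero nomatch unfolding nth take_drop comp by auto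
  next
    case vanish
    have "is_path x (u @ v)" using vanish basis by (simp add: b2_basis_is_path)
    then have "b2_path x u * b2_path y v = 0"
      using vanish b2_path_normal[of x "u @ v"] by (simp add: b2_path_mult d_def)
    then show ?thesis using zero vanish unfolding nth take_drop comp Let_def
      by (auto simp: z_def[symmetric] d_def)
  next
    case adm
    have path: "is_path x (u @ v)" using adm basis by (simp add: b2_basis_is_path)
    with adm(2) have n: "(x, normal_word d) \<in> b2_basis" "weight (normal_word d) = d"
      "b2_path x u * b2_path y v = basis_path (x, normal_word d)"
      using b2_path_normal[OF path] adm(1) by (simp_all add: b2_path_mult d_def)
    \<comment> \<open>Equal degree means equal endpoint, so composability with the remaining inputs
      is the same before and after multiplication.\<close>
    have "endpoint x (normal_word d) = endpoint y v"
      using endpoint_determined[OF b2_basis_is_path[OF n(1)] path] n(2) adm(1) by (simp add: d_def)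
    then have comp': "composable_from (right_idem g) (us @ (x, normal_word d) # vs) \<longleftrightarrow>
        composable_from (right_idem g) ms"
      using adm(1) unfolding comp by (auto simp: composable_from_append z_def)
    have "gen_delta g (map basis_path us @ basis_path (x, normal_word d) # map basis_path vs) =
        delta_basis g (us @ (x, normal_word d) # vs)"
      using gen_delta_basis[of "us @ (x, normal_word d) # vs" g] basis n(1) by simp
    also have "\<dots> = (if composable_from (right_idem g) ms
        then (\<Sum>p\<leftarrow>op_table g (map snd us @ normal_word d # map snd vs). entry_tensor g p) else 0)"
      unfolding delta_basis_eq comp' by simp
    also have "(\<Sum>p\<leftarrow>op_table g (map snd us @ normal_word d # map snd vs). entry_tensor g p) =
        (\<Sum>p\<leftarrow>map (\<lambda>(w, h). (weight w, h)) (op_table g (map snd us @ normal_word d # map snd vs)). term_tensor g p)"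
    proof -
      have "(\<Sum>p\<leftarrow>ps. entry_tensor g p) = (\<Sum>p\<leftarrow>map (\<lambda>(w, h). (weight w, h)) ps. term_tensor g p)"
        if "set ps \<subseteq> set (op_table g (map snd us @ normal_word d # map snd vs))" for ps
        using that
      proof (induction ps)
        case (Cons p ps)
        then show ?case
          using op_table_props(1)[of "fst p" "snd p" g "map snd us @ normal_word d # map snd vs"]
            term_tensor_path[of g "fst p" "snd p"]
          by (simp add: entry_tensor_def split_def)
      qed simp
      then show ?thesis by simp
    qed
    finally show ?thesis
      using adm(2) unfolding nth take_drop n(3) Let_def d_def[symmetric] z_def[symmetric] comp by auto
  qed
qed

definition relation_sum :: "xda \<Rightarrow> b2 list \<Rightarrow> xda b2_tensor" where
  "relation_sum x as = (\<Sum>j\<le>length as. lift_delta (drop j as) (xda_delta x (take j as)))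
     + (\<Sum>j<length as - 1. xda_delta x (take j as @ (as ! j * as ! (j + 1)) # drop (j + 2) as))"

lemma relation_sum_basis:
  assumes ms: "set ms \<subseteq> b2_basis"
  shows "relation_sum (basis_elt g) (map basis_path ms) = 0"
proof -
  have sum_list_concat: "(\<Sum>p\<leftarrow>concat (map F [0..<n]). f p) = (\<Sum>j<n. \<Sum>p\<leftarrow>F j. f p)"
    for F :: "nat \<Rightarrow> (alex \<times> gen) list" and f :: "alex \<times> gen \<Rightarrow> xda b2_tensor" and n
    by (induction n) (simp_all add: add.commute)
  have "lift_delta (drop j (map basis_path ms)) (gen_delta g (take j (map basis_path ms))) =
    (if composable_from (right_idem g) ms
     then (\<Sum>p\<leftarrow>concat (map (\<lambda>(w, h). map (\<lambda>(w', h'). (weight (w @ w'), h'))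
        (op_table h (drop j (map snd ms)))) (op_table g (take j (map snd ms)))). term_tensor g p) else 0)" for j
  proof -
    have "set (take j ms) \<subseteq> b2_basis" "set (drop j ms) \<subseteq> b2_basis"
      by (rule order_trans[OF set_take_subset ms] order_trans[OF set_drop_subset ms])+
    from lift_delta_basis[OF this, of g] show ?thesis
      unfolding take_map drop_map append_take_drop_id .
  qed
  then have "(\<Sum>j\<le>length ms. lift_delta (drop j (map basis_path ms)) (gen_delta g (take j (map basis_path ms)))) =
      (if composable_from (right_idem g) ms then \<Sum>p\<leftarrow>composite_terms g (map snd ms). term_tensor g p else 0)"
    unfolding composite_terms_def sum_list_concat by (simp add: lessThan_Suc_atMost)
  moreover have "(\<Sum>j<length ms - 1. gen_delta g (take j (map basis_path ms) @
      (map basis_path ms ! j * map basis_path ms ! (j + 1)) # drop (j + 2) (map basis_path ms))) =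
      (if composable_from (right_idem g) ms then \<Sum>p\<leftarrow>merge_terms g (map snd ms). term_tensor g p else 0)"
    unfolding merge_terms_def sum_list_concat using gen_delta_merge[OF ms, of _ g]
    by (auto simp: Let_def intro!: sum.cong sum.neutral)
  ultimately show ?thesis
    using sum_relation_holds[OF relation_holds_basis[OF ms, of g]]
    by (auto simp: relation_sum_def)
qed

section \<open>Reduction of the structure relation to basis elements\<close>

lemma relation_sum_add: "relation_sum (x + y) as = relation_sum x as + relation_sum y as"
  by (simp add: relation_sum_def xda_delta_add lift_delta_add sum.distrib algebra_simps)

lemma sum_terms_add:
  fixes f g h :: "nat \<Rightarrow> 'a::ab_group_add"
  assumes "\<And>j. j \<in> A \<Longrightarrow> f j = g j + h j"
  shows "sum f A = sum g A + sum h A"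
  using assms by (simp add: sum.distrib[symmetric])

lemma relation_sum_add_input:
  "relation_sum x (as @ (a + b) # bs) = relation_sum x (as @ a # bs) + relation_sum x (as @ b # bs)"
proof -
  let ?c = "\<lambda>c. as @ c # bs" and ?n = "length as"
  have 1: "lift_delta (drop j (?c (a + b))) (xda_delta x (take j (?c (a + b)))) =
      lift_delta (drop j (?c a)) (xda_delta x (take j (?c a))) +
      lift_delta (drop j (?c b)) (xda_delta x (take j (?c b)))" for j
  proof (cases "j \<le> ?n")
    case True
    then show ?thesis by (simp add: lift_delta_add_input)
  next
    case False
    then obtain k where "j = Suc (?n + k)" by (metis less_imp_Suc_add not_le)
    then show ?thesis by (simp add: xda_delta_add_input lift_delta_add)
  qed
  have 2: "xda_delta x (take j (?c (a + b)) @ (?c (a + b) ! j * ?c (a + b) ! (j + 1)) # drop (j + 2) (?c (a + b))) =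
      xda_delta x (take j (?c a) @ (?c a ! j * ?c a ! (j + 1)) # drop (j + 2) (?c a)) +
      xda_delta x (take j (?c b) @ (?c b ! j * ?c b ! (j + 1)) # drop (j + 2) (?c b))"
    if j: "j < length as + length bs" for j
  proof -
    \<comment> \<open>The merged pair lies before the changed input, ends with it, begins with it,
      or lies after it.\<close>
    consider "j + 1 < ?n" | "j + 1 = ?n" | "j = ?n" | k where "j = Suc (?n + k)"
      by (metis Suc_eq_plus1 less_antisym less_imp_Suc_add linorder_neqE_nat not_less_eq)
    then show ?thesis
    proof cases
      case 1
      then have "take j (?c c) @ (?c c ! j * ?c c ! (j + 1)) # drop (j + 2) (?c c) =
          (take j as @ (as ! j * as ! (j + 1)) # drop (j + 2) as) @ c # bs" for c
        by (simp add: nth_append)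
      then show ?thesis by (simp only: xda_delta_add_input)
    next
      case 2
      then have "take j (?c c) @ (?c c ! j * ?c c ! (j + 1)) # drop (j + 2) (?c c) =
          take j as @ (as ! j * c) # bs" for c
        by (simp add: nth_append) (simp add: One_nat_def flip: 2)
      then show ?thesis by (simp only: xda_delta_add_input distrib_left)
    next
      case 3
      then have "take j (?c c) @ (?c c ! j * ?c c ! (j + 1)) # drop (j + 2) (?c c) =
          as @ (c * bs ! 0) # drop 1 bs" for c
        by (simp add: nth_append One_nat_def)
      then show ?thesis by (simp only: xda_delta_add_input distrib_right)
    next
      case (4 k)
      then have "take j (?c c) @ (?c c ! j * ?c c ! (j + 1)) # drop (j + 2) (?c c) =
          as @ c # (take k bs @ (bs ! k * bs ! (k + 1)) # drop (k + 2) bs)" for c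
        by (simp add: nth_append numeral_eq_Suc)
      then show ?thesis by (simp only: xda_delta_add_input)
    qed
  qed
  have "(\<Sum>j<length (?c (a + b)) - 1. xda_delta x (take j (?c (a + b)) @ (?c (a + b) ! j * ?c (a + b) ! (j + 1)) # drop (j + 2) (?c (a + b)))) =
      (\<Sum>j<length (?c a) - 1. xda_delta x (take j (?c a) @ (?c a ! j * ?c a ! (j + 1)) # drop (j + 2) (?c a))) +
      (\<Sum>j<length (?c b) - 1. xda_delta x (take j (?c b) @ (?c b ! j * ?c b ! (j + 1)) # drop (j + 2) (?c b)))"
    using sum_terms_add[of "{..<length as + length bs}", OF 2] by simp
  moreover have "(\<Sum>j\<le>length (?c (a + b)). lift_delta (drop j (?c (a + b))) (xda_delta x (take j (?c (a + b))))) =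
      (\<Sum>j\<le>length (?c a). lift_delta (drop j (?c a)) (xda_delta x (take j (?c a)))) +
      (\<Sum>j\<le>length (?c b). lift_delta (drop j (?c b)) (xda_delta x (take j (?c b))))"
    by (simp only: 1 sum.distrib length_append list.size)
  ultimately show ?thesis unfolding relation_sum_def by (simp only: ac_simps)
qed

text \<open>Inputs are expanded from left to right: the prefix \<open>ms\<close> already consists of
  basis elements, and the next input is decomposed while the remaining ones stay arbitrary.\<close>

lemma multiadditive_zero:
  fixes F :: "b2 list \<Rightarrow> 'a::ab_group_add"
  assumes add: "\<And>as a b bs. F (as @ (a + b) # bs) = F (as @ a # bs) + F (as @ b # bs)"
    and basis: "\<And>ms. set ms \<subseteq> b2_basis \<Longrightarrow> F (map basis_path ms) = 0"
  shows "F as = 0"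
proof -
  have "F (map basis_path ms @ as) = 0" if "set ms \<subseteq> b2_basis" for ms
    using that
  proof (induction as arbitrary: ms)
    case (Cons a as)
    show ?case
    proof (induction a rule: b2_basis_induct)
      case zero
      show ?case using add[of "map basis_path ms" 0 0 as] by simp
    next
      case (basis x w)
      then show ?case using Cons.IH[of "ms @ [(x, w)]"] Cons.prems by simp
    qed (simp add: add)
  qed (simp add: basis)
  from this[of "[]"] show ?thesis by simp
qed

lemma relation_sum_zero: "relation_sum x as = 0"
proof (induction x rule: xda_induct)
  case zero
  show ?case using relation_sum_add[of 0 0 as] by simp
next
  case (basis g)
  show ?case by (rule multiadditive_zero) (rule relation_sum_add_input, rule relation_sum_basis)
qed (simp add: relation_sum_add)

theorem theorem1p1:
  shows "DA_bimodule xda_grading xda_delta"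
proof
  fix d :: "int \<times> alex" and x y :: xda
  show "0 \<in> xda_grading d" by (simp add: xda_grading_iff)
  show "x - y \<in> xda_grading d" if "x \<in> xda_grading d" "y \<in> xda_grading d"
    using that unfolding xda_grading_def by (rule group_closure.diff)
next
  fix d :: "int \<times> alex" and e :: b2 and x :: xda
  assume "x \<in> xda_grading d"
  then show "e \<rhd> x \<in> xda_grading d" "x \<lhd> e \<in> xda_grading d"
    by (auto simp: xda_grading_iff)
next
  fix x :: xda and as :: "b2 list"
  show "(\<Sum>j\<le>length as. tensor_lift (\<lambda>b y. tensor_lmult b (xda_delta y (drop j as))) (xda_delta x (take j as)))
       + (\<Sum>j<length as - 1. xda_delta x (take j as @ (as ! j * as ! (j + 1)) # drop (j + 2) as)) = 0"
    using relation_sum_zero[of x as] unfolding relation_sum_def lift_delta_def .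
qed (fact xda_grading_direct_sum xda_delta_add xda_delta_add_input xda_delta_balanced_first
    xda_delta_balanced xda_delta_left_linear xda_delta_right_linear_Nil xda_delta_right_linear
    xda_delta_degree)+

end
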